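(* Let $(R,\mathfrak m,\mathbb K=R/\mathfrak m)$ be a regular local ring with regular system of parameters $(x)=(x_1,\ldots,x_n)$, let $\widehat R$ be its $\mathfrak m$-adic completion, and let $f\in R[z]$, where $z$ is an indeterminate. Assume that the Newton polyhedron $\operatorname{NP}(f)\subset\mathbb R^{n+1}_{\ge0}$ of $f$ (with respect to $(x_1,\ldots,x_n,z)$) has a descendant, loose edge $\mathcal E$. If $\operatorname{in}_{\mathcal E}(f)=G\cdot H$ is a product of two coprime polynomials $G,H\in\mathbb K[X_1,\ldots,X_n,Z]$, where $G$ is monic with respect to $Z$, then there exist $\widehat g,\widehat h\in\widehat R[z]$ such that $$f=\widehat g\cdot\widehat h\quad\text{in }\widehat R[z],$$ where $\widehat g$ is monic in $z$, and there exist compact faces $\mathcal E_1$ of $\operatorname{NP}(\widehat g)$ and $\mathcal E_2$ of $\operatorname{NP}(\widehat h)$, each of dimension at most one, such that $\mathcal E=\mathcal E_1+\mathcal E_2$ (Minkowski sum), $\operatorname{in}_{\mathcal E_1}(\widehat g)=G$ and $\operatorname{in}_{\mathcal E_2}(\widehat h)=H$.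
   Context: Multi-index notation: $x^A=x_1^{A_1}\cdots x_n^{A_n}$ for $A\in\mathbb Z_{\ge0}^n$. The ring $R$ need not be complete and may have mixed characteristic. Newton polyhedron. Every nonzero $f\in R[z]$ has a finite expansion $f=\sum_{(A,b)}\rho_{A,b}\,x^Az^b$ with $A\in\mathbb Z^n_{\ge0}$, $b\in\mathbb Z_{\ge0}$, $\rho_{A,b}\in R^\times\cup\{0\}$. The Newton polyhedron $\operatorname{NP}(f)\subset\mathbb R^{n+1}_{\ge0}$ is the smallest closed convex subset containing $\{(A,b)\mid\rho_{A,b}\ne0\}+\mathbb R^{n+1}_{\ge0}$ (it does not depend on the chosen expansion). The last coordinate of $\mathbb R^{n+1}$ corresponds to $z$. Since $\widehat R$ is again a regular local ring with regular system of parameters $(x)$ and residue field $\mathbb K$, the same definitions apply to elements of $\widehat R[z]$. Faces. A linear form $L:\mathbb R^{n+1}\to\mathbb R$ is a map $L(v)=\lambda_1v_1+\cdots+\lambda_{n+1}v_{n+1}$ with fixed $\lambda_i\ge0$; it is positive if all $\lambda_i>0$. A compact face of $\operatorname{NP}(f)$ is a set $\mathcal F$ of all points of $\operatorname{NP}(f)$ at which some positive linear form $L$ attains its minimum on $\operatorname{NP}(f)$. A vertex (resp. edge) is a compact face of dimension $0$ (resp. $1$). A loose edge is a compact edge that is not contained in any compact face of dimension $\ge2$. An edge is called descendant if it is parallel to a vector $\delta=(\delta_1,\ldots,\delta_{n+1})\in\mathbb R^{n+1}$ with $\delta_i\ge0$ for $1\le i\le n$ and $\delta_{n+1}<0$.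 Initial form. For a compact face $\mathcal F$ of $\operatorname{NP}(f)$ and a finite expansion $f=\sum_{(A,b)}\rho_{A,b}\,x^Az^b$ with $A\in\mathbb Z^n_{\ge0}$, $b\in\mathbb Z_{\ge0}$, $\rho_{A,b}\in R^\times\cup\{0\}$, the initial form of $f$ along $\mathcal F$ is $\operatorname{in}_{\mathcal F}(f)=\sum_{(A,b)\in\mathcal F}\overline{\rho_{A,b}}\,X^AZ^b\in\mathbb K[X_1,\ldots,X_n,Z]$, where $\overline{\rho_{A,b}}=\rho_{A,b}\bmod\mathfrak m\in\mathbb K$. Equivalently, it is the sum of those terms for which $L(A,b)$ is minimal, for any positive linear form $L$ determining $\mathcal F$. It depends only on $f$, $(x,z)$ and $\mathcal F$. *)

theory Defs
  imports
    "HOL-Analysis.Analysis"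
    "HOL-Library.Poly_Mapping"
    "HOL-Library.Set_Algebras"
    "HOL-Library.Extended_Nat"
    "HOL-Computational_Algebra.Polynomial"
begin

section \<open>Ideals and Krull dimension\<close>

context comm_ring_1
begin

text \<open>Inside the class context the library notion of a submodule is not available;
  the lemma \<open>ring_ideal_iff_subspace\<close> below shows that ideals are the submodules
  of the ring over itself.\<close>

definition ring_ideal :: "'a set \<Rightarrow> bool" where
  "ring_ideal I \<longleftrightarrow> 0 \<in> I \<and> (\<forall>a\<in>I. \<forall>b\<in>I. a + b \<in> I) \<and> (\<forall>r. \<forall>a\<in>I. r * a \<in> I)"

definition prime_ideal :: "'a set \<Rightarrow> bool" where
  "prime_ideal P \<longleftrightarrow> ring_ideal P \<and> P \<noteq> UNIV \<and> (\<forall>a b. a * b \<in> P \<longrightarrow> a \<in> P \<or> b \<in> P)"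

definition maximal_ideal :: "'a set \<Rightarrow> bool" where
  "maximal_ideal M \<longleftrightarrow>
     ring_ideal M \<and> M \<noteq> UNIV \<and> (\<forall>I. ring_ideal I \<longrightarrow> M \<subseteq> I \<longrightarrow> I = M \<or> I = UNIV)"

definition ideal_generated :: "'a set \<Rightarrow> 'a set" where
  "ideal_generated S = ring_ideal hull S"

definition krull_dim :: "'a itself \<Rightarrow> enat" where
  "krull_dim _ =
     (SUP k\<in>{k. \<exists>P. (\<forall>i\<le>k. prime_ideal (P i)) \<and> (\<forall>i<k. P i \<subset> P (Suc i))}. enat k)"

end

lemma ring_ideal_iff_subspace:
  "ring_ideal (I :: 'a::comm_ring_1 set) \<longleftrightarrow> module.subspace (*) I"
proof -
  interpret m: module "(*) :: 'a \<Rightarrow> 'a \<Rightarrow> 'a"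
    by unfold_locales (simp_all add: algebra_simps)
  show ?thesis
    by (simp add: ring_ideal_def m.subspace_def)
qed

lemma ideal_generated_eq_span:
  "ideal_generated (S :: 'a::comm_ring_1 set) = module.span (*) S"
proof -
  interpret m: module "(*) :: 'a \<Rightarrow> 'a \<Rightarrow> 'a"
    by unfold_locales (simp_all add: algebra_simps)
  have "ring_ideal = m.subspace"
    by (rule ext) (rule ring_ideal_iff_subspace)
  then show ?thesis
    unfolding ideal_generated_def m.span_def by simp
qed

lemma ring_ideal_ideal_generated: "ring_ideal (ideal_generated (S :: 'a::comm_ring_1 set))"
  unfolding ideal_generated_def hull_def ring_ideal_def by blast

primrec ideal_power :: "'a::comm_ring_1 set \<Rightarrow> nat \<Rightarrow> 'a set" where
  "ideal_power I 0 = UNIV"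
| "ideal_power I (Suc k) = ideal_generated {a * b | a b. a \<in> ideal_power I k \<and> b \<in> I}"

lemma ring_ideal_ideal_power: "ring_ideal (ideal_power I k)"
  by (cases k) (simp_all add: ring_ideal_ideal_generated, simp add: ring_ideal_def)

lemma ring_ideal_diff:
  assumes "ring_ideal (I :: 'a::comm_ring_1 set)" "a \<in> I" "b \<in> I"
  shows "a - b \<in> I"
proof -
  have "(-1) * b \<in> I"
    using assms unfolding ring_ideal_def by blast
  then have "a + (-1) * b \<in> I"
    using assms unfolding ring_ideal_def by blast
  then show ?thesis by simp
qed

lemma ideal_power_1:
  assumes "ring_ideal I"
  shows "ideal_power I (Suc 0) = I"
proof -
  have "{a * b | a b. a \<in> UNIV \<and> b \<in> I} = I"
    using assms unfolding ring_ideal_def by (auto, metis mult_1)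
  moreover have "ring_ideal hull I = I"
    using assms by (rule hull_same)
  ultimately show ?thesis
    by (simp add: ideal_generated_def)
qed


section \<open>Regular local rings\<close>

class local_ring = comm_ring_1 +
  assumes unique_maximal_ideal: "\<exists>!M. maximal_ideal M"
begin

definition max_ideal :: "'a set" where
  "max_ideal = (THE M. maximal_ideal M)"

lemma maximal_ideal_max_ideal: "maximal_ideal max_ideal"
  unfolding max_ideal_def by (rule theI') (rule unique_maximal_ideal)

end

text \<open>A noetherian local ring is regular if its maximal ideal can be generated by as many
  elements as its Krull dimension; such generators form a regular system of parameters.\<close>

class regular_local_ring = local_ring +
  assumes noetherian: "ring_ideal I \<Longrightarrow> \<exists>S. finite S \<and> I = ideal_generated S"
    and regular: "\<exists>S. finite S \<and> max_ideal = ideal_generated S \<and> enat (card S) = krull_dim TYPE('a)"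

definition regular_system_of_parameters :: "('n::finite \<Rightarrow> 'a::regular_local_ring) \<Rightarrow> bool" where
  "regular_system_of_parameters x \<longleftrightarrow>
     max_ideal = ideal_generated (range x) \<and> enat CARD('n) = krull_dim TYPE('a)"

lemma ring_ideal_max_ideal: "ring_ideal (max_ideal :: 'a::local_ring set)"
  using maximal_ideal_max_ideal[where 'a = 'a] by (simp add: maximal_ideal_def)


section \<open>The residue field\<close>

quotient_type (overloaded) 'a residue_field = "'a::local_ring" / "\<lambda>a b. a - b \<in> max_ideal"
  morphisms rep_residue to_residue
proof (rule equivpI)
  note I = ring_ideal_max_ideal[where 'a = 'a]
  have zero: "(0::'a) \<in> max_ideal"
    using I by (simp add: ring_ideal_def)
  show "reflp (\<lambda>a b::'a. a - b \<in> max_ideal)"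
    by (rule reflpI) (simp add: zero)
  show "symp (\<lambda>a b::'a. a - b \<in> max_ideal)"
    by (rule sympI) (use ring_ideal_diff[OF I zero] in fastforce)
  show "transp (\<lambda>a b::'a. a - b \<in> max_ideal)"
  proof (rule transpI)
    fix a b c :: 'a
    assume "a - b \<in> max_ideal" "b - c \<in> max_ideal"
    then have "(a - b) + (b - c) \<in> max_ideal"
      using I unfolding ring_ideal_def by blast
    then show "a - c \<in> max_ideal" by simp
  qed
qed

text \<open>Congruence modulo an ideal is compatible with the ring operations.\<close>

lemma ideal_cong:
  assumes I: "ring_ideal (I :: 'a::comm_ring_1 set)"
    and "a - a' \<in> I" "b - b' \<in> I"
  shows "a + b - (a' + b') \<in> I" "a - b - (a' - b') \<in> I" "- a - - a' \<in> I"
    "a * b - a' * b' \<in> I"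
proof -
  have "(a - a') + (b - b') \<in> I"
    using assms unfolding ring_ideal_def by blast
  then show "a + b - (a' + b') \<in> I" by (simp add: algebra_simps)
  have "(a - a') - (b - b') \<in> I"
    using assms by (blast intro: ring_ideal_diff)
  then show "a - b - (a' - b') \<in> I" by (simp add: algebra_simps)
  have "(-1) * (a - a') \<in> I"
    using assms unfolding ring_ideal_def by blast
  then show "- a - - a' \<in> I" by (simp add: algebra_simps)
  have "b * (a - a') + a' * (b - b') \<in> I"
    using assms unfolding ring_ideal_def by blast
  then show "a * b - a' * b' \<in> I" by (simp add: algebra_simps)
qed

instantiation residue_field :: (local_ring) field
begin

lift_definition zero_residue_field :: "'a residue_field" is 0 .
lift_definition one_residue_field :: "'a residue_field" is 1 .
lift_definition plus_residue_field :: "'a residue_field \<Rightarrow> 'a residue_field \<Rightarrow> 'a residue_field" is "(+)"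
  by (rule ideal_cong[OF ring_ideal_max_ideal])
lift_definition minus_residue_field :: "'a residue_field \<Rightarrow> 'a residue_field \<Rightarrow> 'a residue_field" is "(-)"
  by (rule ideal_cong[OF ring_ideal_max_ideal])
lift_definition uminus_residue_field :: "'a residue_field \<Rightarrow> 'a residue_field" is "uminus"
  by (rule ideal_cong[OF ring_ideal_max_ideal])
lift_definition times_residue_field :: "'a residue_field \<Rightarrow> 'a residue_field \<Rightarrow> 'a residue_field" is "(*)"
  by (rule ideal_cong[OF ring_ideal_max_ideal])

definition inverse_residue_field :: "'a residue_field \<Rightarrow> 'a residue_field" where
  "inverse_residue_field a = (if a = 0 then 0 else (SOME b. b * a = 1))"
definition divide_residue_field :: "'a residue_field \<Rightarrow> 'a residue_field \<Rightarrow> 'a residue_field" where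
  "divide_residue_field a b = a * inverse b"

instance
proof
  have refl: "u = v \<Longrightarrow> u - v \<in> max_ideal" for u v :: 'a
    using ring_ideal_max_ideal[where 'a = 'a] by (simp add: ring_ideal_def)
  fix a b c :: "'a residue_field"
  show "a + b + c = a + (b + c)" by transfer (rule refl, simp add: algebra_simps)
  show "a + b = b + a" by transfer (rule refl, simp add: algebra_simps)
  show "0 + a = a" by transfer (rule refl, simp)
  show "- a + a = 0" by transfer (rule refl, simp)
  show "a - b = a + - b" by transfer (rule refl, simp)
  show "a * b * c = a * (b * c)" by transfer (rule refl, simp add: algebra_simps)
  show "a * b = b * a" by transfer (rule refl, simp add: algebra_simps)
  show "1 * a = a" by transfer (rule refl, simp)
  show "(a + b) * c = a * c + b * c" by transfer (rule refl, simp add: algebra_simps)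
  show "(0::'a residue_field) \<noteq> 1"
  proof transfer
    show "(0::'a) - 1 \<notin> max_ideal"
    proof
      assume "(0::'a) - 1 \<in> max_ideal"
      then have "r * ((-1) * (0 - 1)) \<in> max_ideal" for r :: 'a
        using ring_ideal_max_ideal[where 'a = 'a] unfolding ring_ideal_def by blast
      then have "(max_ideal :: 'a set) = UNIV" by auto
      then show False
        using maximal_ideal_max_ideal[where 'a = 'a] by (simp add: maximal_ideal_def)
    qed
  qed
  have ex: "\<exists>b. b * a = 1" if "a \<noteq> 0"
    using that
  proof transfer
    fix a :: 'a
    assume "a - 0 \<notin> max_ideal"
    then have a: "a \<notin> max_ideal" by simp
    define I where "I = {m + r * a | m r. m \<in> max_ideal}"
    have M: "(0::'a) \<in> max_ideal"
      "\<And>u v::'a. u \<in> max_ideal \<Longrightarrow> v \<in> max_ideal \<Longrightarrow> u + v \<in> max_ideal"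
      "\<And>u v::'a. u \<in> max_ideal \<Longrightarrow> v * u \<in> max_ideal"
      using ring_ideal_max_ideal[where 'a = 'a] by (auto simp: ring_ideal_def)
    have "ring_ideal I"
      unfolding ring_ideal_def
    proof (intro conjI ballI allI)
      show "0 \<in> I"
        unfolding I_def using M(1) by (auto intro!: exI[of _ 0])
    next
      fix u v assume "u \<in> I" "v \<in> I"
      then obtain m r m' r' where "u = m + r * a" "v = m' + r' * a"
        "m \<in> max_ideal" "m' \<in> max_ideal"
        unfolding I_def by blast
      moreover from this have "u + v = (m + m') + (r + r') * a"
        by (simp add: algebra_simps)
      ultimately show "u + v \<in> I"
        unfolding I_def using M(2) by blast
    next
      fix s u assume "u \<in> I"
      then obtain m r where "u = m + r * a" "m \<in> max_ideal"
        unfolding I_def by blast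
      moreover from this have "s * u = s * m + (s * r) * a"
        by (simp add: algebra_simps)
      ultimately show "s * u \<in> I"
        unfolding I_def using M(3) by blast
    qed
    moreover have "max_ideal \<subseteq> I"
    proof
      fix m :: 'a assume "m \<in> max_ideal"
      then have "m + 0 * a \<in> I" unfolding I_def by blast
      then show "m \<in> I" by simp
    qed
    moreover have "a \<in> I"
    proof -
      have "0 + 1 * a \<in> I" unfolding I_def using M(1) by blast
      then show ?thesis by simp
    qed
    ultimately have "I = UNIV"
      using maximal_ideal_max_ideal[where 'a = 'a] a unfolding maximal_ideal_def by blast
    then obtain m r where m: "1 = m + r * a" "m \<in> max_ideal"
      unfolding I_def by blast
    have "(-1) * m \<in> max_ideal" using M(3) m(2) by blast
    moreover have "r * a - 1 = (-1) * m" using m(1) by (simp add: algebra_simps)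
    ultimately show "\<exists>b. b * a - 1 \<in> max_ideal" by metis
  qed
  show "inverse a * a = 1" if "a \<noteq> 0"
    using someI_ex[OF ex[OF that]] that by (simp add: inverse_residue_field_def)
  show "a div b = a * inverse b" by (simp add: divide_residue_field_def)
  show "inverse (0::'a residue_field) = 0" by (simp add: inverse_residue_field_def)
qed

end


section \<open>The completion with respect to the maximal ideal\<close>

text \<open>The inverse limit of the rings \<open>R / m^k\<close>: an element is represented by a sequence \<open>u\<close>
  of representatives whose classes are compatible, and two sequences are identified
  if \<open>u k\<close> and \<open>v k\<close> agree modulo \<open>m^k\<close> for every \<open>k\<close>.\<close>

abbreviation max_ideal_power :: "nat \<Rightarrow> 'a::local_ring set" where
  "max_ideal_power \<equiv> ideal_power max_ideal"

definition coherent :: "(nat \<Rightarrow> 'a::local_ring) \<Rightarrow> bool" where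
  "coherent u \<longleftrightarrow> (\<forall>k. u (Suc k) - u k \<in> max_ideal_power k)"

definition completion_rel :: "(nat \<Rightarrow> 'a::local_ring) \<Rightarrow> (nat \<Rightarrow> 'a) \<Rightarrow> bool" where
  "completion_rel u v \<longleftrightarrow> coherent u \<and> coherent v \<and> (\<forall>k. u k - v k \<in> max_ideal_power k)"

lemma max_ideal_power_zero [simp]: "(0::'a::local_ring) \<in> max_ideal_power k"
  using ring_ideal_ideal_power[of "max_ideal :: 'a set" k] by (simp add: ring_ideal_def)

lemma coherent_const [simp]: "coherent (\<lambda>_. a)"
  by (simp add: coherent_def)

quotient_type (overloaded) 'a completion = "nat \<Rightarrow> 'a::local_ring" / partial: completion_rel
proof (rule part_equivpI)
  show "\<exists>u :: nat \<Rightarrow> 'a. completion_rel u u"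
    by (rule exI[of _ "\<lambda>_. 0"]) (simp add: completion_rel_def)
  show "symp (completion_rel :: (nat \<Rightarrow> 'a) \<Rightarrow> _)"
  proof (rule sympI)
    fix u v :: "nat \<Rightarrow> 'a"
    assume uv: "completion_rel u v"
    have "v k - u k \<in> max_ideal_power k" for k
    proof -
      have "0 - (u k - v k) \<in> max_ideal_power k"
        by (rule ring_ideal_diff[OF ring_ideal_ideal_power max_ideal_power_zero])
          (use uv in \<open>simp add: completion_rel_def\<close>)
      then show ?thesis by simp
    qed
    with uv show "completion_rel v u" by (simp add: completion_rel_def)
  qed
  show "transp (completion_rel :: (nat \<Rightarrow> 'a) \<Rightarrow> _)"
  proof (rule transpI)
    fix u v w :: "nat \<Rightarrow> 'a"
    assume uv: "completion_rel u v" and vw: "completion_rel v w"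
    have "u k - w k \<in> max_ideal_power k" for k
    proof -
      have "(u k - v k) + (v k - w k) \<in> max_ideal_power k"
        using uv vw ring_ideal_ideal_power[of "max_ideal :: 'a set" k]
        unfolding completion_rel_def ring_ideal_def by blast
      then show ?thesis by simp
    qed
    with uv vw show "completion_rel u w" by (simp add: completion_rel_def)
  qed
qed

instantiation completion :: (local_ring) comm_ring_1
begin

lift_definition zero_completion :: "'a completion" is "\<lambda>_. 0"
  by (simp add: completion_rel_def)
lift_definition one_completion :: "'a completion" is "\<lambda>_. 1"
  by (simp add: completion_rel_def)
lift_definition plus_completion :: "'a completion \<Rightarrow> 'a completion \<Rightarrow> 'a completion"
  is "\<lambda>u v k. u k + v k"
  by (simp add: completion_rel_def coherent_def ideal_cong[OF ring_ideal_ideal_power])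
lift_definition minus_completion :: "'a completion \<Rightarrow> 'a completion \<Rightarrow> 'a completion"
  is "\<lambda>u v k. u k - v k"
  by (simp add: completion_rel_def coherent_def ideal_cong[OF ring_ideal_ideal_power])
lift_definition uminus_completion :: "'a completion \<Rightarrow> 'a completion"
  is "\<lambda>u k. - u k"
  by (unfold completion_rel_def coherent_def, intro conjI allI;
      elim conjE; rule ideal_cong(3)[OF ring_ideal_ideal_power]; blast)
lift_definition times_completion :: "'a completion \<Rightarrow> 'a completion \<Rightarrow> 'a completion"
  is "\<lambda>u v k. u k * v k"
  by (simp add: completion_rel_def coherent_def ideal_cong[OF ring_ideal_ideal_power])

instance
proof
  have refl: "completion_rel u v"
    if "completion_rel u u" "u = v" for u v :: "nat \<Rightarrow> 'a"
    using that by simp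
  note closed = completion_rel_def coherent_def ideal_cong[OF ring_ideal_ideal_power]
  fix a b c :: "'a completion"
  show "a + b + c = a + (b + c)"
    by transfer (rule refl, simp add: closed, simp add: algebra_simps)
  show "a + b = b + a"
    by transfer (rule refl, simp add: closed, simp add: algebra_simps)
  show "0 + a = a" by transfer (rule refl, simp_all)
  show "- a + a = 0" by transfer (rule refl, simp_all add: completion_rel_def)
  show "a - b = a + - b"
    by transfer (rule refl, simp add: closed, simp add: algebra_simps)
  show "a * b * c = a * (b * c)"
    by transfer (rule refl, simp add: closed, simp add: algebra_simps)
  show "a * b = b * a"
    by transfer (rule refl, simp add: closed, simp add: algebra_simps)
  show "1 * a = a" by transfer (rule refl, simp_all)
  show "(a + b) * c = a * c + b * c"
    by transfer (rule refl, simp add: closed, simp add: algebra_simps)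
  show "(0::'a completion) \<noteq> 1"
  proof transfer
    show "\<not> completion_rel (\<lambda>_. 0::'a) (\<lambda>_. 1)"
    proof
      assume "completion_rel (\<lambda>_. 0::'a) (\<lambda>_. 1)"
      then have "(0::'a) - 1 \<in> max_ideal_power (Suc 0)"
        unfolding completion_rel_def by blast
      then have "(0::'a) - 1 \<in> max_ideal"
        by (simp only: ideal_power_1[OF ring_ideal_max_ideal])
      then have "(0::'a residue_field) = 1" by transfer
      then show False by simp
    qed
  qed
qed

end

lift_definition to_completion :: "'a::local_ring \<Rightarrow> 'a completion" is "\<lambda>a _. a"
  by (simp add: completion_rel_def)

text \<open>The projection of the completion to \<open>R / m\<close>, by which its residue field is
  identified with that of \<open>R\<close>.\<close>

lift_definition completion_to_residue :: "'a::local_ring completion \<Rightarrow> 'a residue_field"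
  is "\<lambda>u. u 1"
  unfolding completion_rel_def by (metis One_nat_def ideal_power_1 ring_ideal_max_ideal)

lemma completion_to_residue_to_completion [simp]:
  "completion_to_residue (to_completion a) = to_residue a"
  by (simp add: completion_to_residue.abs_eq to_completion.abs_eq completion_rel_def
      to_residue_def to_completion_def)


section \<open>Newton polyhedra and initial forms\<close>

text \<open>The variables \<open>x\<^sub>1, \<dots>, x\<^sub>n\<close> are indexed by a finite type \<open>'n\<close>,
  and \<open>n + 1\<close>-space is \<open>real ^ 'n \<times> real\<close>, the last factor belonging to \<open>z\<close>.
  An exponent \<open>(A, b)\<close> is a pair of a finitely supported map and a natural number.
  The definitions below are made for any commutative ring with a family \<open>x\<close>;
  they are used for a regular local ring and for its completion.\<close>

type_synonym 'n exponent = "('n \<Rightarrow>\<^sub>0 nat) \<times> nat"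

definition exponent_point :: "'n::finite exponent \<Rightarrow> (real ^ 'n) \<times> real" where
  "exponent_point = (\<lambda>(A, b). (\<chi> i. real (Poly_Mapping.lookup A i), real b))"

definition monomial_value :: "('n::finite \<Rightarrow> 'r::comm_ring_1) \<Rightarrow> ('n \<Rightarrow>\<^sub>0 nat) \<Rightarrow> 'r" where
  "monomial_value x A = (\<Prod>i\<in>UNIV. x i ^ Poly_Mapping.lookup A i)"

definition is_expansion ::
    "('n::finite \<Rightarrow> 'r::comm_ring_1) \<Rightarrow> 'r poly \<Rightarrow> ('n exponent \<Rightarrow>\<^sub>0 'r) \<Rightarrow> bool" where
  "is_expansion x f \<rho> \<longleftrightarrow>
     (\<forall>e. Poly_Mapping.lookup \<rho> e = 0 \<or> Poly_Mapping.lookup \<rho> e dvd 1) \<and>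
     f = (\<Sum>(A, b)\<in>Poly_Mapping.keys \<rho>.
            monom (Poly_Mapping.lookup \<rho> (A, b) * monomial_value x A) b)"

text \<open>For a regular system of parameters, finite expansions exist and the notions below do not
  depend on the one that is chosen.\<close>

definition expansion ::
    "('n::finite \<Rightarrow> 'r::comm_ring_1) \<Rightarrow> 'r poly \<Rightarrow> ('n exponent \<Rightarrow>\<^sub>0 'r)" where
  "expansion x f = (SOME \<rho>. is_expansion x f \<rho>)"

definition nonneg_orthant :: "((real ^ 'n) \<times> real) set" where
  "nonneg_orthant = {v. (\<forall>i. 0 \<le> fst v $ i) \<and> 0 \<le> snd v}"

definition newton_polyhedron ::
    "('n::finite \<Rightarrow> 'r::comm_ring_1) \<Rightarrow> 'r poly \<Rightarrow> ((real ^ 'n) \<times> real) set" where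
  "newton_polyhedron x f =
     (\<lambda>C. closed C \<and> convex C) hull
       (exponent_point ` Poly_Mapping.keys (expansion x f) + nonneg_orthant)"

text \<open>A linear form is given by its coefficient vector \<open>l\<close>, as \<open>v \<mapsto> l \<bullet> v\<close>.\<close>

definition positive_form :: "(real ^ 'n) \<times> real \<Rightarrow> bool" where
  "positive_form l \<longleftrightarrow> (\<forall>i. 0 < fst l $ i) \<and> 0 < snd l"

definition compact_face ::
    "((real ^ 'n::finite) \<times> real) set \<Rightarrow> ((real ^ 'n) \<times> real) set \<Rightarrow> bool" where
  "compact_face P F \<longleftrightarrow>
     (\<exists>l. positive_form l \<and> F = {v \<in> P. \<forall>w\<in>P. l \<bullet> v \<le> l \<bullet> w})"

definition compact_edge ::
    "((real ^ 'n::finite) \<times> real) set \<Rightarrow> ((real ^ 'n) \<times> real) set \<Rightarrow> bool" where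
  "compact_edge P E \<longleftrightarrow> compact_face P E \<and> aff_dim E = 1"

definition loose_edge ::
    "((real ^ 'n::finite) \<times> real) set \<Rightarrow> ((real ^ 'n) \<times> real) set \<Rightarrow> bool" where
  "loose_edge P E \<longleftrightarrow>
     compact_edge P E \<and> \<not> (\<exists>F. compact_face P F \<and> 2 \<le> aff_dim F \<and> E \<subseteq> F)"

definition descendant :: "((real ^ 'n::finite) \<times> real) set \<Rightarrow> bool" where
  "descendant E \<longleftrightarrow>
     (\<exists>d. (\<forall>i. 0 \<le> fst d $ i) \<and> snd d < 0 \<and> (\<forall>v\<in>E. \<forall>w\<in>E. \<exists>t. w - v = t *\<^sub>R d))"

text \<open>The ring \<open>K[X\<^sub>1, \<dots>, X\<^sub>n, Z]\<close> is represented as \<open>K[X\<^sub>1, \<dots>, X\<^sub>n][Z]\<close>, so that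
  being monic in \<open>Z\<close> is a condition on the leading coefficient.
  The argument \<open>res\<close> is the map to the residue field.\<close>

type_synonym ('n, 'k) mpoly_Z = "(('n \<Rightarrow>\<^sub>0 nat) \<Rightarrow>\<^sub>0 'k) poly"

definition initial_form ::
    "('r::comm_ring_1 \<Rightarrow> 'k::field) \<Rightarrow> ('n::finite \<Rightarrow> 'r) \<Rightarrow> 'r poly \<Rightarrow>
     ((real ^ 'n) \<times> real) set \<Rightarrow> ('n, 'k) mpoly_Z" where
  "initial_form res x f F =
     (\<Sum>(A, b)\<in>{e \<in> Poly_Mapping.keys (expansion x f). exponent_point e \<in> F}.
        monom (Poly_Mapping.single A (res (Poly_Mapping.lookup (expansion x f) (A, b)))) b)"

text \<open>The library constant \<^const>\<open>coprime\<close>, whose class does not cover this polynomial ring,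
  is defined by the same formula.\<close>

definition coprime_elements :: "'b::comm_semiring_1 \<Rightarrow> 'b \<Rightarrow> bool" where
  "coprime_elements a b \<longleftrightarrow> (\<forall>c. c dvd a \<longrightarrow> c dvd b \<longrightarrow> c dvd 1)"

end

theory Submission
  imports Defs
begin

text \<open>Let \<open>\<delta>\<close> be the slope of the edge. Since the edge is loose, every exponent \<open>(A, b)\<close> of \<open>f\<close>
  satisfies \<open>A + b \<delta> \<ge> M\<close> componentwise for a constant vector \<open>M\<close>, with equality exactly on the edge.
  For the grading by the vectors \<open>A + b \<delta>\<close> the initial form is therefore the lowest part of \<open>f\<close>, its
  factors \<open>G\<close> and \<open>H\<close> are homogeneous, and their coprimality makes \<open>G(1, Z)\<close> and \<open>H(1, Z)\<close> coprime:
  the Euclidean algorithm can be homogenized. A Bezout identity for these two polynomials corrects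
  approximate factorizations of \<open>f\<close> as in Hensel's lemma, where the total weight of the error grows,
  so that the corrections converge in the completion.

  Newton polyhedra and initial forms can be computed from any expansion because regular
  parameters are analytically independent: a homogeneous relation with a unit coefficient would
  make the maximal ideal minimal over fewer than \<open>n\<close> elements, contrary to Krull's height theorem.
  Expansions are finite by Dickson's lemma, combined in \<open>R\<close> with Krull's intersection theorem and
  in the completion with the convergence of power series.\<close>


section \<open>Noetherian rings\<close>

text \<open>Looseness allows a whole vector of weights instead of a single one. For a fixed exponent
  \<open>b\<close> of z such a weight leaves at most one monomial in x, so setting X = 1 loses
  nothing and the residual problem is one about polynomials in one variable over a field. Two
  obstacles shape the lifting. Coefficients must be lifted from the residue field by a map that
  respects sums and products only modulo the maximal ideal; each such defect raises the total weight
  by one. Weights are real while exponents are natural numbers, so a term whose weight belongs to no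
  monomial has no lift; such terms are replaced by 0, and products must be shown not to notice. The
  descent of the edge makes \<delta> nonnegative: lowering the power of z leaves room for more x,
  which is what permits Bezout cofactors to be homogenized. Division by the monic G keeps the
  z-degrees bounded, and in bounded z-degree a large total weight means a high power of the maximal
  ideal. Each correction gains a fixed \<epsilon>, the gap in total weight between the edge and the
  other exponents of an expansion of f, capped at one.\<close>

lemma ideal_zero: "ring_ideal I \<Longrightarrow> 0 \<in> I"
  and ideal_add: "ring_ideal I \<Longrightarrow> a \<in> I \<Longrightarrow> b \<in> I \<Longrightarrow> a + b \<in> I"
  and ideal_mult: "ring_ideal I \<Longrightarrow> a \<in> I \<Longrightarrow> r * a \<in> I"
  by (auto simp: ring_ideal_def)

lemma ideal_mult_right: "ring_ideal I \<Longrightarrow> a \<in> I \<Longrightarrow> a * r \<in> (I :: 'a::comm_ring_1 set)"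
  by (metis ideal_mult mult.commute)

lemma ideal_uminus: "ring_ideal I \<Longrightarrow> a \<in> I \<Longrightarrow> - a \<in> (I :: 'a::comm_ring_1 set)"
  using ideal_mult[of I a "-1"] by simp

lemma ideal_sum:
  assumes "ring_ideal (I :: 'a::comm_ring_1 set)" "\<And>s. s \<in> S \<Longrightarrow> f s \<in> I"
  shows "sum f S \<in> I"
  using assms by (induction S rule: infinite_finite_induct) (auto intro: ideal_zero ideal_add)

lemma ring_idealI:
  assumes "0 \<in> I" "\<And>a b. a \<in> I \<Longrightarrow> b \<in> I \<Longrightarrow> a + b \<in> I" "\<And>r a. a \<in> I \<Longrightarrow> r * a \<in> I"
  shows "ring_ideal I"
  using assms by (auto simp: ring_ideal_def)

lemma ideal_generated_base: "a \<in> S \<Longrightarrow> a \<in> ideal_generated (S :: 'a::comm_ring_1 set)"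
  unfolding ideal_generated_def by (rule hull_inc)

lemma ideal_generated_least: "S \<subseteq> I \<Longrightarrow> ring_ideal I \<Longrightarrow> ideal_generated S \<subseteq> (I :: 'a::comm_ring_1 set)"
  unfolding ideal_generated_def by (rule hull_minimal)

lemma ideal_generated_mono: "S \<subseteq> T \<Longrightarrow> ideal_generated S \<subseteq> ideal_generated (T :: 'a::comm_ring_1 set)"
  unfolding ideal_generated_def by (rule hull_mono)

lemma ring_ideal_plus:
  assumes "ring_ideal (I :: 'a::comm_ring_1 set)" "ring_ideal J"
  shows "ring_ideal (I + J)"
proof (rule ring_idealI)
  show "0 \<in> I + J" using set_plus_intro[of 0 I 0 J] assms by (simp add: ideal_zero)
next
  fix a b assume "a \<in> I + J" "b \<in> I + J"
  then obtain i j i' j' where "a = i + j" "b = i' + j'" "i \<in> I" "j \<in> J" "i' \<in> I" "j' \<in> J"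
    by (elim set_plus_elim) blast
  then have "a + b = (i + i') + (j + j')" "i + i' \<in> I" "j + j' \<in> J"
    using assms by (auto intro: ideal_add)
  then show "a + b \<in> I + J" by (metis set_plus_intro)
next
  fix r a assume "a \<in> I + J"
  then obtain i j where "a = i + j" "i \<in> I" "j \<in> J" by (elim set_plus_elim) blast
  then have "r * a = r * i + r * j" "r * i \<in> I" "r * j \<in> J"
    using assms by (auto intro: ideal_mult simp: distrib_left)
  then show "r * a \<in> I + J" by (metis set_plus_intro)
qed

lemma subset_ideal_plus:
  assumes "ring_ideal (I :: 'a::comm_ring_1 set)" "ring_ideal J"
  shows "I \<subseteq> I + J" "J \<subseteq> I + J"
  using assms set_plus_intro[of _ I 0 J] set_plus_intro[of 0 I _ J]
  by (auto dest: ideal_zero)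

lemma ideal_plus_least:
  "I \<subseteq> K \<Longrightarrow> J \<subseteq> K \<Longrightarrow> ring_ideal K \<Longrightarrow> I + J \<subseteq> (K :: 'a::comm_ring_1 set)"
  by (auto elim!: set_plus_elim intro: ideal_add)

lemma ideal_plus_iff: "a \<in> I + J \<longleftrightarrow> (\<exists>i\<in>I. \<exists>j\<in>J. a = i + (j :: 'a::comm_ring_1))"
  by (auto simp: set_plus_def)

definition principal :: "'a::comm_ring_1 \<Rightarrow> 'a set" where
  "principal a = {r * a | r. True}"

lemma ring_ideal_principal: "ring_ideal (principal a)"
proof (rule ring_idealI)
  show "0 \<in> principal a" unfolding principal_def by (auto intro!: exI[of _ 0])
next
  fix u v assume "u \<in> principal a" "v \<in> principal a"
  then obtain r s where "u = r * a" "v = s * a" unfolding principal_def by blast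
  then have "u + v = (r + s) * a" by (simp add: algebra_simps)
  then show "u + v \<in> principal a" unfolding principal_def by blast
next
  fix r u assume "u \<in> principal a"
  then obtain s where "u = s * a" unfolding principal_def by blast
  then have "r * u = (r * s) * a" by (simp add: algebra_simps)
  then show "r * u \<in> principal a" unfolding principal_def by blast
qed

lemma mem_principal: "u \<in> principal a \<longleftrightarrow> (\<exists>r. u = r * a)"
  by (auto simp: principal_def)

lemma principal_self: "a \<in> principal a"
  unfolding principal_def by (auto intro: exI[of _ 1])

lemma principal_mult: "r * a \<in> principal a"
  unfolding principal_def by auto

lemma principal_least: "ring_ideal I \<Longrightarrow> a \<in> I \<Longrightarrow> principal a \<subseteq> I"
  unfolding principal_def by (auto intro: ideal_mult)

lemma prime_idealD:
  assumes "prime_ideal P"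
  shows "ring_ideal P" "1 \<notin> P" "a * b \<in> P \<Longrightarrow> a \<in> P \<or> b \<in> (P :: 'a::comm_ring_1 set)"
proof -
  show "ring_ideal P" "a * b \<in> P \<Longrightarrow> a \<in> P \<or> b \<in> P" using assms by (auto simp: prime_ideal_def)
  show "1 \<notin> P"
  proof
    assume "1 \<in> P"
    then have "r * 1 \<in> P" for r using assms by (intro ideal_mult) (auto simp: prime_ideal_def)
    then show False using assms by (auto simp: prime_ideal_def)
  qed
qed

lemma prime_ideal_power: "prime_ideal P \<Longrightarrow> a ^ k \<in> P \<Longrightarrow> a \<in> (P :: 'a::comm_ring_1 set)"
  by (induction k) (auto dest: prime_idealD(2,3))

text \<open>Krull's theorems below use finite generation of ideals alone or together with locality.
  The completion is never made an instance: there completeness takes the place of this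
  property.\<close>

class noetherian_ring = comm_ring_1 +
  assumes ideal_fg: "ring_ideal I \<Longrightarrow> \<exists>S. finite S \<and> I = ideal_generated S"

instance regular_local_ring \<subseteq> noetherian_ring
  by standard (rule noetherian)

text \<open>Zorn's lemma: the union of a chain is a finitely generated ideal, its generators already
  lie in one member of the chain, and so the union is that member. All later noetherian inductions
  go through this form.\<close>

lemma ex_maximal_ideal_in:
  fixes A :: "'a::noetherian_ring set set"
  assumes "I0 \<in> A" "\<forall>I\<in>A. ring_ideal I"
  shows "\<exists>M\<in>A. I0 \<subseteq> M \<and> (\<forall>I\<in>A. M \<subseteq> I \<longrightarrow> I = M)"
proof -
  let ?A = "{I \<in> A. I0 \<subseteq> I}"
  have "\<exists>M\<in>?A. \<forall>X\<in>?A. M \<subseteq> X \<longrightarrow> X = M"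
  proof (rule subset_Zorn_nonempty)
    show "?A \<noteq> {}" using assms by auto
    fix C assume C: "C \<noteq> {}" "subset.chain ?A C"
    have tot: "X \<subseteq> Y \<or> Y \<subseteq> X" if "X \<in> C" "Y \<in> C" for X Y
      using C(2) that unfolding subset.chain_def by blast
    have CA: "X \<in> ?A" if "X \<in> C" for X
      using C that by (auto simp: subset.chain_def)
    have idl: "ring_ideal X" if "X \<in> C" for X using CA[OF that] assms(2) by auto
    have "ring_ideal (\<Union>C)"
    proof (rule ring_idealI)
      show "0 \<in> \<Union>C" using C(1) idl ideal_zero by blast
    next
      fix a b assume "a \<in> \<Union>C" "b \<in> \<Union>C"
      then obtain X Y where XY: "X \<in> C" "Y \<in> C" "a \<in> X" "b \<in> Y" by auto
      then consider "a \<in> Y" | "b \<in> X" using tot by blast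
      then show "a + b \<in> \<Union>C" using XY idl ideal_add by cases blast+
    next
      fix r a assume "a \<in> \<Union>C"
      then show "r * a \<in> \<Union>C" using idl ideal_mult by blast
    qed
    then obtain S where S: "finite S" "\<Union>C = ideal_generated S" using ideal_fg by blast
    have "S \<subseteq> \<Union>C" using S ideal_generated_base by blast
    then obtain X where X: "X \<in> C" "S \<subseteq> X"
      using finite_subset_Union_chain[OF S(1) _ C] by blast
    then have "\<Union>C \<subseteq> X" using S idl ideal_generated_least by metis
    then have "\<Union>C = X" using X by blast
    then show "\<Union>C \<in> ?A" using CA X by metis
  qed
  then obtain M where "M \<in> ?A" "\<forall>X\<in>?A. M \<subseteq> X \<longrightarrow> X = M" by (elim bexE)
  then show ?thesis by (intro bexI[of _ M] conjI ballI impI) auto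
qed

text \<open>The contraction of the extension of \<open>I\<close> to the localization at \<open>P\<close>: all statements about
  localizations are expressed through this saturation.\<close>

definition sat :: "'a::comm_ring_1 set \<Rightarrow> 'a set \<Rightarrow> 'a set" where
  "sat P I = {a. \<exists>s. s \<notin> P \<and> s * a \<in> I}"

lemma satI: "s \<notin> P \<Longrightarrow> s * a \<in> I \<Longrightarrow> a \<in> sat P I"
  by (auto simp: sat_def)

lemma sat_superset: "prime_ideal P \<Longrightarrow> I \<subseteq> sat P I"
  using prime_idealD(2) by (fastforce intro: satI[of 1])

lemma sat_mono: "I \<subseteq> J \<Longrightarrow> sat P I \<subseteq> sat P J"
  by (auto simp: sat_def)

lemma sat_sat:
  assumes "prime_ideal P" "a \<in> sat P (sat P I)"
  shows "a \<in> sat P I"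
proof -
  obtain s t where "s \<notin> P" "t \<notin> P" "t * (s * a) \<in> I"
    using assms(2) by (auto simp: sat_def)
  moreover have "t * s \<notin> P" using calculation prime_idealD(3)[OF assms(1)] by blast
  ultimately show ?thesis by (intro satI[of "t * s"]) (auto simp: mult.assoc)
qed

lemma ring_ideal_sat:
  assumes P: "prime_ideal P" and I: "ring_ideal I"
  shows "ring_ideal (sat P I)"
proof (rule ring_idealI)
  show "0 \<in> sat P I" using sat_superset[OF P] ideal_zero[OF I] by blast
next
  fix a b assume "a \<in> sat P I" "b \<in> sat P I"
  then obtain s t where st: "s \<notin> P" "t \<notin> P" "s * a \<in> I" "t * b \<in> I" by (auto simp: sat_def)
  have "(s * t) * (a + b) = t * (s * a) + s * (t * b)" by (simp add: algebra_simps)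
  then have "(s * t) * (a + b) \<in> I" using st I by (simp add: ideal_add ideal_mult)
  moreover have "s * t \<notin> P" using st prime_idealD(3)[OF P] by blast
  ultimately show "a + b \<in> sat P I" by (rule satI[rotated])
next
  fix r a assume "a \<in> sat P I"
  then obtain s where s: "s \<notin> P" "s * a \<in> I" by (auto simp: sat_def)
  have "s * (r * a) = r * (s * a)" by (simp add: algebra_simps)
  then show "r * a \<in> sat P I" using s I by (metis ideal_mult satI)
qed

lemma sat_least: "prime_ideal P \<Longrightarrow> ring_ideal I \<Longrightarrow> J \<subseteq> sat P I \<Longrightarrow> sat P J \<subseteq> sat P I"
  using sat_mono sat_sat by blast

text \<open>One generator is eliminated at a time. A relation \<open>s * b = n + p * b + v\<close>
  with \<open>s\<close> outside P and \<open>p\<close> in P turns into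
  \<open>(s - p) * b = n + v\<close>, and \<open>s - p\<close> is again outside P, hence invertible
  in the localization.\<close>

lemma nakayama_generators:
  assumes P: "prime_ideal P" and N: "ring_ideal (N :: 'a::comm_ring_1 set)" and "finite S"
    and "S \<subseteq> sat P (N + ideal_generated {p * c | p c. p \<in> P \<and> c \<in> S})"
  shows "S \<subseteq> sat P N"
  using assms(3,4)
proof (induction S)
  case empty
  then show ?case by simp
next
  case (insert b S)
  note pI = prime_idealD(1)[OF P]
  let ?PS = "ideal_generated {p * c | p c. p \<in> P \<and> c \<in> S}"
  have PS: "ring_ideal ?PS" by (rule ring_ideal_ideal_generated)
  let ?PI = "{p * b | p. p \<in> P} + ?PS"
  have "ring_ideal {p * b | p. p \<in> P}"
  proof (rule ring_idealI)
    show "0 \<in> {p * b | p. p \<in> P}" using ideal_zero[OF pI] by (auto intro!: exI[of _ 0])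
  next
    fix x y assume "x \<in> {p * b | p. p \<in> P}" "y \<in> {p * b | p. p \<in> P}"
    then obtain p q where "x = p * b" "y = q * b" "p \<in> P" "q \<in> P" by blast
    then have "x + y = (p + q) * b" "p + q \<in> P" using ideal_add[OF pI] by (auto simp: algebra_simps)
    then show "x + y \<in> {p * b | p. p \<in> P}" by blast
  next
    fix r x assume "x \<in> {p * b | p. p \<in> P}"
    then obtain p where "x = p * b" "p \<in> P" by blast
    then have "r * x = (r * p) * b" "r * p \<in> P" using ideal_mult[OF pI] by (auto simp: algebra_simps)
    then show "r * x \<in> {p * b | p. p \<in> P}" by blast
  qed
  note bI = this
  have PI: "ring_ideal ?PI" using bI PS by (rule ring_ideal_plus)
  have "{p * c | p c. p \<in> P \<and> c \<in> insert b S} \<subseteq> ?PI"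
  proof
    fix u assume "u \<in> {p * c | p c. p \<in> P \<and> c \<in> insert b S}"
    then obtain p c where u: "u = p * c" "p \<in> P" "c \<in> insert b S" by blast
    show "u \<in> ?PI"
    proof (cases "c = b")
      case True
      then show ?thesis using u subset_ideal_plus(1)[OF bI PS] by blast
    next
      case False
      then have "u \<in> ?PS" using u by (intro ideal_generated_base) blast
      then show ?thesis using subset_ideal_plus(2)[OF bI PS] by blast
    qed
  qed
  then have sub: "ideal_generated {p * c | p c. p \<in> P \<and> c \<in> insert b S} \<subseteq> ?PI"
    using PI by (rule ideal_generated_least)
  have dec: "\<exists>t n p v. t \<notin> P \<and> n \<in> N \<and> p \<in> P \<and> v \<in> ?PS \<and> t * a = n + p * b + v"
    if "a \<in> insert b S" for a
  proof -
    have "a \<in> sat P (N + ideal_generated {p * c | p c. p \<in> P \<and> c \<in> insert b S})"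
      using insert.prems that by blast
    then obtain t n u where t: "t \<notin> P" "t * a = n + u" "n \<in> N"
        "u \<in> ideal_generated {p * c | p c. p \<in> P \<and> c \<in> insert b S}"
      by (auto simp: sat_def ideal_plus_iff)
    then have "u \<in> ?PI" using sub by blast
    then obtain p v where "u = p * b + v" "p \<in> P" "v \<in> ?PS" by (auto simp: ideal_plus_iff)
    then have "t * a = n + p * b + v" using t by (simp add: add.assoc)
    with \<open>p \<in> P\<close> \<open>v \<in> ?PS\<close> t show ?thesis by blast
  qed
  obtain s n p v where b: "s \<notin> P" "n \<in> N" "p \<in> P" "v \<in> ?PS" "s * b = n + p * b + v"
    using dec[of b] by blast
  define s' where "s' = s - p"
  have s': "s' \<notin> P"
  proof
    assume "s' \<in> P"
    then have "s' + p \<in> P" using b ideal_add[OF pI] by blast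
    then show False using b by (simp add: s'_def)
  qed
  have s'b: "s' * b = n + v" using b(5) by (simp add: s'_def algebra_simps)
  have "S \<subseteq> sat P (N + ?PS)"
  proof
    fix a assume "a \<in> S"
    then obtain t n1 p1 v1 where a: "t \<notin> P" "n1 \<in> N" "p1 \<in> P" "v1 \<in> ?PS" "t * a = n1 + p1 * b + v1"
      using dec[of a] by blast
    have "(s' * t) * a = s' * (t * a)" by (simp add: mult.assoc)
    also have "\<dots> = s' * n1 + p1 * (s' * b) + s' * v1" by (simp only: a(5)) (simp add: algebra_simps)
    also have "\<dots> = (s' * n1 + p1 * n) + (p1 * v + s' * v1)" by (simp only: s'b) (simp add: algebra_simps)
    finally have "(s' * t) * a \<in> N + ?PS"
      using a b by (auto intro!: set_plus_intro ideal_add[OF N] ideal_mult[OF N] ideal_add[OF PS] ideal_mult[OF PS])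
    moreover have "s' * t \<notin> P" using s' a prime_idealD(3)[OF P] by blast
    ultimately show "a \<in> sat P (N + ?PS)" by (rule satI[rotated])
  qed
  then have S: "S \<subseteq> sat P N" by (rule insert.IH)
  have sN: "ring_ideal (sat P N)" using P N by (rule ring_ideal_sat)
  have "?PS \<subseteq> sat P N"
    by (rule ideal_generated_least) (use S in \<open>auto intro!: ideal_mult sN\<close>)
  then have "v \<in> sat P N" using b by blast
  moreover have "n \<in> sat P N" using b sat_superset[OF P] by blast
  ultimately have "s' * b \<in> sat P N" unfolding s'b by (intro ideal_add sN)
  then have "b \<in> sat P N" using sat_sat[OF P] satI[OF s'] by blast
  with S show ?case by simp
qed

text \<open>Nakayama's lemma in the localization at P, read off in the ring itself: the products
  with elements of I already lie in the ideal generated by the products with finitely many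
  generators of I.\<close>

lemma nakayama:
  fixes I :: "'a::noetherian_ring set"
  assumes P: "prime_ideal P" and N: "ring_ideal N" and I: "ring_ideal I"
    and sub: "I \<subseteq> sat P (N + ideal_generated {p * c | p c. p \<in> P \<and> c \<in> I})"
  shows "I \<subseteq> sat P N"
proof -
  obtain S where S: "finite S" "I = ideal_generated S" using ideal_fg[OF I] by blast
  let ?PS = "ideal_generated {p * c | p c. p \<in> P \<and> c \<in> S}"
  have PS: "ring_ideal ?PS" by (rule ring_ideal_ideal_generated)
  have "p * c \<in> ?PS" if "p \<in> P" "c \<in> I" for p c
  proof -
    have "ring_ideal {c. p * c \<in> ?PS}"
      by (rule ring_idealI)
        (simp_all add: ideal_zero[OF PS] ideal_add[OF PS] distrib_left
          ideal_mult[OF PS] mult.left_commute[of p])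
    moreover have "S \<subseteq> {c. p * c \<in> ?PS}" using that by (auto intro: ideal_generated_base)
    ultimately have "I \<subseteq> {c. p * c \<in> ?PS}" unfolding S(2) by (rule ideal_generated_least[rotated])
    then show ?thesis using that by blast
  qed
  then have "ideal_generated {p * c | p c. p \<in> P \<and> c \<in> I} \<subseteq> ?PS"
    by (intro ideal_generated_least PS) blast
  then have "N + ideal_generated {p * c | p c. p \<in> P \<and> c \<in> I} \<subseteq> N + ?PS"
    by (auto elim!: set_plus_elim intro: set_plus_intro)
  then have "I \<subseteq> sat P (N + ?PS)" using sub sat_mono by blast
  then have "S \<subseteq> sat P (N + ?PS)" using S ideal_generated_base by blast
  then have "S \<subseteq> sat P N" using P N S(1) by (rule nakayama_generators[rotated -1])
  then show ?thesis unfolding S(2) using P N by (intro ideal_generated_least ring_ideal_sat)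
qed

text \<open>An ideal maximal among those avoiding S is prime: enlarging it by \<open>a\<close> or by
  \<open>b\<close> produces elements of S, and if \<open>a * b\<close> lay in it, the product of
  these two elements would be in both the ideal and S.\<close>

lemma ex_prime_disjoint:
  fixes I :: "'a::noetherian_ring set"
  assumes I: "ring_ideal I" and S: "1 \<in> S" "\<And>s t. s \<in> S \<Longrightarrow> t \<in> S \<Longrightarrow> s * t \<in> S" and d: "I \<inter> S = {}"
  obtains Q where "prime_ideal Q" "I \<subseteq> Q" "Q \<inter> S = {}"
proof -
  have IA: "I \<in> {J. ring_ideal J \<and> J \<inter> S = {}}" using I d by simp
  have rA: "\<forall>J\<in>{J. ring_ideal J \<and> J \<inter> S = {}}. ring_ideal J" by simp
  obtain Q where QA: "Q \<in> {J. ring_ideal J \<and> J \<inter> S = {}}" and IQ: "I \<subseteq> Q"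
    and mx: "\<forall>J\<in>{J. ring_ideal J \<and> J \<inter> S = {}}. Q \<subseteq> J \<longrightarrow> J = Q"
    using ex_maximal_ideal_in[OF IA rA] by (elim bexE conjE)
  have Q: "ring_ideal Q \<and> Q \<inter> S = {}" using QA by simp
  have Qmax: "J = Q" if "ring_ideal J" "J \<inter> S = {}" "Q \<subseteq> J" for J
    using mx that by blast
  have meet: "\<exists>q\<in>Q. \<exists>r. q + r * a \<in> S" if "a \<notin> Q" for a
  proof -
    have idl: "ring_ideal (Q + principal a)" using Q by (intro ring_ideal_plus ring_ideal_principal) simp
    have "Q \<subseteq> Q + principal a" "a \<in> Q + principal a"
      using subset_ideal_plus[OF conjunct1[OF Q] ring_ideal_principal[of a]] principal_self by auto
    then have "(Q + principal a) \<inter> S \<noteq> {}" using Qmax[OF idl] that by blast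
    then show ?thesis by (auto simp: ideal_plus_iff principal_def)
  qed
  have "prime_ideal Q"
    unfolding prime_ideal_def
  proof (intro conjI allI impI)
    show "ring_ideal Q" "Q \<noteq> UNIV" using Q S(1) by auto
    fix a b assume ab: "a * b \<in> Q"
    show "a \<in> Q \<or> b \<in> Q"
    proof (rule ccontr)
      assume "\<not> (a \<in> Q \<or> b \<in> Q)"
      then obtain q r q' r' where q: "q \<in> Q" "q + r * a \<in> S" "q' \<in> Q" "q' + r' * b \<in> S"
        using meet by meson
      have "(q + r * a) * (q' + r' * b) = (q' + r' * b) * q + (r * a) * q' + (r * r') * (a * b)"
        by (simp add: algebra_simps)
      then have "(q + r * a) * (q' + r' * b) \<in> Q"
        using q ab Q by (simp add: ideal_add ideal_mult)
      then show False using S(2)[OF q(2,4)] Q by blast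
    qed
  qed
  then show ?thesis using that IQ Q by simp
qed

text \<open>The localization at P modulo I0 is artinian when P is nilpotent there. Noetherian
  induction replaces lengths: a maximal counterexample I becomes harmless after adding one element
  \<open>v\<close> that P annihilates modulo I, and this single step can change the chain only
  once.\<close>

lemma dcc_mod_nilpotent:
  fixes P :: "'a::noetherian_ring set"
  assumes P: "prime_ideal P"
    and D: "\<And>k. ring_ideal (D k)" "\<And>k. D (Suc k) \<subseteq> D k"
    and I: "ring_ideal I0" and nil: "\<And>p. p \<in> P \<Longrightarrow> \<exists>k. p ^ k \<in> sat P I0"
  shows "\<exists>k. \<forall>j\<ge>k. D k \<subseteq> sat P (D j + I0)"
proof (rule ccontr)
  let ?A = "{I. ring_ideal I \<and> I0 \<subseteq> I \<and> \<not> (\<exists>k. \<forall>j\<ge>k. D k \<subseteq> sat P (D j + I))}"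
  assume "\<not> ?thesis"
  then have I0: "I0 \<in> ?A" using I by (intro CollectI conjI subset_refl)
  have rA: "\<forall>J\<in>?A. ring_ideal J" by blast
  obtain I where I1: "I \<in> ?A" and "I0 \<subseteq> I" and mx: "\<forall>J\<in>?A. I \<subseteq> J \<longrightarrow> J = I"
    using ex_maximal_ideal_in[OF I0 rA] by (elim bexE conjE)
  then have II: "ring_ideal I" "I0 \<subseteq> I" and nk: "\<And>k. \<exists>j\<ge>k. \<not> D k \<subseteq> sat P (D j + I)" by blast+
  have Dm: "D j \<subseteq> D k" if "k \<le> j" for j k using that D(2) by (rule lift_Suc_antimono_le[rotated])
  have sI: "ring_ideal (sat P I)" using P II by (intro ring_ideal_sat)
  have DI: "I \<subseteq> D j + I" "D j \<subseteq> D j + I" for j using subset_ideal_plus[OF D(1) II(1)] by auto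
  have one: "1 \<notin> sat P I"
  proof
    assume "1 \<in> sat P I"
    then have "r * 1 \<in> sat P I" for r by (rule ideal_mult[OF sI])
    then have "sat P I = UNIV" by auto
    then have "sat P (D j + I) = UNIV" for j using sat_mono[OF DI(1)] by blast
    then show False using nk by blast
  qed
  obtain S where S: "finite S" "P = ideal_generated S" using ideal_fg prime_idealD(1)[OF P] by blast
  have SP: "S \<subseteq> P" using S ideal_generated_base by blast
  \<comment> \<open>A socle element: for each generator \<open>p\<close> of P in turn,
    \<open>v\<close> is multiplied by the last power of \<open>p\<close> that keeps it outside the
    saturation of I.\<close>
  have "\<exists>v. v \<notin> sat P I \<and> (\<forall>p\<in>S. p * v \<in> sat P I)" using S(1) SP
  proof (induction S)
    case empty
    then show ?case using one by auto
  next
    case (insert p S)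
    then obtain v where v: "v \<notin> sat P I" "\<forall>q\<in>S. q * v \<in> sat P I" by auto
    obtain k where "p ^ k \<in> sat P I0" using nil insert by blast
    then have "p ^ k \<in> sat P I" using sat_mono[OF II(2)] by blast
    then have "p ^ k * v \<in> sat P I" using sI by (rule ideal_mult_right[rotated])
    then have ex: "\<exists>k. p ^ k * v \<in> sat P I" by blast
    define k where "k = (LEAST k. p ^ k * v \<in> sat P I)"
    have k: "p ^ k * v \<in> sat P I" unfolding k_def using ex by (rule LeastI_ex)
    then have "k \<noteq> 0" using v by (auto intro!: gr0I)
    then obtain l where l: "k = Suc l" by (cases k) auto
    have "p ^ l * v \<notin> sat P I"
      using not_less_Least[of l "\<lambda>k. p ^ k * v \<in> sat P I"] l unfolding k_def by auto
    moreover have "p * (p ^ l * v) \<in> sat P I" using k l by (simp add: mult.assoc)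
    moreover have "\<forall>q\<in>S. q * (p ^ l * v) \<in> sat P I"
      using v ideal_mult[OF sI, of _ "p ^ l"] by (metis mult.left_commute)
    ultimately show ?case by blast
  qed
  then obtain v where v: "v \<notin> sat P I" "\<forall>p\<in>S. p * v \<in> sat P I" by blast
  have "ideal_generated S \<subseteq> {p. p * v \<in> sat P I}"
  proof (rule ideal_generated_least)
    show "ring_ideal {p. p * v \<in> sat P I}" (is "ring_ideal ?X")
    proof (rule ring_idealI)
      show "0 \<in> ?X" using ideal_zero[OF sI] by simp
      show "a + b \<in> ?X" if "a \<in> ?X" "b \<in> ?X" for a b
        using that ideal_add[OF sI] by (simp add: distrib_right)
      show "r * a \<in> ?X" if "a \<in> ?X" for a r
        using that ideal_mult[OF sI] by (simp add: mult.assoc)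
    qed
    show "S \<subseteq> ?X" using v by blast
  qed
  then have Pv: "p * v \<in> sat P I" if "p \<in> P" for p using that S(2) by blast
  have vI: "v \<notin> I" using v sat_superset[OF P] by blast
  have Iv: "ring_ideal (I + principal v)" using II by (intro ring_ideal_plus ring_ideal_principal)
  have "I \<subseteq> I + principal v" "v \<in> I + principal v"
    using subset_ideal_plus[OF II(1) ring_ideal_principal[of v]] principal_self by auto
  then have "I + principal v \<notin> ?A" using mx vI by blast
  then obtain k0 where k0: "\<And>j. j \<ge> k0 \<Longrightarrow> D k0 \<subseteq> sat P (D j + (I + principal v))"
    using Iv II \<open>I \<subseteq> I + principal v\<close> by blast
  \<comment> \<open>If \<open>v\<close> stays in every \<open>sat P (D j + I)\<close>, adding it to
    I changes nothing. Otherwise it is missing from some \<open>D j0 + I\<close> on; then a multiple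
    \<open>r * v\<close> lying in \<open>D j1 + I\<close> forces \<open>r\<close> into P, so the
    multiple vanishes modulo I.\<close>
  show False
  proof (cases "\<forall>j. v \<in> sat P (D j + I)")
    case True
    have "D k0 \<subseteq> sat P (D j + I)" if "j \<ge> k0" for j
    proof -
      have idl: "ring_ideal (sat P (D j + I))" using P D II by (intro ring_ideal_sat ring_ideal_plus)
      have "D j + (I + principal v) \<subseteq> sat P (D j + I)"
        using True DI[of j] sat_superset[OF P, of "D j + I"] idl
        by (intro ideal_plus_least principal_least) auto
      then have "sat P (D j + (I + principal v)) \<subseteq> sat P (D j + I)"
        using P D II by (intro sat_least ring_ideal_plus)
      then show ?thesis using k0[OF that] by blast
    qed
    then show False using nk by blast
  next
    case False
    then obtain j0 where j0: "v \<notin> sat P (D j0 + I)" by blast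
    define j1 where "j1 = max k0 j0"
    have "D j1 \<subseteq> sat P (D j + I)" if j: "j \<ge> j1" for j
    proof
      fix a assume a: "a \<in> D j1"
      then have "a \<in> sat P (D j + (I + principal v))"
        using k0[of j] j Dm[of k0 j1] by (auto simp: j1_def)
      then obtain s d i r where s: "s \<notin> P" "s * a = d + (i + r * v)" "d \<in> D j" "i \<in> I"
        by (auto simp: sat_def ideal_plus_iff principal_def)
      have "r * v = (s * a - d) + (- i)" using s(2) by (simp add: algebra_simps)
      moreover have "s * a - d \<in> D j1"
        using a s Dm[OF j] by (intro ring_ideal_diff D ideal_mult) auto
      ultimately have rv: "r * v \<in> D j1 + I" using s(4) ideal_uminus[OF II(1)] by (simp only: set_plus_intro)
      have "D j1 + I \<subseteq> D j0 + I" using Dm[of j0 j1] by (auto simp: j1_def elim!: set_plus_elim intro: set_plus_intro)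
      then have "r \<in> P" using rv j0 satI[of r P v "D j0 + I"] by blast
      then have "r * v \<in> sat P I" by (rule Pv)
      then have "r * v \<in> sat P (D j + I)" using sat_mono[OF DI(1)] by blast
      moreover have "d \<in> sat P (D j + I)" "i \<in> sat P (D j + I)"
        using s DI sat_superset[OF P, of "D j + I"] by blast+
      moreover have "ring_ideal (sat P (D j + I))" using P D II by (intro ring_ideal_sat ring_ideal_plus)
      ultimately have "s * a \<in> sat P (D j + I)" unfolding s(2) by (intro ideal_add)
      then show "a \<in> sat P (D j + I)" using s(1) sat_sat[OF P] satI by blast
    qed
    then show False using nk by blast
  qed
qed

section \<open>Powers of an ideal\<close>

lemma ideal_power_Suc_subset: "ideal_power I (Suc k) \<subseteq> ideal_power I k"
  unfolding ideal_power.simps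
  by (rule ideal_generated_least) (auto intro: ideal_mult_right ring_ideal_ideal_power)

lemma ideal_power_mult_mem: "a \<in> ideal_power I k \<Longrightarrow> b \<in> I \<Longrightarrow> a * b \<in> ideal_power I (Suc k)"
  by (auto intro: ideal_generated_base)

lemma power_mem_ideal_power: "a \<in> I \<Longrightarrow> a ^ k \<in> ideal_power I k"
proof (induction k)
  case (Suc k)
  then have "a ^ k * a \<in> ideal_power I (Suc k)" by (intro ideal_power_mult_mem)
  then show ?case by (simp only: power_Suc2)
qed simp

text \<open>Phrased with an arbitrary target ideal K, so that a bound on products of elements
  suffices and products of ideals need no separate notion.\<close>

lemma ideal_power_add_subset:
  assumes "ring_ideal K" "\<And>u v. u \<in> ideal_power I k \<Longrightarrow> v \<in> ideal_power I l \<Longrightarrow> u * v \<in> K"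
  shows "ideal_power I (k + l) \<subseteq> K"
  using assms
proof (induction l arbitrary: K)
  case 0
  then show ?case using "0.prems"(2)[of _ 1] by auto
next
  case (Suc l)
  have "{a * b | a b. a \<in> ideal_power I (k + l) \<and> b \<in> I} \<subseteq> K"
  proof clarify
    fix a b assume ab: "a \<in> ideal_power I (k + l)" "b \<in> I"
    have "ideal_power I (k + l) \<subseteq> {c. c * b \<in> K}"
    proof (rule Suc.IH)
      show "ring_ideal {c. c * b \<in> K}"
        by (rule ring_idealI)
          (simp_all add: ideal_zero[OF Suc.prems(1)] ideal_add[OF Suc.prems(1)] distrib_right
            ideal_mult[OF Suc.prems(1)] mult.assoc)
    next
      fix u v assume "u \<in> ideal_power I k" "v \<in> ideal_power I l"
      then show "u * v \<in> {c. c * b \<in> K}"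
        using Suc.prems(2)[of u "v * b"] ideal_power_mult_mem[OF _ ab(2)] by (simp only: mem_Collect_eq mult.assoc)
    qed
    then show "a * b \<in> K" using ab by blast
  qed
  then show ?case using Suc.prems(1) by (simp add: ideal_generated_least)
qed

text \<open>Krull's principal ideal theorem in the form of an exchange property for chains of primes,
  proved with the symbolic powers of the middle prime.\<close>

lemma prime_between:
  fixes P0 P1 P2 :: "'a::noetherian_ring set"
  assumes P: "prime_ideal P0" "prime_ideal P1" "prime_ideal P2" and lt: "P0 \<subset> P1" "P1 \<subset> P2"
    and x: "x \<in> P2"
  shows "\<exists>Q. prime_ideal Q \<and> P0 \<subset> Q \<and> Q \<subset> P2 \<and> x \<in> Q"
proof (rule ccontr)
  assume no: "\<not> ?thesis"
  then have xP1: "x \<notin> P1" using P lt by blast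
  let ?I = "P0 + principal x"
  note iP = prime_idealD(1)[OF P(1)] prime_idealD(1)[OF P(2)] prime_idealD(1)[OF P(3)]
  have I: "ring_ideal ?I" using iP by (intro ring_ideal_plus ring_ideal_principal)
  \<comment> \<open>Were \<open>p\<close> not nilpotent modulo the ideal locally at P2, a prime over
    P0 and \<open>x\<close>, contained in P2 and avoiding \<open>p\<close>, would lie strictly
    between P0 and P2.\<close>
  have nil: "\<exists>k. p ^ k \<in> sat P2 ?I" if p: "p \<in> P2" for p
  proof (rule ccontr)
    assume n: "\<nexists>k. p ^ k \<in> sat P2 ?I"
    define S where "S = {s * p ^ k | s k. s \<notin> P2}"
    have "1 * p ^ 0 \<in> S" unfolding S_def using prime_idealD(2)[OF P(3)] by blast
    then have "1 \<in> S" by simp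
    moreover have "s * t \<in> S" if st: "s \<in> S" "t \<in> S" for s t
    proof -
      obtain u k where u: "s = u * p ^ k" "u \<notin> P2" using st(1) unfolding S_def by blast
      obtain v l where v: "t = v * p ^ l" "v \<notin> P2" using st(2) unfolding S_def by blast
      from u v have "s * t = (u * v) * p ^ (k + l)" "u * v \<notin> P2"
        using prime_idealD(3)[OF P(3)] by (auto simp: power_add mult_ac)
      then show ?thesis unfolding S_def by blast
    qed
    moreover have "?I \<inter> S = {}"
    proof (rule ccontr)
      assume "?I \<inter> S \<noteq> {}"
      then obtain s k where "s \<notin> P2" "s * p ^ k \<in> ?I" unfolding S_def by blast
      then show False using n satI by blast
    qed
    ultimately obtain Q where Q: "prime_ideal Q" "?I \<subseteq> Q" "Q \<inter> S = {}"
      using ex_prime_disjoint[OF I, of S] by blast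
    have "x \<in> Q" "P0 \<subseteq> Q" using Q(2) subset_ideal_plus[OF iP(1) ring_ideal_principal[of x]] principal_self by blast+
    moreover have "Q \<subseteq> P2"
    proof
      fix a assume a: "a \<in> Q"
      show "a \<in> P2"
      proof (rule ccontr)
        assume "a \<notin> P2"
        then have "a * p ^ 0 \<in> S" unfolding S_def by blast
        then show False using a Q by auto
      qed
    qed
    moreover have "p \<notin> Q"
    proof
      assume "p \<in> Q"
      moreover have "1 * p ^ 1 \<in> S" unfolding S_def using prime_idealD(2)[OF P(3)] by blast
      ultimately show False using Q by auto
    qed
    moreover have "x \<notin> P0" using xP1 lt by blast
    ultimately show False using no Q(1) p by blast
  qed
  \<comment> \<open>The symbolic powers of P1 modulo P0. Being saturated at P1, they allow division
    by \<open>x\<close>, which is outside P1.\<close>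
  define D where "D k = sat P1 (ideal_power P1 k + P0)" for k
  have J: "ring_ideal (ideal_power P1 k + P0)" for k
    using iP by (intro ring_ideal_plus ring_ideal_ideal_power)
  have D: "ring_ideal (D k)" for k unfolding D_def using P(2) J by (rule ring_ideal_sat)
  have DS: "D (Suc k) \<subseteq> D k" for k
    unfolding D_def using ideal_power_Suc_subset[of P1 k]
    by (intro sat_mono set_plus_mono2) auto
  have P0D: "P0 \<subseteq> D k" for k
    using subset_ideal_plus(2)[OF ring_ideal_ideal_power iP(1)] sat_superset[OF P(2)]
    unfolding D_def by blast
  obtain k where k: "D k \<subseteq> sat P2 (D (Suc k) + ?I)"
    using dcc_mod_nilpotent[of P2 D, OF P(3) D DS I nil] by (meson le_SucI order_refl)
  \<comment> \<open>Stationarity gives each element of \<open>D k\<close> as an element of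
    \<open>D (Suc k)\<close> plus \<open>r * x\<close> after multiplication by some element outside
    P2. Dividing by \<open>x\<close> puts \<open>r\<close> into \<open>D k\<close>, so Nakayama at
    P2 yields \<open>D k \<subseteq> D (Suc k)\<close>; a second application, at P1, makes the
    \<open>k\<close>-th power of P1 vanish modulo P0.\<close>
  have "D k \<subseteq> sat P2 (D (Suc k) + ideal_generated {p * c | p c. p \<in> P2 \<and> c \<in> D k})"
  proof
    fix a assume a: "a \<in> D k"
    then have "a \<in> sat P2 (D (Suc k) + ?I)" using k by blast
    then obtain s d p r where s: "s \<notin> P2" "s * a = d + (p + r * x)" "d \<in> D (Suc k)" "p \<in> P0"
      by (auto simp: sat_def ideal_plus_iff mem_principal)
    have dp: "d + p \<in> D (Suc k)" using s P0D by (intro ideal_add D) auto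
    have "x * r = s * a - (d + p)" using s(2) by (simp add: algebra_simps)
    moreover have "s * a - (d + p) \<in> D k"
      using a dp DS by (intro ring_ideal_diff D ideal_mult) auto
    ultimately have "x * r \<in> D k" by simp
    then have "r \<in> D k" unfolding D_def using sat_sat[OF P(2)] satI[OF xP1] by blast
    then have "x * r \<in> ideal_generated {p * c | p c. p \<in> P2 \<and> c \<in> D k}"
      using x by (intro ideal_generated_base) blast
    with dp have "(d + p) + x * r \<in> D (Suc k) + ideal_generated {p * c | p c. p \<in> P2 \<and> c \<in> D k}"
      by (rule set_plus_intro)
    moreover have "(d + p) + x * r = s * a" using s(2) by (simp add: algebra_simps)
    ultimately have "s * a \<in> D (Suc k) + ideal_generated {p * c | p c. p \<in> P2 \<and> c \<in> D k}" by simp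
    with s(1) show "a \<in> sat P2 (D (Suc k) + ideal_generated {p * c | p c. p \<in> P2 \<and> c \<in> D k})"
      by (rule satI)
  qed
  then have "D k \<subseteq> sat P2 (D (Suc k))" by (rule nakayama[OF P(3) D D])
  also have "\<dots> \<subseteq> sat P1 (D (Suc k))" using lt by (auto simp: sat_def)
  also have "\<dots> \<subseteq> D (Suc k)" unfolding D_def using sat_sat[OF P(2)] by blast
  finally have DD: "D k \<subseteq> D (Suc k)" .
  have "ideal_power P1 k \<subseteq> D k"
    using subset_ideal_plus(1)[OF ring_ideal_ideal_power iP(1)] sat_superset[OF P(2)]
    unfolding D_def by blast
  also note DD
  also have "D (Suc k) = sat P1 (P0 + ideal_generated {p * c | p c. p \<in> P1 \<and> c \<in> ideal_power P1 k})"
  proof -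
    have "{a * b | a b. a \<in> ideal_power P1 k \<and> b \<in> P1} = {p * c | p c. p \<in> P1 \<and> c \<in> ideal_power P1 k}"
      by (auto simp: mult.commute) (metis mult.commute)+
    then show ?thesis by (simp add: D_def add.commute)
  qed
  finally have "ideal_power P1 k \<subseteq> sat P1 P0"
    by (rule nakayama[OF P(2) iP(1) ring_ideal_ideal_power])
  moreover have "sat P1 P0 \<subseteq> P0" using lt prime_idealD(3)[OF P(1)] by (auto simp: sat_def)
  ultimately have sub: "ideal_power P1 k \<subseteq> P0" by blast
  obtain q where "q \<in> P1" "q \<notin> P0" using lt by blast
  then show False using power_mem_ideal_power[of q P1 k] sub prime_ideal_power[OF P(1)] by blast
qed

section \<open>Chains of primes and Krull's height theorem\<close>

definition prime_chain :: "nat \<Rightarrow> (nat \<Rightarrow> 'a::comm_ring_1 set) \<Rightarrow> bool" where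
  "prime_chain k P \<longleftrightarrow> (\<forall>i\<le>k. prime_ideal (P i)) \<and> (\<forall>i<k. P i \<subset> P (Suc i))"

text \<open>Exchanging the prime below the top moves \<open>x\<close> down by one place. Repeated
  down to the second prime of the chain, this leaves only the bottom prime to be dropped, so forcing
  \<open>x\<close> into all members costs one step of length.\<close>

lemma prime_chain_through:
  fixes P :: "nat \<Rightarrow> 'a::noetherian_ring set"
  assumes "prime_chain (Suc k) P" "x \<in> P (Suc k)"
  shows "\<exists>Q. prime_chain k Q \<and> Q k = P (Suc k) \<and> P 0 \<subseteq> Q 0 \<and> x \<in> Q 0"
  using assms
proof (induction k arbitrary: P)
  case 0
  then show ?case by (intro exI[of _ "\<lambda>_. P 1"]) (auto simp: prime_chain_def)
next
  case (Suc k)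
  have "prime_ideal (P k)" "prime_ideal (P (Suc k))" "prime_ideal (P (Suc (Suc k)))"
    "P k \<subset> P (Suc k)" "P (Suc k) \<subset> P (Suc (Suc k))"
    using Suc.prems(1) by (simp_all add: prime_chain_def)
  from prime_between[OF this Suc.prems(2)]
  obtain Q where Q: "prime_ideal Q" "P k \<subset> Q" "Q \<subset> P (Suc (Suc k))" "x \<in> Q" by blast
  have "prime_chain (Suc k) (P(Suc k := Q))"
    using Suc.prems(1) Q by (auto simp: prime_chain_def le_Suc_eq less_Suc_eq)
  from Suc.IH[OF this] Q
  obtain Q' where Q': "prime_chain k Q'" "Q' k = Q" "P 0 \<subseteq> Q' 0" "x \<in> Q' 0" by auto
  define R where "R = Q'(Suc k := P (Suc (Suc k)))"
  have R: "R (Suc k) = P (Suc (Suc k))" "R 0 = Q' 0" by (simp_all add: R_def)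
  have "prime_chain (Suc k) R"
    unfolding R_def
    using Q' Q(3) \<open>prime_ideal (P (Suc (Suc k)))\<close> by (auto simp: prime_chain_def le_Suc_eq less_Suc_eq)
  then show ?case using Q' R by auto
qed

text \<open>Each element of Y costs one step of the chain. This is the height theorem in the form
  used later: a chain longer than the number of elements leaves a nontrivial chain above
  them.\<close>

lemma prime_chain_containing:
  fixes P :: "nat \<Rightarrow> 'a::noetherian_ring set"
  assumes "finite Y" "prime_chain (card Y + k) P" "Y \<subseteq> P (card Y + k)"
  shows "\<exists>Q. prime_chain k Q \<and> P 0 \<subseteq> Q 0 \<and> Y \<subseteq> Q 0"
  using assms
proof (induction Y arbitrary: P)
  case empty
  then show ?case by auto
next
  case (insert y Y)
  have c: "card (insert y Y) + k = Suc (card Y + k)" using insert by simp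
  obtain Q where Q: "prime_chain (card Y + k) Q" "Q (card Y + k) = P (Suc (card Y + k))" "P 0 \<subseteq> Q 0" "y \<in> Q 0"
    using prime_chain_through[of "card Y + k" P y] insert.prems unfolding c by auto
  have "Y \<subseteq> Q (card Y + k)" using insert.prems unfolding c Q(2) by simp
  from insert.IH[OF Q(1) this]
  obtain Q' where Q': "prime_chain k Q'" "Q 0 \<subseteq> Q' 0" "Y \<subseteq> Q' 0" by blast
  then show ?case using Q by (intro exI[of _ Q']) auto
qed

section \<open>Local rings\<close>

lemma proper_ideal_subset_max_ideal:
  fixes I :: "'a::{local_ring, noetherian_ring} set"
  assumes "ring_ideal I" "I \<noteq> UNIV"
  shows "I \<subseteq> max_ideal"
proof -
  let ?A = "{J. ring_ideal J \<and> J \<noteq> (UNIV :: 'a set)}"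
  have "I \<in> ?A" "\<forall>J\<in>?A. ring_ideal J" using assms by auto
  from ex_maximal_ideal_in[OF this]
  obtain M where M: "M \<in> ?A" "I \<subseteq> M" "\<forall>J\<in>?A. M \<subseteq> J \<longrightarrow> J = M" by (elim bexE conjE)
  then have "maximal_ideal M" unfolding maximal_ideal_def by blast
  then have "M = max_ideal" using unique_maximal_ideal maximal_ideal_max_ideal by blast
  then show ?thesis using M by simp
qed

lemma unit_iff_notin_max_ideal:
  fixes a :: "'a::{local_ring, noetherian_ring}"
  shows "a dvd 1 \<longleftrightarrow> a \<notin> max_ideal"
proof
  assume "a dvd 1"
  then obtain b where b: "1 = a * b" by (elim dvdE)
  show "a \<notin> max_ideal"
  proof
    assume "a \<in> max_ideal"
    then have "r * (a * b) \<in> max_ideal" for r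
      by (intro ideal_mult ideal_mult_right ring_ideal_max_ideal)
    then have "max_ideal = (UNIV :: 'a set)" using b by auto
    then show False using maximal_ideal_max_ideal[where 'a = 'a] by (simp add: maximal_ideal_def)
  qed
next
  assume "a \<notin> max_ideal"
  then have "principal a = UNIV"
    using proper_ideal_subset_max_ideal[OF ring_ideal_principal[of a]] principal_self by blast
  then have "1 \<in> principal a" by simp
  then obtain r where "1 = r * a" unfolding principal_def by blast
  then show "a dvd 1" by (metis dvd_triv_right)
qed

lemma prime_ideal_max_ideal: "prime_ideal (max_ideal :: 'a::{local_ring, noetherian_ring} set)"
proof -
  have "a \<in> max_ideal \<or> b \<in> max_ideal" if "a * b \<in> max_ideal" for a b :: 'a
  proof (rule ccontr)
    assume "\<not> ?thesis"
    then have "a dvd 1" "b dvd 1" by (auto simp: unit_iff_notin_max_ideal)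
    then have "a * b dvd 1" using mult_dvd_mono[of a 1 b 1] by simp
    then show False using that by (simp add: unit_iff_notin_max_ideal)
  qed
  then show ?thesis
    using maximal_ideal_max_ideal[where 'a = 'a] by (auto simp: prime_ideal_def maximal_ideal_def)
qed

lemma local_sat_subset:
  fixes N :: "'a::{local_ring, noetherian_ring} set"
  assumes "ring_ideal N"
  shows "sat max_ideal N \<subseteq> N"
proof
  fix a assume "a \<in> sat max_ideal N"
  then obtain s where s: "s \<notin> max_ideal" "s * a \<in> N" by (auto simp: sat_def)
  then obtain t where "1 = s * t" by (metis dvdE unit_iff_notin_max_ideal)
  then have "a = t * (s * a)" by (metis mult.commute mult.left_commute mult_1)
  then show "a \<in> N" using s ideal_mult[OF assms] by metis
qed

text \<open>An ideal maximal among those over Q that contain no power of I is prime, since two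
  elements outside would give two powers of I whose product falls into it. Being prime and above Q
  it contains I, a contradiction.\<close>

lemma ideal_power_subset_of_radical:
  fixes Q I :: "'a::noetherian_ring set"
  assumes "ring_ideal Q" "\<And>a. a \<in> I \<Longrightarrow> \<exists>k. a ^ k \<in> Q" and I: "ring_ideal I"
  shows "\<exists>k. ideal_power I k \<subseteq> Q"
proof (rule ccontr)
  assume n: "\<not> ?thesis"
  let ?A = "{J. ring_ideal J \<and> (\<forall>k. \<not> ideal_power I k \<subseteq> J)}"
  have "Q \<in> ?A" "\<forall>J\<in>?A. ring_ideal J" using n assms by auto
  from ex_maximal_ideal_in[OF this]
  obtain M where M: "M \<in> ?A" "Q \<subseteq> M" "\<forall>J\<in>?A. M \<subseteq> J \<longrightarrow> J = M" by (elim bexE conjE)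
  have iM: "ring_ideal M" using M by blast
  have ex: "\<exists>k. ideal_power I k \<subseteq> M + principal a" if "a \<notin> M" for a
  proof (rule ccontr)
    assume "\<not> ?thesis"
    then have "M + principal a \<in> ?A" using iM ring_ideal_plus[OF _ ring_ideal_principal] by blast
    then have "M + principal a = M"
      using M(3) subset_ideal_plus(1)[OF iM ring_ideal_principal[of a]] by blast
    then show False
      using that subset_ideal_plus(2)[OF iM ring_ideal_principal[of a]] principal_self by blast
  qed
  have "prime_ideal M"
    unfolding prime_ideal_def
  proof (intro conjI allI impI)
    show "ring_ideal M" by (fact iM)
    show "M \<noteq> UNIV" using M by blast
    fix a b assume ab: "a * b \<in> M"
    show "a \<in> M \<or> b \<in> M"
    proof (rule ccontr)
      assume "\<not> ?thesis"
      then obtain k l where kl: "ideal_power I k \<subseteq> M + principal a" "ideal_power I l \<subseteq> M + principal b"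
        using ex by meson
      have "ideal_power I (k + l) \<subseteq> M"
      proof (rule ideal_power_add_subset[OF iM])
        fix u v assume "u \<in> ideal_power I k" "v \<in> ideal_power I l"
        then have "u \<in> M + principal a" "v \<in> M + principal b" using kl by auto
        then obtain p r q s where pq: "p \<in> M" "q \<in> M" "u = p + r * a" "v = q + s * b"
          unfolding ideal_plus_iff Bex_def mem_principal by blast
        have "u * v = (q + s * b) * p + (r * a) * q + (r * s) * (a * b)"
          unfolding pq by (simp add: algebra_simps)
        then show "u * v \<in> M" using pq ab by (simp only: ideal_add[OF iM] ideal_mult[OF iM])
      qed
      then show False using M by blast
    qed
  qed
  then have "I \<subseteq> M" using assms(2) M(2) prime_ideal_power by blast
  then have "ideal_power I (Suc 0) \<subseteq> M" by (simp only: ideal_power_1[OF I])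
  then show False using M by blast
qed

text \<open>Krull's intersection theorem for \<open>R / J\<close>. The ideal \<open>Q\<close> is maximal with
  \<open>Q \<inter> I = J + m I\<close>, where \<open>I\<close> is the intersection; it contains a power of the maximal ideal.\<close>

lemma krull_intersection:
  fixes J :: "'a::{local_ring, noetherian_ring} set"
  assumes J: "ring_ideal J" and a: "\<And>k. a \<in> J + max_ideal_power k"
  shows "a \<in> J"
proof -
  note mI = ring_ideal_max_ideal
  note pI = ring_ideal_ideal_power[of max_ideal]
  define I where "I = {a. \<forall>k. a \<in> J + max_ideal_power k}"
  have Jk: "ring_ideal (J + max_ideal_power k)" for k using J pI by (rule ring_ideal_plus)
  have I: "ring_ideal I"
    unfolding I_def
    by (rule ring_idealI) (simp_all add: ideal_zero[OF Jk] ideal_add[OF Jk] ideal_mult[OF Jk])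
  have JI: "J \<subseteq> I" unfolding I_def using subset_ideal_plus(1)[OF J pI] by blast
  let ?mI = "ideal_generated {p * c | p c. p \<in> max_ideal \<and> c \<in> I}"
  have mII: "?mI \<subseteq> I"
    by (rule ideal_generated_least) (use I in \<open>auto intro: ideal_mult\<close>)
  define B where "B = J + ?mI"
  have B: "ring_ideal B" unfolding B_def using J ring_ideal_ideal_generated by (rule ring_ideal_plus)
  have BI: "B \<subseteq> I" unfolding B_def using JI mII I by (rule ideal_plus_least)
  have mIB: "?mI \<subseteq> B" unfolding B_def using J ring_ideal_ideal_generated by (rule subset_ideal_plus)
  let ?A = "{Q. ring_ideal Q \<and> Q \<inter> I = B}"
  have "B \<in> ?A" "\<forall>Q\<in>?A. ring_ideal Q" using B BI by auto
  from ex_maximal_ideal_in[OF this]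
  obtain Q where Q: "Q \<in> ?A" "B \<subseteq> Q" "\<forall>X\<in>?A. Q \<subseteq> X \<longrightarrow> X = Q" by (elim bexE conjE)
  have iQ: "ring_ideal Q" and QI: "Q \<inter> I = B" using Q by auto
  have pow: "\<exists>k. x ^ k \<in> Q" if x: "x \<in> max_ideal" for x
  proof -
    \<comment> \<open>The colon ideals of Q by powers of \<open>x\<close> become stationary. For
      such a \<open>k\<close>, an element \<open>q + r * x ^ k\<close> of I is multiplied by
      \<open>x\<close> into Q, so \<open>r * x ^ Suc k\<close>, hence already
      \<open>r * x ^ k\<close>, lies in Q: adding \<open>x ^ k\<close> to Q does not change its
      intersection with I.\<close>
    define C where "C k = {r. r * x ^ k \<in> Q}" for k
    have C: "ring_ideal (C k)" for k
      unfolding C_def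
      by (rule ring_idealI)
        (simp_all add: ideal_zero[OF iQ] ideal_add[OF iQ] distrib_right ideal_mult[OF iQ] mult.assoc)
    have "C 0 \<in> range C" "\<forall>J\<in>range C. ring_ideal J" using C by auto
    from ex_maximal_ideal_in[OF this] obtain k where k: "\<forall>X\<in>range C. C k \<subseteq> X \<longrightarrow> X = C k" by blast
    have "C k \<subseteq> C (Suc k)"
    proof
      fix r assume "r \<in> C k"
      then have "x * (r * x ^ k) \<in> Q" unfolding C_def using ideal_mult[OF iQ] by blast
      then show "r \<in> C (Suc k)" unfolding C_def by (simp add: mult_ac)
    qed
    then have Ck: "C (Suc k) = C k" using k by blast
    have xk: "ring_ideal (Q + principal (x ^ k))" using iQ ring_ideal_principal by (rule ring_ideal_plus)
    have sub: "Q \<subseteq> Q + principal (x ^ k)" "x ^ k \<in> Q + principal (x ^ k)"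
      using subset_ideal_plus[OF iQ ring_ideal_principal[of "x ^ k"]] principal_self by auto
    have "(Q + principal (x ^ k)) \<inter> I \<subseteq> B"
    proof
      fix y assume y: "y \<in> (Q + principal (x ^ k)) \<inter> I"
      then obtain q r where q: "q \<in> Q" "y = q + r * x ^ k"
        unfolding Int_iff ideal_plus_iff Bex_def mem_principal by blast
      have "x * y \<in> ?mI" using x y by (intro ideal_generated_base) blast
      then have "x * y \<in> Q" using mIB Q by blast
      then have "x * y - x * q \<in> Q" by (rule ring_ideal_diff[OF iQ _ ideal_mult[OF iQ q(1)]])
      moreover have "x * y - x * q = r * x ^ Suc k" unfolding q(2) by (simp add: algebra_simps)
      ultimately have "r \<in> C (Suc k)" unfolding C_def by simp
      then have "r * x ^ k \<in> Q" using Ck unfolding C_def by blast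
      then have "y \<in> Q" using q ideal_add[OF iQ] by blast
      then show "y \<in> B" using y QI by blast
    qed
    then have "Q + principal (x ^ k) \<in> ?A" using xk sub QI by blast
    then have "Q + principal (x ^ k) = Q" using Q sub by blast
    then show ?thesis using sub by blast
  qed
  obtain N where N: "max_ideal_power N \<subseteq> Q"
    using ideal_power_subset_of_radical[OF iQ pow mI] by blast
  have "I \<subseteq> B"
  proof
    fix b assume b: "b \<in> I"
    then have "b \<in> J + max_ideal_power N" unfolding I_def by blast
    moreover have "J \<subseteq> Q" using Q(2) subset_ideal_plus(1)[OF J ring_ideal_ideal_generated] unfolding B_def by blast
    ultimately have "b \<in> Q" using N ideal_plus_least[OF _ N iQ] by blast
    then show "b \<in> B" using b QI by blast
  qed
  then have "I \<subseteq> sat max_ideal (J + ?mI)"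
    using sat_superset[OF prime_ideal_max_ideal] unfolding B_def by blast
  then have "I \<subseteq> sat max_ideal J" by (rule nakayama[OF prime_ideal_max_ideal J I])
  then have "I \<subseteq> J" using local_sat_subset[OF J] by blast
  then show ?thesis using a unfolding I_def by blast
qed

section \<open>Monomial ideals\<close>

definition exp_le :: "('n \<Rightarrow>\<^sub>0 nat) \<Rightarrow> ('n \<Rightarrow>\<^sub>0 nat) \<Rightarrow> bool" where
  "exp_le A B \<longleftrightarrow> (\<forall>i. Poly_Mapping.lookup A i \<le> Poly_Mapping.lookup B i)"

definition wdeg :: "('n::finite \<Rightarrow> nat) \<Rightarrow> ('n \<Rightarrow>\<^sub>0 nat) \<Rightarrow> nat" where
  "wdeg w A = (\<Sum>i\<in>UNIV. w i * Poly_Mapping.lookup A i)"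

definition mdeg :: "('n::finite \<Rightarrow>\<^sub>0 nat) \<Rightarrow> nat" where
  "mdeg A = (\<Sum>i\<in>UNIV. Poly_Mapping.lookup A i)"

lemma wdeg_add: "wdeg w (A + B) = wdeg w A + wdeg w B"
  by (simp add: wdeg_def lookup_add distrib_left sum.distrib)

lemma mdeg_single [simp]: "mdeg (Poly_Mapping.single i k) = k"
  by (simp add: mdeg_def lookup_single when_def)

lemma mdeg_add: "mdeg (A + B) = mdeg A + mdeg B"
  by (simp add: mdeg_def lookup_add sum.distrib)

lemma mdeg_zero [simp]: "mdeg 0 = 0"
  by (simp add: mdeg_def)

lemma exp_le_refl [simp]: "exp_le A A"
  by (simp add: exp_le_def)

lemma exp_le_trans: "exp_le A B \<Longrightarrow> exp_le B C \<Longrightarrow> exp_le A C"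
  by (meson exp_le_def order_trans)

lemma exp_le_add [simp]: "exp_le A (A + B)"
  by (simp add: exp_le_def lookup_add)

lemma exp_le_add2 [simp]: "exp_le B (A + B)"
  by (simp add: exp_le_def lookup_add)

lemma exp_le_diff: "exp_le A B \<Longrightarrow> A + (B - A) = B"
  by (intro poly_mapping_eqI) (simp add: exp_le_def lookup_add lookup_minus)

lemma exp_leE: "exp_le A B \<Longrightarrow> (\<And>C. B = A + C \<Longrightarrow> thesis) \<Longrightarrow> thesis"
  by (metis exp_le_diff)

lemma mdeg_Suc_split:
  assumes "mdeg A = Suc k"
  obtains B i where "A = B + Poly_Mapping.single i 1" "mdeg B = k"
proof -
  obtain i where i: "Poly_Mapping.lookup A i \<noteq> 0"
    using assms by (force simp: mdeg_def)
  have "exp_le (Poly_Mapping.single i 1) A" using i by (simp add: exp_le_def lookup_single when_def)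
  then have A: "A = (A - Poly_Mapping.single i 1) + Poly_Mapping.single i 1"
    using exp_le_diff by (metis add.commute)
  moreover have "mdeg A = mdeg (A - Poly_Mapping.single i 1) + 1"
    by (subst A) (simp only: mdeg_add mdeg_single)
  then have "mdeg (A - Poly_Mapping.single i 1) = k" using assms by simp
  ultimately show ?thesis by (rule that)
qed

lemma mdeg_ge_split:
  assumes "k \<le> mdeg A"
  shows "\<exists>B C. A = B + C \<and> mdeg B = k"
  using assms
proof (induction "mdeg A - k" arbitrary: A)
  case 0
  then show ?case by (metis add.right_neutral diff_is_0_eq le_antisym)
next
  case (Suc d)
  then have "mdeg A = Suc (k + d)" by simp
  then obtain B i where B: "A = B + Poly_Mapping.single i 1" "mdeg B = k + d" by (rule mdeg_Suc_split)
  then obtain B' C where "B = B' + C" "mdeg B' = k" using Suc.hyps(1)[of B] by auto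
  then show ?case using B by (metis add.assoc)
qed

lemma mdeg_zero_iff: "mdeg A = 0 \<longleftrightarrow> A = 0"
proof
  assume "mdeg A = 0"
  then show "A = 0" by (intro poly_mapping_eqI) (simp add: mdeg_def)
qed simp

lemma monomial_value_add: "monomial_value x (A + B) = monomial_value x A * monomial_value x B"
  by (simp add: monomial_value_def lookup_add power_add prod.distrib)

lemma monomial_value_zero [simp]: "monomial_value x 0 = 1"
  by (simp add: monomial_value_def)

lemma monomial_value_single [simp]: "monomial_value x (Poly_Mapping.single i 1) = x i"
proof -
  have "monomial_value x (Poly_Mapping.single i 1) = (\<Prod>j\<in>UNIV. if j = i then x i else 1)"
    unfolding monomial_value_def by (intro prod.cong) (auto simp: lookup_single when_def)
  then show ?thesis by simp
qed

definition mono_ideal :: "('n::finite \<Rightarrow> 'r::comm_ring_1) \<Rightarrow> ('n \<Rightarrow>\<^sub>0 nat) set \<Rightarrow> 'r set" where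
  "mono_ideal x V = ideal_generated (monomial_value x ` V)"

lemma ring_ideal_mono_ideal: "ring_ideal (mono_ideal x V)"
  by (simp add: mono_ideal_def ring_ideal_ideal_generated)

lemma mono_ideal_base: "A \<in> V \<Longrightarrow> monomial_value x A \<in> mono_ideal x V"
  unfolding mono_ideal_def by (intro ideal_generated_base imageI)

lemma mono_ideal_least:
  "(\<And>A. A \<in> V \<Longrightarrow> monomial_value x A \<in> I) \<Longrightarrow> ring_ideal I \<Longrightarrow> mono_ideal x V \<subseteq> I"
  unfolding mono_ideal_def by (intro ideal_generated_least) auto

lemma mono_ideal_mono: "V \<subseteq> W \<Longrightarrow> mono_ideal x V \<subseteq> mono_ideal x W"
  unfolding mono_ideal_def by (intro ideal_generated_mono image_mono)

lemma mono_ideal_explicit: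
  "a \<in> mono_ideal x V \<longleftrightarrow> (\<exists>S c. finite S \<and> S \<subseteq> V \<and> a = (\<Sum>A\<in>S. c A * monomial_value x A))"
proof
  let ?I = "{a. \<exists>S c. finite S \<and> S \<subseteq> V \<and> a = (\<Sum>A\<in>S. c A * monomial_value x A)}"
  assume "a \<in> mono_ideal x V"
  moreover have "mono_ideal x V \<subseteq> ?I"
  proof (rule mono_ideal_least)
    fix A assume "A \<in> V"
    then show "monomial_value x A \<in> ?I"
      by (intro CollectI exI[of _ "{A}"] exI[of _ "\<lambda>_. 1"]) simp
  next
    show "ring_ideal ?I"
    proof (rule ring_idealI)
      show "0 \<in> ?I" by (intro CollectI exI[of _ "{}"]) simp
    next
      fix a b assume "a \<in> ?I" "b \<in> ?I"
      then obtain S c T d where S: "finite S" "S \<subseteq> V" "a = (\<Sum>A\<in>S. c A * monomial_value x A)"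
        and T: "finite T" "T \<subseteq> V" "b = (\<Sum>A\<in>T. d A * monomial_value x A)" by blast
      define c' where "c' A = (if A \<in> S then c A else 0)" for A
      define d' where "d' A = (if A \<in> T then d A else 0)" for A
      have "a = (\<Sum>A\<in>S \<union> T. c' A * monomial_value x A)"
        unfolding S(3) c'_def using S T by (intro sum.mono_neutral_cong_left) auto
      moreover have "b = (\<Sum>A\<in>S \<union> T. d' A * monomial_value x A)"
        unfolding T(3) d'_def using S T by (intro sum.mono_neutral_cong_left) auto
      ultimately have "a + b = (\<Sum>A\<in>S \<union> T. (c' A + d' A) * monomial_value x A)"
        by (simp add: sum.distrib distrib_right)
      then show "a + b \<in> ?I" using S T
        by (intro CollectI exI[of _ "S \<union> T"] exI[of _ "\<lambda>A. c' A + d' A"]) auto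
    next
      fix r a assume "a \<in> ?I"
      then obtain S c where S: "finite S" "S \<subseteq> V" "a = (\<Sum>A\<in>S. c A * monomial_value x A)" by blast
      then have "r * a = (\<Sum>A\<in>S. (r * c A) * monomial_value x A)"
        by (simp add: sum_distrib_left mult.assoc)
      then show "r * a \<in> ?I" using S
        by (intro CollectI exI[of _ S] exI[of _ "\<lambda>A. r * c A"]) auto
    qed
  qed
  ultimately show "\<exists>S c. finite S \<and> S \<subseteq> V \<and> a = (\<Sum>A\<in>S. c A * monomial_value x A)" by blast
next
  assume "\<exists>S c. finite S \<and> S \<subseteq> V \<and> a = (\<Sum>A\<in>S. c A * monomial_value x A)"
  then show "a \<in> mono_ideal x V"
    by (auto intro!: ideal_sum ideal_mult ring_ideal_mono_ideal mono_ideal_base)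
qed

lemma mono_ideal_mult:
  assumes "a \<in> mono_ideal x V" "b \<in> mono_ideal x W" "\<And>A B. A \<in> V \<Longrightarrow> B \<in> W \<Longrightarrow> A + B \<in> U"
  shows "a * b \<in> mono_ideal x U"
proof -
  note U = ring_ideal_mono_ideal[of x U]
  have *: "ring_ideal {u. u * v \<in> mono_ideal x U}" for v
    by (rule ring_idealI)
      (simp_all add: ideal_zero[OF U] ideal_add[OF U] distrib_right ideal_mult[OF U] mult.assoc)
  have "monomial_value x A * b \<in> mono_ideal x U" if A: "A \<in> V" for A
  proof -
    have "mono_ideal x W \<subseteq> {u. u * monomial_value x A \<in> mono_ideal x U}"
    proof (rule mono_ideal_least[OF _ *])
      fix B assume "B \<in> W"
      then have "monomial_value x (A + B) \<in> mono_ideal x U" using assms(3) A by (intro mono_ideal_base)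
      then show "monomial_value x B \<in> {u. u * monomial_value x A \<in> mono_ideal x U}"
        by (simp add: monomial_value_add mult.commute)
    qed
    then show ?thesis using assms(2) by (auto simp: mult.commute)
  qed
  then have "mono_ideal x V \<subseteq> {u. u * b \<in> mono_ideal x U}"
    by (intro mono_ideal_least[OF _ *]) simp
  then show ?thesis using assms(1) by blast
qed

lemma mono_ideal_upward:
  assumes "\<And>A. A \<in> V \<Longrightarrow> \<exists>B\<in>W. exp_le B A"
  shows "mono_ideal x V \<subseteq> mono_ideal x W"
proof (rule mono_ideal_least[OF _ ring_ideal_mono_ideal])
  fix A assume "A \<in> V"
  then obtain B C where "B \<in> W" "A = B + C" using assms exp_leE by metis
  then show "monomial_value x A \<in> mono_ideal x W"
    by (auto simp: monomial_value_add intro!: ideal_mult_right ring_ideal_mono_ideal mono_ideal_base)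
qed

lemma mono_ideal_mdeg_ge: "mono_ideal x {A. k \<le> mdeg A} = mono_ideal x {A. mdeg A = k}"
proof
  show "mono_ideal x {A. k \<le> mdeg A} \<subseteq> mono_ideal x {A. mdeg A = k}"
    by (rule mono_ideal_upward) (use mdeg_ge_split exp_le_add in blast)
  show "mono_ideal x {A. mdeg A = k} \<subseteq> mono_ideal x {A. k \<le> mdeg A}"
    by (rule mono_ideal_mono) auto
qed

lemma mono_ideal_zero_mdeg: "mono_ideal x {A. mdeg A = 0} = UNIV"
proof -
  have "monomial_value x 0 \<in> mono_ideal x {A. mdeg A = 0}" by (rule mono_ideal_base) simp
  then have "r * 1 \<in> mono_ideal x {A. mdeg A = 0}" for r
    by (intro ideal_mult ring_ideal_mono_ideal) simp
  then show ?thesis by auto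
qed

text \<open>Turns the adic filtration into a filtration by monomial ideals, so that exponents alone
  decide membership questions below.\<close>

lemma ideal_power_eq_mono_ideal:
  fixes x :: "'n::finite \<Rightarrow> 'r::comm_ring_1"
  shows "ideal_power (ideal_generated (range x)) k = mono_ideal x {A. mdeg A = k}"
proof (induction k)
  case 0
  then show ?case by (simp add: mono_ideal_zero_mdeg)
next
  case (Suc k)
  have x1: "ideal_generated (range x) \<subseteq> mono_ideal x {A. mdeg A = 1}"
  proof (rule ideal_generated_least[OF _ ring_ideal_mono_ideal], clarify)
    fix i
    have "monomial_value x (Poly_Mapping.single i 1) \<in> mono_ideal x {A. mdeg A = 1}"
      by (rule mono_ideal_base) simp
    then show "x i \<in> mono_ideal x {A. mdeg A = 1}" by (simp only: monomial_value_single)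
  qed
  show ?case
  proof
    show "ideal_power (ideal_generated (range x)) (Suc k) \<subseteq> mono_ideal x {A. mdeg A = Suc k}"
      unfolding ideal_power.simps Suc.IH
      by (rule ideal_generated_least[OF _ ring_ideal_mono_ideal])
        (use x1 in \<open>auto simp: mdeg_add intro!: mono_ideal_mult\<close>)
    show "mono_ideal x {A. mdeg A = Suc k} \<subseteq> ideal_power (ideal_generated (range x)) (Suc k)"
    proof (rule mono_ideal_least[OF _ ring_ideal_ideal_power])
      fix A assume "A \<in> {A :: 'n \<Rightarrow>\<^sub>0 nat. mdeg A = Suc k}"
      then obtain B i where B: "A = B + Poly_Mapping.single i 1" "mdeg B = k"
        using mdeg_Suc_split by blast
      then have "monomial_value x B \<in> ideal_power (ideal_generated (range x)) k"
        unfolding Suc.IH by (intro mono_ideal_base) simp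
      moreover have "x i \<in> ideal_generated (range x)" by (intro ideal_generated_base) simp
      ultimately have "monomial_value x B * x i \<in> ideal_power (ideal_generated (range x)) (Suc k)"
        by (rule ideal_power_mult_mem)
      then show "monomial_value x A \<in> ideal_power (ideal_generated (range x)) (Suc k)"
        unfolding B(1) monomial_value_add monomial_value_single .
    qed
  qed
qed

section \<open>Analytic independence of regular parameters\<close>

text \<open>The exponents are read like digits: a base K beyond all values of the new coordinate
  \<open>j\<close> is multiplied onto the old weight, and the coordinate itself is recovered as the
  remainder modulo K.\<close>

lemma separating_weights:
  fixes S :: "('n::finite \<Rightarrow>\<^sub>0 nat) set"
  assumes "finite S"
  shows "\<exists>w. inj_on (wdeg w) S"
proof -
  have "\<exists>w. \<forall>A\<in>S. \<forall>B\<in>S. wdeg w A = wdeg w B \<longrightarrow>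
      (\<forall>i\<in>I. Poly_Mapping.lookup A i = Poly_Mapping.lookup B i)" if "finite I" for I :: "'n set"
    using that
  proof induction
    case empty
    show ?case by simp
  next
    case (insert j I)
    then obtain w where w: "\<And>A B i. A \<in> S \<Longrightarrow> B \<in> S \<Longrightarrow> wdeg w A = wdeg w B \<Longrightarrow> i \<in> I \<Longrightarrow>
      Poly_Mapping.lookup A i = Poly_Mapping.lookup B i" by blast
    obtain K where K: "\<And>A. A \<in> S \<Longrightarrow> Poly_Mapping.lookup A j < K"
      using finite_nat_set_iff_bounded[of "(\<lambda>A. Poly_Mapping.lookup A j) ` S"] assms by auto
    define w' where "w' i = K * w i + (if i = j then 1 else 0)" for i
    have w': "wdeg w' A = K * wdeg w A + Poly_Mapping.lookup A j" for A
    proof -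
      have "wdeg w' A = (\<Sum>i\<in>UNIV. K * (w i * Poly_Mapping.lookup A i) + (if i = j then Poly_Mapping.lookup A j else 0))"
        unfolding wdeg_def w'_def by (intro sum.cong) (auto simp: algebra_simps)
      then show ?thesis by (simp add: sum.distrib sum_distrib_left wdeg_def)
    qed
    have "Poly_Mapping.lookup A i = Poly_Mapping.lookup B i"
      if "A \<in> S" "B \<in> S" "wdeg w' A = wdeg w' B" "i \<in> insert j I" for A B i
    proof -
      have "(K * wdeg w A + Poly_Mapping.lookup A j) mod K = (K * wdeg w B + Poly_Mapping.lookup B j) mod K"
        using that(3) unfolding w' by simp
      then have j: "Poly_Mapping.lookup A j = Poly_Mapping.lookup B j"
        using K[OF that(1)] K[OF that(2)] by simp
      then have "wdeg w A = wdeg w B" using that(3) K[OF that(1)] unfolding w' by simp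
      then show ?thesis using w[OF that(1,2)] j that(4) by auto
    qed
    then show ?case by blast
  qed
  from this[of UNIV] show ?thesis
    by (auto simp: inj_on_def intro!: poly_mapping_eqI) 
qed

lemma ideal_prod_cong:
  assumes "ring_ideal (I :: 'a::comm_ring_1 set)" "\<And>i. i \<in> S \<Longrightarrow> f i - g i \<in> I"
  shows "prod f S - prod g S \<in> I"
  using assms(2)
proof (induction S rule: infinite_finite_induct)
  case (insert i S)
  then show ?case using ideal_cong(4)[OF assms(1)] by simp
qed (auto intro: ideal_zero[OF assms(1)])

lemma ideal_power_cong:
  assumes "ring_ideal (I :: 'a::comm_ring_1 set)" "a - b \<in> I"
  shows "a ^ k - b ^ k \<in> I"
  using ideal_prod_cong[of I "{..<k}" "\<lambda>_. a" "\<lambda>_. b"] assms by simp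

text \<open>Modulo \<open>P\<close> all powers \<open>x i ^ a i\<close> are equal to one element \<open>T\<close>, so a monomial of weight \<open>k\<close>
  is roughly \<open>T\<close> to the power \<open>k / W\<close>. The relation then gives \<open>T ^ q \<in> T ^ (q + 1) R + P\<close>.\<close>

lemma parameters_in_prime:
  fixes x :: "'n::finite \<Rightarrow> 'a::{local_ring, noetherian_ring}"
  assumes P: "prime_ideal P" and w: "\<And>i. 0 < w i"
    and x: "\<And>i. x i \<in> max_ideal"
    and a: "\<And>i. w i * a i = W" "0 < W"
    and eq: "\<And>i. x i ^ a i - x i0 ^ a i0 \<in> P"
    and rel: "monomial_value x A0 \<in> mono_ideal x {B. wdeg w A0 < wdeg w B}"
  shows "x i \<in> P"
proof -
  let ?n = "CARD('n)"
  define T where "T = x i0 ^ a i0"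
  note iP = prime_idealD(1)[OF P]
  have a0: "0 < a i" for i using a by (metis gr0I less_irrefl mult_0_right)
  have eqp: "x i ^ (a i * q) - T ^ q \<in> P" for i q
    using ideal_power_cong[OF iP eq[of i]] by (simp add: power_mult T_def)
  \<comment> \<open>Each exponent is divided by \<open>a i\<close> with remainder. A quotient is
    worth a power of T, and a remainder wastes at most W in weight, so all variables together waste
    at most \<open>W * ?n\<close>.\<close>
  have high: "monomial_value x B \<in> P + principal (T ^ q)" if q: "W * (q + ?n) \<le> wdeg w B" for B q
  proof -
    let ?q = "\<lambda>i. Poly_Mapping.lookup B i div a i" and ?r = "\<lambda>i. Poly_Mapping.lookup B i mod a i"
    have "wdeg w B \<le> (\<Sum>i\<in>UNIV. W * ?q i + W)"
      unfolding wdeg_def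
    proof (rule sum_mono)
      fix i
      have "w i * Poly_Mapping.lookup B i = w i * (a i * ?q i + ?r i)" by simp
      also have "\<dots> = W * ?q i + w i * ?r i" by (simp only: distrib_left a(1)[of i, symmetric] mult.assoc)
      also have "w i * ?r i \<le> w i * a i" using a0[of i] by (intro mult_left_mono) (auto simp: less_imp_le)
      finally show "w i * Poly_Mapping.lookup B i \<le> W * ?q i + W" by (simp add: a)
    qed
    also have "\<dots> = W * ((\<Sum>i\<in>UNIV. ?q i) + ?n)" by (simp add: sum.distrib sum_distrib_left distrib_left)
    finally have "wdeg w B \<le> W * ((\<Sum>i\<in>UNIV. ?q i) + ?n)" .
    with q have "W * (q + ?n) \<le> W * ((\<Sum>i\<in>UNIV. ?q i) + ?n)" by (rule order_trans)
    then have le: "q \<le> (\<Sum>i\<in>UNIV. ?q i)" using a(2) by simp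
    have "monomial_value x B - (\<Prod>i\<in>UNIV. T ^ ?q i * x i ^ ?r i) \<in> P"
      unfolding monomial_value_def
    proof (rule ideal_prod_cong[OF iP])
      fix i
      have "x i ^ Poly_Mapping.lookup B i = x i ^ (a i * ?q i) * x i ^ ?r i"
        by (simp flip: power_add)
      moreover have "x i ^ (a i * ?q i) * x i ^ ?r i - T ^ ?q i * x i ^ ?r i \<in> P"
        using eqp by (intro ideal_cong(4) iP) (simp_all add: ideal_zero[OF iP])
      ultimately show "x i ^ Poly_Mapping.lookup B i - T ^ ?q i * x i ^ ?r i \<in> P" by simp
    qed
    moreover have "(\<Prod>i\<in>UNIV. T ^ ?q i * x i ^ ?r i) = (T ^ ((\<Sum>i\<in>UNIV. ?q i) - q) * (\<Prod>i\<in>UNIV. x i ^ ?r i)) * T ^ q"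
    proof -
      have "T ^ (\<Sum>i\<in>UNIV. ?q i) = T ^ ((\<Sum>i\<in>UNIV. ?q i) - q) * T ^ q"
        using le by (simp flip: power_add)
      then show ?thesis by (simp only: prod.distrib power_sum[symmetric] mult_ac)
    qed
    ultimately have "monomial_value x B - (T ^ ((\<Sum>i\<in>UNIV. ?q i) - q) * (\<Prod>i\<in>UNIV. x i ^ ?r i)) * T ^ q \<in> P"
      by simp
    then have "(monomial_value x B - (T ^ ((\<Sum>i\<in>UNIV. ?q i) - q) * (\<Prod>i\<in>UNIV. x i ^ ?r i)) * T ^ q)
       + (T ^ ((\<Sum>i\<in>UNIV. ?q i) - q) * (\<Prod>i\<in>UNIV. x i ^ ?r i)) * T ^ q \<in> P + principal (T ^ q)"
      using principal_mult by (rule set_plus_intro)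
    then show ?thesis by simp
  qed
  \<comment> \<open>Powers of the relation amplify its gain of one unit of weight. The exponent N is
    such that \<open>N * (k0 + 1) = W * (Suc q0 + ?n)\<close>: the gain pays for the waste
    \<open>W * ?n\<close> and one extra factor T, whereas the N-th power of the monomial itself is
    \<open>T ^ q0\<close> modulo P.\<close>
  define k0 where "k0 = wdeg w A0"
  define q0 where "q0 = (?n + 1) * k0"
  define N where "N = W * (?n + 1)"
  have "monomial_value x A0 ^ m \<in> mono_ideal x {B. m * (k0 + 1) \<le> wdeg w B}" for m
  proof (induction m)
    case 0
    have "monomial_value x 0 \<in> mono_ideal x {B. 0 * (k0 + 1) \<le> wdeg w B}"
      by (rule mono_ideal_base) simp
    then show ?case by simp
  next
    case (Suc m)
    have "monomial_value x A0 * monomial_value x A0 ^ m \<in> mono_ideal x {B. Suc m * (k0 + 1) \<le> wdeg w B}"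
      by (rule mono_ideal_mult[OF rel Suc.IH]) (auto simp: wdeg_add k0_def)
    then show ?case by simp
  qed
  moreover have "mono_ideal x {B. N * (k0 + 1) \<le> wdeg w B} \<subseteq> P + principal (T ^ Suc q0)"
  proof (rule mono_ideal_least[OF high], clarify)
    fix B assume B: "N * (k0 + 1) \<le> wdeg w B"
    have "Suc q0 + ?n = (?n + 1) * (k0 + 1)" by (simp add: q0_def)
    then have "W * (Suc q0 + ?n) = N * (k0 + 1)" by (simp only: N_def mult.assoc)
    then show "W * (Suc q0 + ?n) \<le> wdeg w B" using B by simp
  next
    show "ring_ideal (P + principal (T ^ Suc q0))"
      using iP ring_ideal_principal by (rule ring_ideal_plus)
  qed
  ultimately have mem: "monomial_value x A0 ^ N \<in> P + principal (T ^ Suc q0)" by blast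
  have "monomial_value x A0 ^ N - (\<Prod>i\<in>UNIV. T ^ (w i * Poly_Mapping.lookup A0 i * (?n + 1))) \<in> P"
    unfolding monomial_value_def prod_power_distrib
  proof (rule ideal_prod_cong[OF iP])
    fix i
    have "Poly_Mapping.lookup A0 i * N = a i * (w i * Poly_Mapping.lookup A0 i * (?n + 1))"
      by (simp only: N_def a(1)[of i, symmetric] mult_ac)
    then show "(x i ^ Poly_Mapping.lookup A0 i) ^ N - T ^ (w i * Poly_Mapping.lookup A0 i * (?n + 1)) \<in> P"
      using eqp[of i "w i * Poly_Mapping.lookup A0 i * (?n + 1)"] by (simp only: power_mult[symmetric])
  qed
  moreover have "(\<Prod>i\<in>UNIV. T ^ (w i * Poly_Mapping.lookup A0 i * (?n + 1))) = T ^ q0"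
    by (simp only: power_sum[symmetric] q0_def k0_def wdeg_def sum_distrib_right mult.commute[of "?n + 1"])
  ultimately have low: "monomial_value x A0 ^ N - T ^ q0 \<in> P" by simp
  obtain p r where pr: "p \<in> P" "monomial_value x A0 ^ N = p + r * T ^ Suc q0"
    using mem unfolding ideal_plus_iff Bex_def mem_principal by blast
  have "(1 - r * T) * T ^ q0 = p - (monomial_value x A0 ^ N - T ^ q0)"
    unfolding pr(2) by (simp add: algebra_simps)
  also have "\<dots> \<in> P" using pr(1) low by (rule ring_ideal_diff[OF iP])
  finally have "1 - r * T \<in> P \<or> T ^ q0 \<in> P" by (rule prime_idealD(3)[OF P])
  \<comment> \<open>T lies in the maximal ideal, so \<open>1 - r * T\<close> cannot belong to a
    proper ideal.\<close>
  moreover have "1 - r * T \<notin> P"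
  proof
    assume "1 - r * T \<in> P"
    then have "1 - r * T \<in> max_ideal"
      using proper_ideal_subset_max_ideal[OF iP] P by (auto simp: prime_ideal_def)
    moreover have "T = x i0 ^ (a i0 - 1) * x i0" unfolding T_def using a0[of i0]
      by (simp flip: power_Suc2)
    then have "r * T \<in> max_ideal" using x ring_ideal_max_ideal by (auto intro!: ideal_mult)
    ultimately have "(1 - r * T) + r * T \<in> max_ideal" by (rule ideal_add[OF ring_ideal_max_ideal])
    then show False using prime_idealD(2)[OF prime_ideal_max_ideal[where 'a = 'a]] by simp
  qed
  ultimately have "T \<in> P" using prime_ideal_power[OF P] by blast
  then have "(x i ^ a i - x i0 ^ a i0) + T \<in> P" using eq[of i] by (intro ideal_add iP)
  then show ?thesis unfolding T_def using prime_ideal_power[OF P, of "x i" "a i"] by simp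
qed

text \<open>A finite supremum of naturals is attained: chains all shorter than \<open>n\<close>
  would bound the dimension by \<open>n - 1\<close>, which is smaller because \<open>n\<close> is
  positive. A longer chain is truncated.\<close>

lemma ex_prime_chain_krull_dim:
  assumes "krull_dim TYPE('a::comm_ring_1) = enat n" "0 < n"
  shows "\<exists>P :: nat \<Rightarrow> 'a set. prime_chain n P"
proof -
  let ?K = "{k. \<exists>P :: nat \<Rightarrow> 'a set. prime_chain k P}"
  have "\<exists>k\<in>?K. n \<le> k"
  proof (rule ccontr)
    assume "\<not> ?thesis"
    then have "enat k \<le> enat (n - 1)" if "k \<in> ?K" for k using that by force
    then have "krull_dim TYPE('a) \<le> enat (n - 1)"
      unfolding krull_dim_def prime_chain_def[symmetric] by (rule SUP_least)
    then show False using assms by simp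
  qed
  then obtain k and P :: "nat \<Rightarrow> 'a set" where "prime_chain k P" "n \<le> k" by blast
  then have "prime_chain n P" unfolding prime_chain_def by (meson less_le_trans order_trans)
  then show ?thesis by blast
qed

text \<open>Generic weights single out one monomial \<open>A0\<close> of lowest weight with a unit coefficient. Such a
  relation makes the maximal ideal the only prime over \<open>n - 1\<close> elements.\<close>

theorem analytically_independent:
  fixes x :: "'n::finite \<Rightarrow> 'a::regular_local_ring"
  assumes rsp: "regular_system_of_parameters x" and S: "finite S" "\<And>A. A \<in> S \<Longrightarrow> mdeg A = d"
    and rel: "(\<Sum>A\<in>S. c A * monomial_value x A) \<in> max_ideal_power (Suc d)"
    and A: "A \<in> S"
  shows "c A \<in> max_ideal"
proof (rule ccontr)
  assume cA: "c A \<notin> max_ideal"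
  have mx: "max_ideal = ideal_generated (range x)" and dim: "krull_dim TYPE('a) = enat CARD('n)"
    using rsp by (auto simp: regular_system_of_parameters_def)
  have mp: "max_ideal_power k = mono_ideal x {A. mdeg A = k}" for k
    unfolding mx by (rule ideal_power_eq_mono_ideal)
  have xm: "x i \<in> max_ideal" for i unfolding mx by (intro ideal_generated_base) simp
  define S' where "S' = {A\<in>S. c A \<notin> max_ideal}"
  have S': "finite S'" "A \<in> S'" using S A cA by (auto simp: S'_def)
  obtain e where e: "inj_on (wdeg e) S'" using separating_weights[OF S'(1)] by blast
  define A0 where "A0 = arg_min_on (wdeg e) S'"
  have A0: "A0 \<in> S'" and min: "\<And>B. B \<in> S' \<Longrightarrow> wdeg e A0 \<le> wdeg e B"
    using arg_min_if_finite[of S' "wdeg e"] S' unfolding A0_def by (auto simp: not_less)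
  \<comment> \<open>M exceeds the \<open>e\<close>-weight of \<open>A0\<close>, so in
    \<open>w\<close> the degree dominates: every monomial of degree \<open>d + 1\<close> is heavier
    than \<open>A0\<close>, and among those of degree \<open>d\<close> the separating weight
    \<open>e\<close> decides.\<close>
  define M where "M = Suc (d * (\<Sum>i\<in>UNIV. e i))"
  define w where "w i = M + e i" for i
  have wM: "wdeg w B = M * mdeg B + wdeg e B" for B
    by (simp add: mdeg_def wdeg_def w_def distrib_right sum.distrib sum_distrib_left)
  have eA0: "wdeg e A0 < M"
  proof -
    have "wdeg e A0 \<le> (\<Sum>i\<in>UNIV. (\<Sum>i\<in>UNIV. e i) * Poly_Mapping.lookup A0 i)"
      unfolding wdeg_def by (intro sum_mono mult_right_mono member_le_sum) auto
    also have "\<dots> = (\<Sum>i\<in>UNIV. e i) * mdeg A0" by (simp add: mdeg_def sum_distrib_left)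
    also have "mdeg A0 = d" using A0 S by (simp add: S'_def)
    finally show ?thesis by (simp add: M_def mult.commute)
  qed
  let ?V = "{B. wdeg w A0 < wdeg w B}"
  have V: "ring_ideal (mono_ideal x ?V)" by (rule ring_ideal_mono_ideal)
  have dA0: "mdeg A0 = d" using A0 S by (simp add: S'_def)
  have high: "max_ideal_power (Suc d) \<subseteq> mono_ideal x ?V"
    unfolding mp using eA0 by (intro mono_ideal_mono) (auto simp: wM dA0)
  have "(\<Sum>A\<in>S. c A * monomial_value x A) = c A0 * monomial_value x A0 + (\<Sum>A\<in>S - {A0}. c A * monomial_value x A)"
    using S A0 by (intro sum.remove) (auto simp: S'_def)
  moreover have "(\<Sum>A\<in>S - {A0}. c A * monomial_value x A) \<in> mono_ideal x ?V"
  proof (rule ideal_sum[OF V])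
    fix B assume B: "B \<in> S - {A0}"
    show "c B * monomial_value x B \<in> mono_ideal x ?V"
    proof (cases "c B \<in> max_ideal")
      case True
      have "monomial_value x B \<in> max_ideal_power d"
        unfolding mp using B S by (intro mono_ideal_base) simp
      from ideal_power_mult_mem[OF this True] have "c B * monomial_value x B \<in> max_ideal_power (Suc d)"
        by (simp only: mult.commute)
      then show ?thesis using high by blast
    next
      case False
      then have B': "B \<in> S'" using B by (simp add: S'_def)
      then have "wdeg e A0 \<noteq> wdeg e B" using e A0 B by (auto dest: inj_onD)
      then have "wdeg e A0 < wdeg e B" using min[OF B'] by simp
      moreover have "mdeg B = d" using B S by simp
      ultimately have "B \<in> ?V" by (simp add: wM dA0)
      then show ?thesis by (intro ideal_mult V mono_ideal_base)
    qed
  qed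
  moreover have "(\<Sum>A\<in>S. c A * monomial_value x A) \<in> mono_ideal x ?V" using high rel by blast
  ultimately have cA0: "c A0 * monomial_value x A0 \<in> mono_ideal x ?V"
    using ring_ideal_diff[OF V, of "\<Sum>A\<in>S. c A * monomial_value x A" "\<Sum>A\<in>S - {A0}. c A * monomial_value x A"]
    by simp
  have "c A0 dvd 1" using A0 by (simp add: S'_def unit_iff_notin_max_ideal)
  then obtain u where u: "1 = c A0 * u" by (elim dvdE)
  have "u * (c A0 * monomial_value x A0) = (c A0 * u) * monomial_value x A0" by (simp only: mult_ac)
  then have rel': "monomial_value x A0 \<in> mono_ideal x ?V"
    using ideal_mult[OF V cA0, of u] by (simp flip: u)
  have w0: "0 < w i" for i by (simp add: w_def M_def)
  \<comment> \<open>A common multiple of the weights; the powers \<open>x i ^ a i\<close> then all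
    have the weight W and can be compared with each other.\<close>
  define W where "W = (\<Prod>i\<in>UNIV. w i)"
  have W0: "0 < W" unfolding W_def using w0 by (simp add: prod_pos)
  define a where "a i = W div w i" for i
  have a: "w i * a i = W" for i unfolding a_def W_def by (intro dvd_mult_div_cancel dvd_prodI) auto
  define i0 :: 'n where "i0 = undefined"
  define Y where "Y = (\<lambda>i. x i ^ a i - x i0 ^ a i0) ` (UNIV - {i0})"
  have Yall: "x i \<in> P" if P: "prime_ideal P" "Y \<subseteq> P" for P i
  proof (rule parameters_in_prime[OF P(1) w0 xm a W0 _ rel'])
    fix i show "x i ^ a i - x i0 ^ a i0 \<in> P"
    proof (cases "i = i0")
      case True
      then show ?thesis using ideal_zero[OF prime_idealD(1)[OF P(1)]] by simp
    next
      case False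
      then show ?thesis using P(2) by (auto simp: Y_def)
    qed
  qed
  have Ymax: "P = max_ideal" if P: "prime_ideal P" "Y \<subseteq> P" for P
  proof
    show "P \<subseteq> max_ideal" using P(1) proper_ideal_subset_max_ideal by (auto simp: prime_ideal_def)
    show "max_ideal \<subseteq> P"
      unfolding mx by (rule ideal_generated_least) (use Yall[OF P] prime_idealD(1)[OF P(1)] in auto)
  qed
  have card: "card Y < CARD('n)"
  proof -
    have "card Y \<le> card (UNIV - {i0})" unfolding Y_def by (rule card_image_le) simp
    also have "\<dots> < CARD('n)" by (simp add: card_gt_0_iff)
    finally show ?thesis .
  qed
  have a0: "0 < a i" for i using a W0 by (metis gr0I less_irrefl mult_0_right)
  have Ym: "Y \<subseteq> max_ideal"
  proof -
    have "x i ^ a i \<in> max_ideal" for i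
    proof -
      have "x i ^ a i = x i ^ (a i - 1) * x i" using a0[of i] by (cases "a i") (simp_all add: mult.commute)
      then show ?thesis using ideal_mult[OF ring_ideal_max_ideal xm, of "x i ^ (a i - 1)" i] by simp
    qed
    then show ?thesis unfolding Y_def by (auto intro: ring_ideal_diff ring_ideal_max_ideal)
  qed
  \<comment> \<open>Y has fewer elements than there are parameters. A maximal chain, with its top
    replaced by the maximal ideal so that Y lies in it, therefore keeps at least one strict
    inclusion above Y; but the maximal ideal is the only prime there.\<close>
  obtain k where k: "CARD('n) = card Y + Suc k" using card less_imp_Suc_add by auto
  obtain P :: "nat \<Rightarrow> 'a set" where P: "prime_chain (card Y + Suc k) P"
    using ex_prime_chain_krull_dim[OF dim] k by auto
  define P' where "P' = P(card Y + Suc k := max_ideal)"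
  have "prime_chain (card Y + Suc k) P'"
    unfolding prime_chain_def
  proof (intro conjI allI impI)
    fix i assume "i \<le> card Y + Suc k"
    then show "prime_ideal (P' i)" using P prime_ideal_max_ideal by (auto simp: P'_def prime_chain_def)
  next
    fix i assume i: "i < card Y + Suc k"
    then have "P i \<subset> P (Suc i)" "prime_ideal (P (Suc i))" using P by (auto simp: prime_chain_def)
    moreover have "P (Suc i) \<subseteq> max_ideal"
      using calculation(2) proper_ideal_subset_max_ideal by (auto simp: prime_ideal_def)
    ultimately show "P' i \<subset> P' (Suc i)" using i by (auto simp: P'_def)
  qed
  moreover have "finite Y" by (simp add: Y_def)
  ultimately obtain Q where Q: "prime_chain (Suc k) Q" "Y \<subseteq> Q 0"
    using prime_chain_containing[of Y "Suc k" P'] Ym by (auto simp: P'_def)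
  then have "prime_ideal (Q 0)" "prime_ideal (Q 1)" "Q 0 \<subset> Q 1" by (auto simp: prime_chain_def)
  then show False using Ymax[of "Q 0"] Ymax[of "Q 1"] Q(2) by blast
qed

section \<open>Expansions with respect to independent parameters\<close>

definition upset :: "('n \<Rightarrow>\<^sub>0 nat) set \<Rightarrow> bool" where
  "upset V \<longleftrightarrow> (\<forall>A\<in>V. \<forall>B. exp_le A B \<longrightarrow> B \<in> V)"

lemma upsetD: "upset V \<Longrightarrow> A \<in> V \<Longrightarrow> exp_le A B \<Longrightarrow> B \<in> V"
  by (auto simp: upset_def)

lemma upset_not_le: "upset {A. \<not> exp_le A A0}"
  by (auto simp: upset_def dest: exp_le_trans)

lemma finite_mdeg_le: "finite {A :: 'n::finite \<Rightarrow>\<^sub>0 nat. mdeg A \<le> k}"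
proof (rule finite_imageD)
  show "inj_on Poly_Mapping.lookup {A :: 'n \<Rightarrow>\<^sub>0 nat. mdeg A \<le> k}"
    by (auto simp: inj_on_def intro: poly_mapping_eqI)
  have "Poly_Mapping.lookup A i \<le> mdeg A" for A :: "'n \<Rightarrow>\<^sub>0 nat" and i
    unfolding mdeg_def by (intro member_le_sum) auto
  then have "Poly_Mapping.lookup ` {A :: 'n \<Rightarrow>\<^sub>0 nat. mdeg A \<le> k} \<subseteq> PiE UNIV (\<lambda>_. {..k})"
    by (auto intro: order_trans)
  then show "finite (Poly_Mapping.lookup ` {A :: 'n \<Rightarrow>\<^sub>0 nat. mdeg A \<le> k})"
    by (rule finite_subset) (intro finite_PiE, auto)
qed

lemma finite_mdeg_eq: "finite {A :: 'n::finite \<Rightarrow>\<^sub>0 nat. mdeg A = k}"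
  by (rule finite_subset[OF _ finite_mdeg_le[of k]]) auto

lemma finite_mdeg_less: "finite {A :: 'n::finite \<Rightarrow>\<^sub>0 nat. mdeg A < k}"
  by (rule finite_subset[OF _ finite_mdeg_le[of k]]) auto

lemma exp_le_mdeg: "exp_le A B \<Longrightarrow> mdeg A \<le> mdeg B"
  unfolding mdeg_def exp_le_def by (intro sum_mono) auto

lemma exp_le_mdeg_less:
  assumes "exp_le A B" "A \<noteq> B"
  shows "mdeg A < mdeg B"
proof -
  obtain C where C: "B = A + C" using assms(1) by (rule exp_leE)
  then have "mdeg C \<noteq> 0" using assms(2) by (auto simp: mdeg_zero_iff)
  then show ?thesis using C by (simp add: mdeg_add)
qed

definition minimals :: "('n \<Rightarrow>\<^sub>0 nat) set \<Rightarrow> ('n \<Rightarrow>\<^sub>0 nat) set" where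
  "minimals V = {A\<in>V. \<forall>B\<in>V. exp_le B A \<longrightarrow> B = A}"

lemma minimals_below:
  fixes V :: "('n::finite \<Rightarrow>\<^sub>0 nat) set"
  assumes "A \<in> V"
  shows "\<exists>B\<in>minimals V. exp_le B A"
  using assms
proof (induction "mdeg A" arbitrary: A rule: less_induct)
  case less
  show ?case
  proof (cases "A \<in> minimals V")
    case True
    then show ?thesis using exp_le_refl by blast
  next
    case False
    then obtain B where B: "B \<in> V" "exp_le B A" "B \<noteq> A"
      using less.prems unfolding minimals_def by blast
    then obtain C where "C \<in> minimals V" "exp_le C B" using less.hyps exp_le_mdeg_less by blast
    then show ?thesis using B exp_le_trans by blast
  qed
qed

text \<open>Coordinates are treated one after another. A monotone subsequence of naturals that is
  not increasing is decreasing, hence constant from the place where it reaches its least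
  value.\<close>

lemma ex_mono_subsequence:
  fixes a :: "nat \<Rightarrow> 'i \<Rightarrow> nat"
  assumes "finite I"
  shows "\<exists>r. strict_mono r \<and> (\<forall>i\<in>I. incseq (\<lambda>k. a (r k) i))"
  using assms
proof induction
  case empty
  show ?case by (rule exI[of _ id]) (simp add: strict_mono_def)
next
  case (insert j I)
  then obtain r where r: "strict_mono (r :: nat \<Rightarrow> nat)" "\<forall>i\<in>I. incseq (\<lambda>k. a (r k) i)" by blast
  obtain s where s: "strict_mono (s :: nat \<Rightarrow> nat)" "monoseq (\<lambda>k. a (r (s k)) j)"
    using seq_monosub[of "\<lambda>k. a (r k) j"] by (auto simp: o_def)
  have "\<exists>t. strict_mono (t :: nat \<Rightarrow> nat) \<and> incseq (\<lambda>k. a (r (s (t k))) j)"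
  proof (cases "incseq (\<lambda>k. a (r (s k)) j)")
    case True
    then show ?thesis by (intro exI[of _ id]) (simp add: strict_mono_def)
  next
    case False
    then have dec: "decseq (\<lambda>k. a (r (s k)) j)" using s(2) by (simp add: monoseq_iff)
    define m where "m = (LEAST m. \<exists>k. a (r (s k)) j = m)"
    have "\<exists>k. a (r (s k)) j = m" unfolding m_def by (rule LeastI_ex) blast
    then obtain k where k: "a (r (s k)) j = m" by blast
    have "a (r (s (k + l))) j = m" for l
    proof (rule antisym)
      show "a (r (s (k + l))) j \<le> m" using dec k by (metis decseqD le_add1)
      show "m \<le> a (r (s (k + l))) j" unfolding m_def by (rule Least_le) blast
    qed
    then show ?thesis by (intro exI[of _ "\<lambda>l. k + l"]) (simp add: strict_mono_def incseq_def)
  qed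
  then obtain t where t: "strict_mono (t :: nat \<Rightarrow> nat)" "incseq (\<lambda>k. a (r (s (t k))) j)" by blast
  have "strict_mono (r \<circ> s \<circ> t)" using r(1) s(1) t(1) by (intro strict_mono_o)
  moreover have "incseq (\<lambda>k. a ((r \<circ> s \<circ> t) k) i)" if "i \<in> insert j I" for i
  proof (cases "i = j")
    case True
    then show ?thesis using t by simp
  next
    case False
    then have "incseq (\<lambda>k. a (r k) i)" using that r by blast
    moreover have "mono s" "mono t" using s t strict_mono_mono by blast+
    ultimately show ?thesis by (auto simp: incseq_def mono_def)
  qed
  ultimately show ?case by blast
qed

text \<open>Dickson's lemma: infinitely many minimal exponents would contain two comparable ones,
  found in a subsequence that increases in every coordinate.\<close>

lemma finite_minimals: "finite (minimals (V :: ('n::finite \<Rightarrow>\<^sub>0 nat) set))"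
proof (rule ccontr)
  assume "infinite (minimals V)"
  then obtain a :: "nat \<Rightarrow> ('n \<Rightarrow>\<^sub>0 nat)" where a: "inj a" "range a \<subseteq> minimals V"
    using infinite_countable_subset by blast
  obtain r where r: "strict_mono r" "\<forall>i\<in>UNIV. incseq (\<lambda>k. Poly_Mapping.lookup (a (r k)) i)"
    using ex_mono_subsequence[of UNIV "\<lambda>k. Poly_Mapping.lookup (a k)"] by auto
  have "exp_le (a (r 0)) (a (r 1))" using r(2) by (auto simp: exp_le_def incseq_def)
  moreover have "a (r 0) \<in> minimals V" "a (r 1) \<in> minimals V" using a by auto
  ultimately have "a (r 0) = a (r 1)" by (auto simp: minimals_def)
  then have "r 0 = r 1" using a(1) by (auto dest: injD)
  then show False using strict_monoD[OF r(1), of 0 1] by simp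
qed

text \<open>What the ring and its completion have in common. The first assumption says that the
  graded ring of the filtration by degree is a polynomial ring over the residue ring, the second
  that the ideal of the parameters consists exactly of the non-units.\<close>

locale independent_parameters =
  fixes x :: "'n::finite \<Rightarrow> 'r::comm_ring_1"
  assumes indep: "finite S \<Longrightarrow> (\<And>A. A \<in> S \<Longrightarrow> mdeg A = d) \<Longrightarrow>
      (\<Sum>A\<in>S. c A * monomial_value x A) \<in> mono_ideal x {A. mdeg A = Suc d} \<Longrightarrow> A \<in> S \<Longrightarrow>
      c A \<in> mono_ideal x {A. mdeg A = 1}"
    and unit_iff: "a dvd 1 \<longleftrightarrow> a \<notin> mono_ideal x {A. mdeg A = 1}"
begin

abbreviation level :: "nat \<Rightarrow> 'r set" where
  "level k \<equiv> mono_ideal x {A. mdeg A = k}"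

lemmas level_ideal = ring_ideal_mono_ideal[of x]

lemma level_antimono: "k \<le> l \<Longrightarrow> level l \<subseteq> level k"
  by (subst (1 2) mono_ideal_mdeg_ge[symmetric]) (intro mono_ideal_mono, auto)

lemma level_mult: "a \<in> level k \<Longrightarrow> b \<in> level l \<Longrightarrow> a * b \<in> level (k + l)"
  by (erule (1) mono_ideal_mult) (simp add: mdeg_add)

text \<open>The degree is raised one unit at a time. The part of lowest degree is a relation, so its
  coefficients lie in \<open>level 1\<close> and can be absorbed into monomials of higher degree;
  these stay in V because V is upward closed.\<close>

lemma mono_ideal_Int_level:
  assumes V: "upset V" and a: "a \<in> mono_ideal x V" "a \<in> level k"
  shows "a \<in> mono_ideal x {A\<in>V. k \<le> mdeg A}"
  using a(2)
proof (induction k)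
  case 0
  then show ?case using a by simp
next
  case (Suc k)
  have "a \<in> level k" using Suc.prems level_antimono[of k "Suc k"] by auto
  then have "a \<in> mono_ideal x {A\<in>V. k \<le> mdeg A}" by (rule Suc.IH)
  then obtain S c where S: "finite S" "S \<subseteq> {A\<in>V. k \<le> mdeg A}"
    "a = (\<Sum>A\<in>S. c A * monomial_value x A)"
    unfolding mono_ideal_explicit by blast
  let ?W = "{A\<in>V. Suc k \<le> mdeg A}"
  define S0 where "S0 = {A\<in>S. mdeg A = k}"
  have S0: "finite S0" "S0 \<subseteq> S" using S by (auto simp: S0_def)
  have split: "a = (\<Sum>A\<in>S - S0. c A * monomial_value x A) + (\<Sum>A\<in>S0. c A * monomial_value x A)"
    unfolding S(3) using S S0 by (intro sum.subset_diff)
  have hi: "(\<Sum>A\<in>S - S0. c A * monomial_value x A) \<in> mono_ideal x ?W"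
    using S(2) by (intro ideal_sum level_ideal ideal_mult mono_ideal_base) (auto simp: S0_def)
  have "mono_ideal x ?W \<subseteq> level (Suc k)"
    by (subst mono_ideal_mdeg_ge[symmetric]) (intro mono_ideal_mono, auto)
  then have "a - (\<Sum>A\<in>S - S0. c A * monomial_value x A) \<in> level (Suc k)"
    using hi Suc.prems by (intro ring_ideal_diff level_ideal) auto
  then have lo: "(\<Sum>A\<in>S0. c A * monomial_value x A) \<in> level (Suc k)" using split by simp
  have "c A * monomial_value x A \<in> mono_ideal x ?W" if A: "A \<in> S0" for A
  proof -
    have "c A \<in> level 1" by (rule indep[OF S0(1) _ lo A]) (simp add: S0_def)
    moreover have "monomial_value x A \<in> mono_ideal x {A}" by (rule mono_ideal_base) simp
    ultimately show ?thesis
      by (rule mono_ideal_mult)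
        (use A S S0 upsetD[OF V, of A] in \<open>auto simp: mdeg_add S0_def\<close>)
  qed
  then have "(\<Sum>A\<in>S0. c A * monomial_value x A) \<in> mono_ideal x ?W" by (intro ideal_sum level_ideal)
  then show ?case using split hi ideal_add[OF level_ideal] by metis
qed

text \<open>The test behind all comparisons of expansions: modulo the monomials that do not divide
  \<open>x^A0\<close>, only the term at \<open>A0\<close> of a suitable sum survives. Restricting to
  degrees at least that of \<open>A0\<close> leaves a homogeneous relation in that degree.\<close>

lemma coefficient_in_level:
  assumes "c * monomial_value x A0 \<in> mono_ideal x {A. \<not> exp_le A A0}"
  shows "c \<in> level 1"
proof -
  let ?d = "mdeg A0"
  have "c * monomial_value x A0 \<in> level ?d" by (intro ideal_mult level_ideal mono_ideal_base) simp
  from mono_ideal_Int_level[OF upset_not_le assms this]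
  obtain S b where S: "finite S" "S \<subseteq> {A\<in>{A. \<not> exp_le A A0}. ?d \<le> mdeg A}"
    "c * monomial_value x A0 = (\<Sum>A\<in>S. b A * monomial_value x A)"
    unfolding mono_ideal_explicit by blast
  define S0 where "S0 = {A\<in>S. mdeg A = ?d}"
  have S0: "finite S0" "S0 \<subseteq> S" "A0 \<notin> S0" using S by (auto simp: S0_def)
  have "(\<Sum>A\<in>S - S0. b A * monomial_value x A) \<in> mono_ideal x {A. Suc ?d \<le> mdeg A}"
    using S(2) by (intro ideal_sum level_ideal ideal_mult mono_ideal_base) (force simp: S0_def)
  then have hi: "(\<Sum>A\<in>S - S0. b A * monomial_value x A) \<in> level (Suc ?d)"
    by (simp only: mono_ideal_mdeg_ge)
  \<comment> \<open>Moves the term at \<open>A0\<close> to the other side, where it becomes one more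
    coefficient of a single homogeneous relation.\<close>
  define b' where "b' = b(A0 := - c)"
  have "(\<Sum>A\<in>insert A0 S0. b' A * monomial_value x A) = - (c * monomial_value x A0) + (\<Sum>A\<in>S0. b A * monomial_value x A)"
    using S0 by (simp add: b'_def) (intro sum.cong, auto)
  also have "\<dots> = - (\<Sum>A\<in>S - S0. b A * monomial_value x A)"
    unfolding S(3) sum.subset_diff[OF S0(2) S(1)] by simp
  also have "\<dots> \<in> level (Suc ?d)" using hi by (intro ideal_uminus level_ideal)
  finally have "b' A0 \<in> level 1"
    by (rule indep[rotated 2]) (use S0 in \<open>auto simp: S0_def\<close>)
  from ideal_uminus[OF level_ideal this] show ?thesis by (simp add: b'_def)
qed

text \<open>The digits are chosen degree by degree; the remainder after degree \<open>k\<close> lies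
  in the next level. The digits may be nonzero for infinitely many exponents.\<close>

lemma formal_expansion:
  "\<exists>u. (\<forall>A. u A = 0 \<or> u A dvd 1) \<and>
    (\<forall>k. a - (\<Sum>A | mdeg A < k. u A * monomial_value x A) \<in> level k)"
proof -
  define P where "P k v \<longleftrightarrow> (\<forall>A. v A = 0 \<or> v A dvd 1) \<and>
    a - (\<Sum>A | mdeg A < k. v A * monomial_value x A) \<in> level k" for k and v :: "('n \<Rightarrow>\<^sub>0 nat) \<Rightarrow> 'r"
  have "\<exists>v. \<forall>k. P k (v k) \<and> (\<forall>A. mdeg A < k \<longrightarrow> v (Suc k) A = v k A)"
  proof (rule dependent_nat_choice)
    show "\<exists>v. P 0 v" unfolding P_def by (rule exI[of _ "\<lambda>_. 0"]) (simp add: mono_ideal_zero_mdeg)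
  next
    fix v k assume v: "P k v"
    then obtain S c where S: "finite S" "S \<subseteq> {A. mdeg A = k}"
      "a - (\<Sum>A | mdeg A < k. v A * monomial_value x A) = (\<Sum>A\<in>S. c A * monomial_value x A)"
      unfolding P_def mono_ideal_explicit by blast
    \<comment> \<open>A coefficient that is not a unit is replaced by 0; the discarded term belongs
      to the next level and is expanded again there.\<close>
    define v' where "v' A = (if mdeg A < k then v A else if A \<in> S \<and> c A dvd 1 then c A else 0)" for A
    have "{A :: 'n \<Rightarrow>\<^sub>0 nat. mdeg A < Suc k} = {A. mdeg A < k} \<union> {A. mdeg A = k}" by auto
    then have "(\<Sum>A | mdeg A < Suc k. v' A * monomial_value x A) =
        (\<Sum>A | mdeg A < k. v' A * monomial_value x A) + (\<Sum>A | mdeg A = k. v' A * monomial_value x A)"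
      by (simp add: sum.union_disjoint[OF finite_mdeg_less finite_mdeg_eq] disjoint_iff)
    also have "(\<Sum>A | mdeg A < k. v' A * monomial_value x A) = (\<Sum>A | mdeg A < k. v A * monomial_value x A)"
      by (intro sum.cong) (auto simp: v'_def)
    also have "(\<Sum>A | mdeg A = k. v' A * monomial_value x A) = (\<Sum>A\<in>S. v' A * monomial_value x A)"
      using S by (intro sum.mono_neutral_right finite_mdeg_eq) (auto simp: v'_def)
    finally have "a - (\<Sum>A | mdeg A < Suc k. v' A * monomial_value x A) =
        (\<Sum>A\<in>S. c A * monomial_value x A) - (\<Sum>A\<in>S. v' A * monomial_value x A)"
      using S(3) by (simp add: algebra_simps)
    also have "\<dots> = (\<Sum>A\<in>S. (c A - v' A) * monomial_value x A)"
      by (simp add: sum_subtractf left_diff_distrib)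
    also have "\<dots> \<in> level (Suc k)"
    proof (rule ideal_sum[OF level_ideal])
      fix A assume A: "A \<in> S"
      then have "mdeg A = k" using S by blast
      then have "c A - v' A \<in> level 1"
        using A unit_iff[of "c A"] ideal_zero[OF level_ideal] by (auto simp: v'_def)
      moreover have "monomial_value x A \<in> level k" using A S by (intro mono_ideal_base) blast
      ultimately show "(c A - v' A) * monomial_value x A \<in> level (Suc k)"
        using level_mult[of _ 1 _ k] by simp
    qed
    finally have "P (Suc k) v'" using v unfolding P_def v'_def by auto
    then show "\<exists>w. P (Suc k) w \<and> (\<forall>A. mdeg A < k \<longrightarrow> w A = v A)"
      by (intro exI[of _ v']) (auto simp: v'_def)
  qed
  then obtain v where v: "\<And>k. P k (v k)" "\<And>k A. mdeg A < k \<Longrightarrow> v (Suc k) A = v k A" by blast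
  define u where "u A = v (Suc (mdeg A)) A" for A
  have "v k A = u A" if "mdeg A < k" for A k
  proof -
    have "Suc (mdeg A) \<le> k" using that by simp
    then show ?thesis
      by (induction k rule: dec_induct) (auto simp: u_def v(2))
  qed
  then have "(\<Sum>A | mdeg A < k. u A * monomial_value x A) = (\<Sum>A | mdeg A < k. v k A * monomial_value x A)" for k
    by (intro sum.cong) auto
  then show ?thesis using v(1) unfolding P_def u_def by (intro exI[of _ u]) (auto simp: u_def)
qed

lemma mono_ideal_sum_except:
  assumes "finite S" "A0 \<in> S" "\<And>A. A \<in> S \<Longrightarrow> A \<noteq> A0 \<Longrightarrow> c A \<noteq> 0 \<Longrightarrow> A \<in> V"
  shows "(\<Sum>A\<in>S. c A * monomial_value x A) - c A0 * monomial_value x A0 \<in> mono_ideal x V"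
proof -
  have "(\<Sum>A\<in>S. c A * monomial_value x A) - c A0 * monomial_value x A0 = (\<Sum>A\<in>S - {A0}. c A * monomial_value x A)"
    using assms(1,2) by (simp add: sum.remove)
  also have "\<dots> \<in> mono_ideal x V"
  proof (rule ideal_sum[OF level_ideal])
    fix A assume A: "A \<in> S - {A0}"
    show "c A * monomial_value x A \<in> mono_ideal x V"
    proof (cases "c A = 0")
      case True
      then show ?thesis using ideal_zero[OF level_ideal] by simp
    next
      case False
      then show ?thesis using A assms(3) by (intro ideal_mult level_ideal mono_ideal_base) auto
    qed
  qed
  finally show ?thesis .
qed

end

locale closed_parameters = independent_parameters +
  assumes mono_ideal_closed:
    "finite S \<Longrightarrow> (\<And>k. a \<in> mono_ideal x S + level k) \<Longrightarrow> a \<in> mono_ideal x S"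
begin

text \<open>Only the minimal exponents of a formal expansion are kept, and all multiples are
  collected in their coefficients. Such a coefficient agrees modulo \<open>level 1\<close> with the
  digit of the formal expansion, because modulo the monomials not dividing the given one both
  expansions reduce to a single term; hence it is a unit.\<close>

lemma ex_finite_expansion:
  "\<exists>S r. finite S \<and> (\<forall>A\<in>S. r A dvd 1) \<and> a = (\<Sum>A\<in>S. r A * monomial_value x A)"
proof -
  obtain u where u: "\<And>A. u A = 0 \<or> u A dvd 1"
    and ua: "\<And>k. a - (\<Sum>A | mdeg A < k. u A * monomial_value x A) \<in> level k"
    using formal_expansion by blast
  define S where "S = minimals {A. u A \<noteq> 0}"
  have S: "finite S" unfolding S_def by (rule finite_minimals)
  have "a \<in> mono_ideal x S"
  proof (rule mono_ideal_closed[OF S])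
    fix k
    have "(\<Sum>A | mdeg A < k. u A * monomial_value x A) \<in> mono_ideal x S"
    proof (rule ideal_sum[OF level_ideal])
      fix A
      show "u A * monomial_value x A \<in> mono_ideal x S"
      proof (cases "u A = 0")
        case True
        then show ?thesis using ideal_zero[OF level_ideal] by simp
      next
        case False
        then have "\<exists>B\<in>S. exp_le B A" unfolding S_def by (intro minimals_below) simp
        then have "mono_ideal x {A} \<subseteq> mono_ideal x S" by (intro mono_ideal_upward) auto
        then show ?thesis using mono_ideal_base[of A "{A}" x] by (intro ideal_mult level_ideal) auto
      qed
    qed
    from set_plus_intro[OF this ua[of k]] show "a \<in> mono_ideal x S + level k" by simp
  qed
  then obtain S' c where S': "finite S'" "S' \<subseteq> S" "a = (\<Sum>A\<in>S'. c A * monomial_value x A)"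
    unfolding mono_ideal_explicit by blast
  define r where "r A = (if A \<in> S' then c A else 0)" for A
  have a: "a = (\<Sum>A\<in>S. r A * monomial_value x A)"
    unfolding S'(3) r_def using S' S by (intro sum.mono_neutral_cong_left) auto
  have "r A dvd 1" if A: "A \<in> S" for A
  proof -
    let ?V = "{B. \<not> exp_le B A}"
    have V: "ring_ideal (mono_ideal x ?V)" by (rule level_ideal)
    have nle: "\<not> exp_le B A" if "u B \<noteq> 0" "B \<noteq> A" for B
      using that A unfolding S_def minimals_def by blast
    have uA: "u A \<noteq> 0" using A by (simp add: S_def minimals_def)
    have 1: "a - r A * monomial_value x A \<in> mono_ideal x ?V"
      unfolding a by (rule mono_ideal_sum_except[OF S A]) (use nle in \<open>auto simp: S_def minimals_def\<close>)
    have 2: "(\<Sum>B | mdeg B < Suc (mdeg A). u B * monomial_value x B) - u A * monomial_value x A \<in> mono_ideal x ?V"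
      by (rule mono_ideal_sum_except[OF finite_mdeg_less]) (use nle in auto)
    have "level (Suc (mdeg A)) \<subseteq> mono_ideal x ?V"
      by (rule mono_ideal_mono) (auto dest: exp_le_mdeg)
    then have 3: "a - (\<Sum>B | mdeg B < Suc (mdeg A). u B * monomial_value x B) \<in> mono_ideal x ?V"
      using ua by blast
    have "(r A - u A) * monomial_value x A =
       (a - (\<Sum>B | mdeg B < Suc (mdeg A). u B * monomial_value x B)) +
       ((\<Sum>B | mdeg B < Suc (mdeg A). u B * monomial_value x B) - u A * monomial_value x A) -
       (a - r A * monomial_value x A)"
      by (simp add: left_diff_distrib)
    also have "\<dots> \<in> mono_ideal x ?V" by (rule ring_ideal_diff[OF V ideal_add[OF V 3 2] 1])
    finally have d: "r A - u A \<in> level 1" by (rule coefficient_in_level)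
    have "r A \<notin> level 1"
    proof
      assume "r A \<in> level 1"
      then have "r A - (r A - u A) \<in> level 1" using d by (rule ring_ideal_diff[OF level_ideal])
      then show False using u[of A] uA unit_iff by simp
    qed
    then show ?thesis by (simp add: unit_iff)
  qed
  then show ?thesis using S a by blast
qed

lemma ex_expansion: "\<exists>\<rho>. is_expansion x f \<rho>"
proof -
  have "\<forall>b. \<exists>S r. finite S \<and> (\<forall>A\<in>S. r A dvd 1) \<and> coeff f b = (\<Sum>A\<in>S. r A * monomial_value x A)"
    by (intro allI ex_finite_expansion)
  from choice[OF this] obtain S where "\<forall>b. \<exists>r. finite (S b) \<and> (\<forall>A\<in>S b. r A dvd 1) \<and>
      coeff f b = (\<Sum>A\<in>S b. r A * monomial_value x A)" ..
  from choice[OF this] obtain r where "\<forall>b. finite (S b) \<and> (\<forall>A\<in>S b. r b A dvd 1) \<and>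
      coeff f b = (\<Sum>A\<in>S b. r b A * monomial_value x A)" ..
  then have S: "\<And>b. finite (S b)" "\<And>b A. A \<in> S b \<Longrightarrow> r b A dvd 1"
    "\<And>b. coeff f b = (\<Sum>A\<in>S b. r b A * monomial_value x A)"
    by blast+
  define K where "K = (SIGMA b:{..degree f}. S b)"
  have K: "finite K" unfolding K_def using S by auto
  define g where "g = (\<lambda>(A, b). if (b, A) \<in> K then r b A else 0)"
  have "finite {e. g e \<noteq> 0}"
    by (rule finite_subset[of _ "(\<lambda>(b, A). (A, b)) ` K"]) (use K in \<open>auto simp: g_def split: if_splits\<close>)
  then have g: "Poly_Mapping.lookup (Abs_poly_mapping g) = g" by (simp add: lookup_Abs_poly_mapping)
  let ?\<rho> = "Abs_poly_mapping g"
  let ?T = "\<lambda>(A, b). monom (g (A, b) * monomial_value x A) b"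
  have keys: "Poly_Mapping.keys ?\<rho> \<subseteq> (\<lambda>(b, A). (A, b)) ` K"
    unfolding keys.rep_eq g by (auto simp: g_def split: if_splits)
  have "(\<Sum>e\<in>Poly_Mapping.keys ?\<rho>. ?T e) = (\<Sum>e\<in>(\<lambda>(b, A). (A, b)) ` K. ?T e)"
    using keys K by (intro sum.mono_neutral_left) (auto simp: in_keys_iff g)
  also have "\<dots> = (\<Sum>(b, A)\<in>K. monom (r b A * monomial_value x A) b)"
    by (subst sum.reindex) (auto simp: inj_on_def g_def intro!: sum.cong)
  also have "\<dots> = (\<Sum>b\<le>degree f. \<Sum>A\<in>S b. monom (r b A * monomial_value x A) b)"
    unfolding K_def using S by (simp add: sum.Sigma)
  also have "\<dots> = (\<Sum>b\<le>degree f. monom (coeff f b) b)"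
    by (simp add: S(3) monom_sum)
  also have "\<dots> = f" by (rule poly_as_sum_of_monoms)
  finally have "is_expansion x f ?\<rho>"
    unfolding is_expansion_def g using S(2) by (auto simp: g_def K_def)
  then show ?thesis by blast
qed

lemma is_expansion_expansion: "is_expansion x f (expansion x f)"
  unfolding expansion_def by (rule someI_ex) (rule ex_expansion)

end

section \<open>What all expansions of a polynomial have in common\<close>

lemma is_expansion_coeff:
  assumes "is_expansion x f \<rho>"
  shows "coeff f b = (\<Sum>A | (A, b) \<in> Poly_Mapping.keys \<rho>. Poly_Mapping.lookup \<rho> (A, b) * monomial_value x A)"
proof -
  let ?K = "Poly_Mapping.keys \<rho>"
  have "coeff f b = (\<Sum>(A, b')\<in>?K. if b' = b then Poly_Mapping.lookup \<rho> (A, b') * monomial_value x A else 0)"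
    using assms unfolding is_expansion_def
    by (auto simp: coeff_sum case_prod_unfold intro!: sum.cong)
  also have "\<dots> = (\<Sum>(A, b')\<in>{e\<in>?K. snd e = b}. Poly_Mapping.lookup \<rho> (A, b') * monomial_value x A)"
    by (subst sum.inter_filter) (auto intro!: sum.cong)
  also have "\<dots> = (\<Sum>A | (A, b) \<in> ?K. Poly_Mapping.lookup \<rho> (A, b) * monomial_value x A)"
    by (rule sum.reindex_bij_witness[of _ "\<lambda>A. (A, b)" fst]) auto
  finally show ?thesis .
qed

context independent_parameters
begin

lemma finite_expansion_slice: "finite {A. (A, b) \<in> Poly_Mapping.keys \<rho>}"
proof -
  have "finite (fst ` Poly_Mapping.keys \<rho>)" by simp
  then show ?thesis by (rule rev_finite_subset) force
qed

text \<open>A minimal exponent outside V would be the only term surviving modulo the monomials that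
  do not divide it, so its unit coefficient would lie in \<open>level 1\<close>. This bounds the
  Newton polyhedron for every choice of the expansion.\<close>

lemma expansion_keys_in_upset:
  assumes e: "is_expansion x f \<rho>" and V: "upset V" and f: "coeff f b \<in> mono_ideal x V"
    and k: "(A, b) \<in> Poly_Mapping.keys \<rho>"
  shows "A \<in> V"
proof (rule ccontr)
  assume "A \<notin> V"
  let ?S = "{A. (A, b) \<in> Poly_Mapping.keys \<rho>}"
  have "A \<in> ?S - V" using k \<open>A \<notin> V\<close> by simp
  then obtain B where B: "B \<in> minimals (?S - V)" using minimals_below[of A "?S - V"] by blast
  let ?W = "{C. \<not> exp_le C B}"
  have W: "ring_ideal (mono_ideal x ?W)" by (rule level_ideal)
  have BS: "B \<in> ?S" "B \<notin> V" using B by (auto simp: minimals_def)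
  have "(\<Sum>A\<in>?S. Poly_Mapping.lookup \<rho> (A, b) * monomial_value x A) - Poly_Mapping.lookup \<rho> (B, b) * monomial_value x B
      \<in> mono_ideal x ?W"
  proof (rule mono_ideal_sum_except[OF finite_expansion_slice BS(1)])
    fix C assume C: "C \<in> ?S" "C \<noteq> B"
    show "C \<in> ?W"
    proof (cases "C \<in> V")
      case True
      then show ?thesis using upsetD[OF V] BS by blast
    next
      case False
      then show ?thesis using B C unfolding minimals_def by blast
    qed
  qed
  then have 1: "coeff f b - Poly_Mapping.lookup \<rho> (B, b) * monomial_value x B \<in> mono_ideal x ?W"
    by (simp only: is_expansion_coeff[OF e])
  have "mono_ideal x V \<subseteq> mono_ideal x ?W"
    by (rule mono_ideal_mono) (use BS upsetD[OF V] in blast)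
  then have "coeff f b - (coeff f b - Poly_Mapping.lookup \<rho> (B, b) * monomial_value x B) \<in> mono_ideal x ?W"
    by (intro ring_ideal_diff[OF W subsetD[OF _ f] 1])
  then have "Poly_Mapping.lookup \<rho> (B, b) * monomial_value x B \<in> mono_ideal x ?W" by simp
  then have "Poly_Mapping.lookup \<rho> (B, b) \<in> level 1" by (rule coefficient_in_level)
  moreover have "Poly_Mapping.lookup \<rho> (B, b) dvd 1"
    using e BS unfolding is_expansion_def by (auto simp: in_keys_iff)
  ultimately show False by (simp add: unit_iff)
qed

text \<open>At a minimal exponent of V the residue of the coefficient is determined by f. This is
  what makes initial forms computable from an approximation of f.\<close>

lemma expansion_lowest_coefficient:
  assumes e: "is_expansion x f \<rho>" and V: "upset V" "upset (V - {A0})" "A0 \<in> V"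
    and f: "coeff f b - c * monomial_value x A0 \<in> mono_ideal x (V - {A0})"
  shows "Poly_Mapping.lookup \<rho> (A0, b) - c \<in> level 1"
proof -
  let ?S = "{A. (A, b) \<in> Poly_Mapping.keys \<rho>}"
  let ?W = "{C. \<not> exp_le C A0}"
  have W: "ring_ideal (mono_ideal x ?W)" by (rule level_ideal)
  have sub: "mono_ideal x (V - {A0}) \<subseteq> mono_ideal x ?W"
    by (rule mono_ideal_mono) (use V upsetD[OF V(2)] in blast)
  have "mono_ideal x (V - {A0}) \<subseteq> mono_ideal x V" by (rule mono_ideal_mono) auto
  then have "(coeff f b - c * monomial_value x A0) + c * monomial_value x A0 \<in> mono_ideal x V"
    using f V by (intro ideal_add ideal_mult level_ideal mono_ideal_base) auto
  then have SV: "?S \<subseteq> V" using expansion_keys_in_upset[OF e V(1)] by auto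
  have "(\<Sum>A\<in>insert A0 ?S. Poly_Mapping.lookup \<rho> (A, b) * monomial_value x A) -
      Poly_Mapping.lookup \<rho> (A0, b) * monomial_value x A0 \<in> mono_ideal x ?W"
  proof (rule mono_ideal_sum_except)
    fix C assume "C \<in> insert A0 ?S" "C \<noteq> A0"
    then have "C \<in> V - {A0}" using SV by blast
    then show "C \<in> ?W" using upsetD[OF V(2), of C A0] by blast
  qed (simp_all add: finite_expansion_slice)
  moreover have "(\<Sum>A\<in>insert A0 ?S. Poly_Mapping.lookup \<rho> (A, b) * monomial_value x A) = coeff f b"
    unfolding is_expansion_coeff[OF e] using finite_expansion_slice
    by (intro sum.mono_neutral_right) (auto simp: in_keys_iff)
  ultimately have "coeff f b - Poly_Mapping.lookup \<rho> (A0, b) * monomial_value x A0 \<in> mono_ideal x ?W" by simp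
  then have "(coeff f b - c * monomial_value x A0) - (coeff f b - Poly_Mapping.lookup \<rho> (A0, b) * monomial_value x A0)
      \<in> mono_ideal x ?W"
    using f sub by (blast intro: ring_ideal_diff[OF W])
  then have "(Poly_Mapping.lookup \<rho> (A0, b) - c) * monomial_value x A0 \<in> mono_ideal x ?W"
    by (simp add: left_diff_distrib)
  then show ?thesis by (rule coefficient_in_level)
qed

end

text \<open>Serves to spread an element over a fixed list of monomials with all coefficients in a
  prescribed level.\<close>

lemma ring_ideal_sums:
  assumes "ring_ideal (I :: 'r::comm_ring_1 set)"
  shows "ring_ideal {a. \<exists>d. (\<forall>B. d B \<in> I) \<and> a = (\<Sum>B\<in>S. d B * g B)}" (is "ring_ideal ?J")
proof (rule ring_idealI)
  show "0 \<in> ?J" by (intro CollectI exI[of _ "\<lambda>_. 0"]) (simp add: ideal_zero[OF assms])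
next
  fix a b assume "a \<in> ?J" "b \<in> ?J"
  then obtain d e where "\<forall>B. d B \<in> I" "a = (\<Sum>B\<in>S. d B * g B)" "\<forall>B. e B \<in> I" "b = (\<Sum>B\<in>S. e B * g B)"
    by blast
  then show "a + b \<in> ?J"
    by (intro CollectI exI[of _ "\<lambda>B. d B + e B"]) (simp add: ideal_add[OF assms] sum.distrib distrib_right)
next
  fix r a assume "a \<in> ?J"
  then obtain d where "\<forall>B. d B \<in> I" "a = (\<Sum>B\<in>S. d B * g B)" by blast
  then show "r * a \<in> ?J"
    by (intro CollectI exI[of _ "\<lambda>B. r * d B"]) (simp add: ideal_mult[OF assms] sum_distrib_left mult.assoc)
qed

locale complete_parameters = independent_parameters +
  assumes complete: "(\<And>k. s (Suc k) - s k \<in> level k) \<Longrightarrow> \<exists>l. \<forall>k. l - s k \<in> level k"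
    and separated: "(\<And>k. a \<in> level k) \<Longrightarrow> a = 0"
begin

text \<open>Approximations of \<open>a\<close> within the ideal are written with coefficients at the
  fixed monomials of S. The differences can be given coefficients in growing levels, so each
  coefficient converges separately and the limits represent \<open>a\<close>.\<close>

lemma mono_ideal_closed_aux:
  assumes S: "finite S" and a: "\<And>k. a \<in> mono_ideal x S + level k"
  shows "a \<in> mono_ideal x S"
proof -
  have "\<forall>k. \<exists>s. s \<in> mono_ideal x S \<and> a - s \<in> level k"
  proof
    fix k
    obtain s t where "s \<in> mono_ideal x S" "t \<in> level k" "a = s + t"
      using a[of k] unfolding ideal_plus_iff by blast
    then show "\<exists>s. s \<in> mono_ideal x S \<and> a - s \<in> level k" by (intro exI[of _ s]) simp
  qed
  from choice[OF this] obtain s where s: "\<And>k. s k \<in> mono_ideal x S" "\<And>k. a - s k \<in> level k" by blast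
  \<comment> \<open>An Artin-Rees constant: a monomial of degree at least \<open>k + K\<close> that
    is divisible by a member of S has a cofactor of degree at least \<open>k\<close>.\<close>
  obtain K where K: "\<And>A. A \<in> S \<Longrightarrow> mdeg A \<le> K"
    using finite_nat_set_iff_bounded_le[of "mdeg ` S"] S by auto
  define V where "V = {A. \<exists>B\<in>S. exp_le B A}"
  have V: "upset V" unfolding V_def upset_def using exp_le_trans by blast
  have SV: "mono_ideal x S \<subseteq> mono_ideal x V"
    by (rule mono_ideal_mono) (auto simp: V_def intro: exp_le_refl)
  have "\<forall>k. \<exists>d. (\<forall>B. d B \<in> level k) \<and> s (Suc (k + K)) - s (k + K) = (\<Sum>B\<in>S. d B * monomial_value x B)"
  proof
    fix k
    let ?J = "{a. \<exists>d. (\<forall>B. d B \<in> level k) \<and> a = (\<Sum>B\<in>S. d B * monomial_value x B)}"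
    have "s (Suc (k + K)) - s (k + K) \<in> mono_ideal x V"
      using s(1) SV by (blast intro: ring_ideal_diff[OF level_ideal])
    moreover have "(a - s (k + K)) - (a - s (Suc (k + K))) \<in> level (k + K)"
      using s(2)[of "Suc (k + K)"] level_antimono[of "k + K" "Suc (k + K)"]
      by (intro ring_ideal_diff[OF level_ideal s(2)]) auto
    then have "s (Suc (k + K)) - s (k + K) \<in> level (k + K)" by simp
    ultimately have "s (Suc (k + K)) - s (k + K) \<in> mono_ideal x {A\<in>V. k + K \<le> mdeg A}"
      by (rule mono_ideal_Int_level[OF V])
    moreover have "mono_ideal x {A\<in>V. k + K \<le> mdeg A} \<subseteq> ?J"
    proof (rule mono_ideal_least[OF _ ring_ideal_sums[OF level_ideal]])
      fix A assume "A \<in> {A\<in>V. k + K \<le> mdeg A}"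
      then obtain B where B: "B \<in> S" "exp_le B A" "k + K \<le> mdeg A" by (auto simp: V_def)
      obtain C where C: "A = B + C" using B(2) by (rule exp_leE)
      then have "k \<le> mdeg C" using B K[of B] by (simp add: mdeg_add)
      then have mC: "monomial_value x C \<in> level k"
        by (subst mono_ideal_mdeg_ge[symmetric]) (intro mono_ideal_base, simp)
      define d where "d B' = (if B' = B then monomial_value x C else 0)" for B'
      have "(\<Sum>B'\<in>S. d B' * monomial_value x B') = (\<Sum>B'\<in>S. if B' = B then monomial_value x C * monomial_value x B else 0)"
        by (intro sum.cong) (auto simp: d_def)
      also have "\<dots> = monomial_value x A" using S B by (simp add: C monomial_value_add mult.commute)
      finally have "monomial_value x A = (\<Sum>B'\<in>S. d B' * monomial_value x B')" by simp
      moreover have "\<forall>B'. d B' \<in> level k" using mC ideal_zero[OF level_ideal] by (simp add: d_def)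
      ultimately show "monomial_value x A \<in> ?J" by blast
    qed
    ultimately show "\<exists>d. (\<forall>B. d B \<in> level k) \<and> s (Suc (k + K)) - s (k + K) = (\<Sum>B\<in>S. d B * monomial_value x B)"
      by blast
  qed
  from choice[OF this] obtain d where d: "\<And>k B. d k B \<in> level k"
    "\<And>k. s (Suc (k + K)) - s (k + K) = (\<Sum>B\<in>S. d k B * monomial_value x B)" by blast
  obtain S' c' where S': "finite S'" "S' \<subseteq> S" "s K = (\<Sum>B\<in>S'. c' B * monomial_value x B)"
    using s(1)[of K] unfolding mono_ideal_explicit by blast
  define c where "c B = (if B \<in> S' then c' B else 0)" for B
  have c: "s K = (\<Sum>B\<in>S. c B * monomial_value x B)"
    unfolding S'(3) c_def using S' S by (intro sum.mono_neutral_cong_left) auto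
  define t where "t B l = c B + (\<Sum>k<l. d k B)" for B l
  have st: "s (l + K) = (\<Sum>B\<in>S. t B l * monomial_value x B)" for l
  proof (induction l)
    case 0
    then show ?case by (simp add: c t_def)
  next
    case (Suc l)
    have "s (Suc l + K) = s (l + K) + (s (Suc (l + K)) - s (l + K))" by simp
    also have "\<dots> = (\<Sum>B\<in>S. t B l * monomial_value x B) + (\<Sum>B\<in>S. d l B * monomial_value x B)"
      by (rule arg_cong2[of _ _ _ _ "(+)", OF Suc.IH d(2)])
    also have "\<dots> = (\<Sum>B\<in>S. (t B l + d l B) * monomial_value x B)"
      by (simp only: sum.distrib distrib_right)
    finally show ?case by (simp add: t_def add.assoc)
  qed
  have "\<forall>B. \<exists>T. \<forall>l. T - t B l \<in> level l"
    by (intro allI complete) (simp add: t_def d)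
  from choice[OF this] obtain T where T: "\<And>B l. T B - t B l \<in> level l" by blast
  have "a - (\<Sum>B\<in>S. T B * monomial_value x B) = 0"
  proof (rule separated)
    fix l
    have 1: "a - s (l + K) \<in> level l" using s(2)[of "l + K"] level_antimono[of l "l + K"] by auto
    have 2: "(\<Sum>B\<in>S. (T B - t B l) * monomial_value x B) \<in> level l"
      by (intro ideal_sum[OF level_ideal] ideal_mult_right[OF level_ideal] T)
    have "a - (\<Sum>B\<in>S. T B * monomial_value x B) = (a - s (l + K)) - (\<Sum>B\<in>S. (T B - t B l) * monomial_value x B)"
      unfolding st by (simp add: sum_subtractf left_diff_distrib)
    also have "\<dots> \<in> level l" using 1 2 by (rule ring_ideal_diff[OF level_ideal])
    finally show "a - (\<Sum>B\<in>S. T B * monomial_value x B) \<in> level l" .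
  qed
  then show ?thesis using S unfolding mono_ideal_explicit by (intro exI[of _ S] exI[of _ T]) simp
qed

end

sublocale complete_parameters \<subseteq> closed_parameters
  by unfold_locales (rule mono_ideal_closed_aux)

section \<open>The parameters of the completion\<close>

abbreviation hat :: "(nat \<Rightarrow> 'a::local_ring) \<Rightarrow> 'a completion" where
  "hat \<equiv> abs_completion"

lemma completion_rel_self: "completion_rel u u \<longleftrightarrow> coherent u"
  by (simp add: completion_rel_def)

lemma completion_cases: obtains u where "coherent u" "a = hat u"
  using Quotient_rep_abs[OF Quotient_completion] Quotient_abs_rep[OF Quotient_completion]
    Quotient_rep_reflp[OF Quotient_completion] completion_rel_self by metis

lemma hat_eq_iff:
  assumes "coherent u" "coherent v"
  shows "hat u = hat v \<longleftrightarrow> (\<forall>k. u k - v k \<in> max_ideal_power k)"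
  using Quotient_rel[OF Quotient_completion, of u v] assms
  by (auto simp: completion_rel_def)

lemma coherent_add: "coherent u \<Longrightarrow> coherent v \<Longrightarrow> coherent (\<lambda>k. u k + v k)"
  and coherent_diff: "coherent u \<Longrightarrow> coherent v \<Longrightarrow> coherent (\<lambda>k. u k - v k)"
  and coherent_mult: "coherent u \<Longrightarrow> coherent v \<Longrightarrow> coherent (\<lambda>k. u k * v k)"
  by (simp_all add: coherent_def ideal_cong[OF ring_ideal_ideal_power])

lemma hat_add: "coherent u \<Longrightarrow> coherent v \<Longrightarrow> hat u + hat v = hat (\<lambda>k. u k + v k)"
  and hat_diff: "coherent u \<Longrightarrow> coherent v \<Longrightarrow> hat u - hat v = hat (\<lambda>k. u k - v k)"
  and hat_mult: "coherent u \<Longrightarrow> coherent v \<Longrightarrow> hat u * hat v = hat (\<lambda>k. u k * v k)"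
  by (simp_all add: plus_completion.abs_eq minus_completion.abs_eq times_completion.abs_eq completion_rel_self)

lemma hat_const: "hat (\<lambda>_. a) = to_completion a"
  by (simp add: to_completion.abs_eq)

lemma hat_sum:
  assumes "finite S" "\<And>s. s \<in> S \<Longrightarrow> coherent (u s)"
  shows "coherent (\<lambda>k. \<Sum>s\<in>S. u s k) \<and> (\<Sum>s\<in>S. hat (u s)) = hat (\<lambda>k. \<Sum>s\<in>S. u s k)"
  using assms
proof induction
  case empty
  then show ?case by (simp add: zero_completion_def)
next
  case (insert s S)
  then show ?case by (simp add: coherent_add hat_add)
qed

lemma to_completion_add: "to_completion (a + b) = to_completion a + to_completion b"
  and to_completion_mult: "to_completion (a * b) = to_completion a * to_completion b"
  and to_completion_zero [simp]: "to_completion 0 = 0"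
  and to_completion_one [simp]: "to_completion 1 = 1"
  by (simp_all flip: hat_const add: hat_add hat_mult zero_completion_def one_completion_def)

lemma to_completion_sum: "to_completion (sum g S) = (\<Sum>s\<in>S. to_completion (g s))"
  by (induction S rule: infinite_finite_induct) (simp_all add: to_completion_add)

lemma to_completion_power: "to_completion (a ^ k) = to_completion a ^ k"
  by (induction k) (simp_all add: to_completion_mult)

lemma to_completion_prod: "to_completion (prod g S) = (\<Prod>s\<in>S. to_completion (g s))"
  by (induction S rule: infinite_finite_induct) (simp_all add: to_completion_mult)

lemma monomial_value_to_completion:
  "monomial_value (to_completion \<circ> x) A = to_completion (monomial_value x A)"
  by (simp add: monomial_value_def to_completion_prod to_completion_power)

text \<open>The kernel of the projection to the ring modulo the \<open>k\<close>-th power of its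
  maximal ideal. Completeness and separation are immediate for this filtration; its description by
  monomials of degree \<open>k\<close> is a separate matter, settled in
  \<open>in_level_iff_mono_ideal\<close>.\<close>

lift_definition in_level :: "nat \<Rightarrow> 'a::local_ring completion \<Rightarrow> bool" is "\<lambda>k u. u k \<in> max_ideal_power k"
proof -
  fix k and u v :: "nat \<Rightarrow> 'a"
  note I = ring_ideal_ideal_power[of "max_ideal :: 'a set" k]
  assume "completion_rel u v"
  then have d: "u k - v k \<in> max_ideal_power k" by (simp add: completion_rel_def)
  show "(u k \<in> max_ideal_power k) = (v k \<in> max_ideal_power k)"
  proof
    assume "u k \<in> max_ideal_power k"
    from ring_ideal_diff[OF I this d] show "v k \<in> max_ideal_power k" by simp
  next
    assume "v k \<in> max_ideal_power k"
    from ideal_add[OF I d this] show "u k \<in> max_ideal_power k" by simp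
  qed
qed

lemma in_level_hat: "coherent u \<Longrightarrow> in_level k (hat u) \<longleftrightarrow> u k \<in> max_ideal_power k"
  by (simp add: in_level.abs_eq completion_rel_self)

lemma ring_ideal_in_level: "ring_ideal {a. in_level k a}"
proof (rule ring_idealI)
  note I = ring_ideal_ideal_power[of max_ideal k]
  have "in_level k (hat (\<lambda>_. 0))" by (simp only: in_level_hat coherent_const) simp
  then show "0 \<in> {a. in_level k a}" by (simp add: hat_const)
  fix a b :: "'a completion" assume ab: "a \<in> {a. in_level k a}"
  obtain u where u: "coherent u" "a = hat u" by (rule completion_cases)
  obtain v where v: "coherent v" "b = hat v" by (rule completion_cases)
  show "b * a \<in> {a. in_level k a}"
    using ab u v by (simp add: in_level_hat hat_mult coherent_mult ideal_mult[OF I])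
  show "a + b \<in> {a. in_level k a}" if "b \<in> {a. in_level k a}"
    using ab that u v by (simp add: in_level_hat hat_add coherent_add ideal_add[OF I])
qed

lemma coherent_le:
  assumes "coherent u" "k \<le> l"
  shows "u l - u k \<in> max_ideal_power k"
  using assms(2)
proof (induction l rule: dec_induct)
  case base
  then show ?case by simp
next
  case (step l)
  have "max_ideal_power l \<subseteq> max_ideal_power k"
    using ideal_power_Suc_subset by (rule lift_Suc_antimono_le) (fact step)
  then have "u (Suc l) - u l \<in> max_ideal_power k" using assms(1) by (auto simp: coherent_def)
  from ideal_add[OF ring_ideal_ideal_power this step.IH] show ?case by simp
qed

lemma coherent_shift:
  assumes "coherent u"
  shows "coherent (\<lambda>l. u (k + l))" "hat (\<lambda>l. u (k + l)) = hat u"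
proof -
  show c: "coherent (\<lambda>l. u (k + l))"
    unfolding coherent_def
  proof
    fix l
    have "max_ideal_power (k + l) \<subseteq> max_ideal_power l"
      using ideal_power_Suc_subset by (rule lift_Suc_antimono_le) simp
    then show "u (k + Suc l) - u (k + l) \<in> max_ideal_power l"
      using assms by (auto simp: coherent_def)
  qed
  show "hat (\<lambda>l. u (k + l)) = hat u"
    using coherent_le[OF assms] by (simp add: hat_eq_iff[OF c assms])
qed

text \<open>The diagonal of the representatives is the limit: its \<open>k\<close>-th entry is the
  \<open>k\<close>-th entry of \<open>a k\<close>.\<close>

lemma completion_complete:
  assumes "\<And>k. in_level k (a (Suc k) - a k)"
  shows "\<exists>l. \<forall>k. in_level k (l - a k)"
proof -
  have "\<forall>k. \<exists>u. coherent u \<and> a k = hat u" using completion_cases by metis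
  from choice[OF this] obtain u where u: "\<And>k. coherent (u k)" "\<And>k. a k = hat (u k)" by blast
  have v: "coherent (\<lambda>k. u k k)"
    unfolding coherent_def
  proof
    fix k
    have "in_level k (hat (u (Suc k)) - hat (u k))" using assms[of k] by (simp only: u)
    then have "in_level k (hat (\<lambda>j. u (Suc k) j - u k j))" by (simp only: hat_diff u)
    then have "u (Suc k) k - u k k \<in> max_ideal_power k" by (simp add: in_level_hat coherent_diff u)
    moreover have "u (Suc k) (Suc k) - u (Suc k) k \<in> max_ideal_power k"
      using u(1)[of "Suc k"] by (simp add: coherent_def)
    ultimately have "(u (Suc k) (Suc k) - u (Suc k) k) + (u (Suc k) k - u k k) \<in> max_ideal_power k"
      by (intro ideal_add[OF ring_ideal_ideal_power])
    then show "u (Suc k) (Suc k) - u k k \<in> max_ideal_power k" by simp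
  qed
  have "in_level k (hat (\<lambda>k. u k k) - a k)" for k
    by (simp add: u hat_diff v in_level_hat coherent_diff)
  then show ?thesis by blast
qed

lemma completion_separated:
  assumes "\<And>k. in_level k a"
  shows "a = 0"
proof -
  obtain u where u: "coherent u" "a = hat u" by (rule completion_cases)
  have "hat u = hat (\<lambda>_. 0)" using assms by (simp add: u hat_eq_iff in_level_hat)
  then show ?thesis using u by (simp add: hat_const)
qed

text \<open>Representatives are inverted one by one; the inverses are coherent since the difference
  of two inverses is a multiple of the difference of the inverted elements.\<close>

lemma completion_unit_iff:
  fixes a :: "'a::{local_ring, noetherian_ring} completion"
  shows "a dvd 1 \<longleftrightarrow> \<not> in_level 1 a"
proof
  assume "a dvd 1"
  then obtain b where b: "1 = a * b" by (elim dvdE)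
  show "\<not> in_level 1 a"
  proof
    assume "in_level 1 a"
    then have "in_level 1 (a * b)" using ideal_mult_right[OF ring_ideal_in_level[of 1]] by blast
    then have "in_level 1 (hat (\<lambda>_. 1 :: 'a))" using b by (simp add: hat_const)
    then have "(1 :: 'a) \<in> max_ideal_power (Suc 0)" by (simp only: in_level_hat coherent_const One_nat_def)
    then have "(1 :: 'a) \<in> max_ideal" by (simp only: ideal_power_1[OF ring_ideal_max_ideal])
    then show False using prime_idealD(2)[OF prime_ideal_max_ideal[where 'a = 'a]] by simp
  qed
next
  assume n: "\<not> in_level 1 a"
  obtain u where u: "coherent u" "a = hat u" by (rule completion_cases)
  \<comment> \<open>The entry \<open>u 0\<close> is only known modulo the whole ring and need not be
    a unit, so the sequence is shifted by one.\<close>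
  define v where "v k = u (Suc k)" for k
  have v: "coherent v" "a = hat v"
    using coherent_shift[OF u(1), of 1] u(2) by (simp_all add: v_def[abs_def])
  have "v k dvd 1" for k
  proof -
    have "u 1 \<notin> max_ideal"
      using n u ideal_power_1[OF ring_ideal_max_ideal[where 'a = 'a]] by (simp add: in_level_hat)
    moreover have "u (Suc k) - u 1 \<in> max_ideal"
      using coherent_le[OF u(1), of 1 "Suc k"] ideal_power_1[OF ring_ideal_max_ideal[where 'a = 'a]] by simp
    ultimately have "v k \<notin> max_ideal"
      using ring_ideal_diff[OF ring_ideal_max_ideal, of "u (Suc k)" "u (Suc k) - u 1"] by (auto simp: v_def)
    then show ?thesis by (simp add: unit_iff_notin_max_ideal)
  qed
  then have "\<forall>k. \<exists>w. 1 = v k * w" by (simp add: dvd_def)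
  from choice[OF this] obtain w where w: "\<And>k. 1 = v k * w k" by blast
  have cw: "coherent w"
    unfolding coherent_def
  proof
    fix k
    have "w (Suc k) - w k = (w (Suc k) * w k) * - (v (Suc k) - v k)"
    proof -
      have "(w (Suc k) * w k) * - (v (Suc k) - v k) = w (Suc k) * (v k * w k) - w k * (v (Suc k) * w (Suc k))"
        by (simp add: algebra_simps)
      then show ?thesis by (simp flip: w)
    qed
    moreover have "v (Suc k) - v k \<in> max_ideal_power k" using v(1) by (simp add: coherent_def)
    from ideal_uminus[OF ring_ideal_ideal_power this]
    have "(w (Suc k) * w k) * - (v (Suc k) - v k) \<in> max_ideal_power k"
      by (rule ideal_mult[OF ring_ideal_ideal_power])
    ultimately show "w (Suc k) - w k \<in> max_ideal_power k" by simp
  qed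
  have "a * hat w = hat (\<lambda>_. 1)" using v cw by (simp add: hat_mult flip: w)
  then have "a * hat w = 1" by (simp add: hat_const)
  then show "a dvd 1" by (metis dvd_triv_left)
qed

lemma max_ideal_power_eq_mono_ideal:
  "regular_system_of_parameters x \<Longrightarrow> max_ideal_power k = mono_ideal x {A. mdeg A = k}"
  using ideal_power_eq_mono_ideal[of x k] by (simp add: regular_system_of_parameters_def)

lemma mono_ideal_add_explicit:
  fixes x :: "'n::finite \<Rightarrow> 'r::comm_ring_1"
  assumes "a \<in> mono_ideal x {A. mdeg A = k + j}"
  shows "\<exists>d. (\<forall>B. d B \<in> mono_ideal x {A. mdeg A = j}) \<and> a = (\<Sum>B | mdeg B = k. d B * monomial_value x B)"
proof -
  let ?J = "{a. \<exists>d. (\<forall>B. d B \<in> mono_ideal x {A. mdeg A = j}) \<and> a = (\<Sum>B | mdeg B = k. d B * monomial_value x B)}"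
  have "mono_ideal x {A. mdeg A = k + j} \<subseteq> ?J"
  proof (rule mono_ideal_least[OF _ ring_ideal_sums[OF ring_ideal_mono_ideal]])
    fix A :: "'n \<Rightarrow>\<^sub>0 nat" assume "A \<in> {A. mdeg A = k + j}"
    then obtain B C where B: "A = B + C" "mdeg B = k" using mdeg_ge_split[of k A] by auto
    with \<open>A \<in> _\<close> have C: "mdeg C = j" by (simp add: mdeg_add)
    define d where "d B' = (if B' = B then monomial_value x C else 0)" for B'
    have "(\<Sum>B' | mdeg B' = k. d B' * monomial_value x B') =
        (\<Sum>B' | mdeg B' = k. if B' = B then monomial_value x C * monomial_value x B else 0)"
      by (intro sum.cong) (auto simp: d_def)
    also have "\<dots> = monomial_value x A"
      using B by (simp add: sum.delta[OF finite_mdeg_eq] monomial_value_add mult.commute)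
    finally have "monomial_value x A = (\<Sum>B' | mdeg B' = k. d B' * monomial_value x B')" by simp
    moreover have "\<forall>B'. d B' \<in> mono_ideal x {A. mdeg A = j}"
      using C by (auto simp: d_def ideal_zero[OF ring_ideal_mono_ideal] intro: mono_ideal_base)
    ultimately show "monomial_value x A \<in> ?J" by blast
  qed
  then show ?thesis using assms by blast
qed

text \<open>For an element whose \<open>k\<close>-th entry lies in the \<open>k\<close>-th power,
  the later increments lie in ever higher powers and can be divided by the finitely many monomials
  of degree \<open>k\<close>. The partial sums of the quotients are coherent and give coefficients
  in the completion.\<close>

lemma in_level_iff_mono_ideal:
  fixes x :: "'n::finite \<Rightarrow> 'a::regular_local_ring"
  assumes rsp: "regular_system_of_parameters x"
  shows "in_level k a \<longleftrightarrow> a \<in> mono_ideal (to_completion \<circ> x) {A. mdeg A = k}"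
proof
  note mp = max_ideal_power_eq_mono_ideal[OF rsp]
  have "mono_ideal (to_completion \<circ> x) {A. mdeg A = k} \<subseteq> {a. in_level k a}"
  proof (rule mono_ideal_least[OF _ ring_ideal_in_level])
    fix A :: "'n \<Rightarrow>\<^sub>0 nat" assume "A \<in> {A. mdeg A = k}"
    then have "monomial_value x A \<in> max_ideal_power k" unfolding mp by (rule mono_ideal_base)
    then show "monomial_value (to_completion \<circ> x) A \<in> {a. in_level k a}"
      by (simp add: monomial_value_to_completion in_level_hat flip: hat_const)
  qed
  then show "in_level k a" if "a \<in> mono_ideal (to_completion \<circ> x) {A. mdeg A = k}" using that by blast
next
  note mp = max_ideal_power_eq_mono_ideal[OF rsp]
  assume a: "in_level k a"
  obtain u where u: "coherent u" "a = hat u" by (rule completion_cases)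
  let ?S = "{B :: 'n \<Rightarrow>\<^sub>0 nat. mdeg B = k}"
  have "u k \<in> mono_ideal x {A. mdeg A = k + 0}" using a u mp by (simp add: in_level_hat)
  from mono_ideal_add_explicit[OF this]
  obtain c where c: "u k = (\<Sum>B\<in>?S. c B * monomial_value x B)" by blast
  have "\<forall>i. \<exists>d. (\<forall>B. d B \<in> max_ideal_power i) \<and>
      u (k + Suc i) - u (k + i) = (\<Sum>B\<in>?S. d B * monomial_value x B)"
  proof
    fix i
    have "u (k + Suc i) - u (k + i) \<in> mono_ideal x {A. mdeg A = k + i}"
      using u(1) mp by (simp add: coherent_def)
    from mono_ideal_add_explicit[OF this]
    show "\<exists>d. (\<forall>B. d B \<in> max_ideal_power i) \<and>
      u (k + Suc i) - u (k + i) = (\<Sum>B\<in>?S. d B * monomial_value x B)" by (simp only: mp)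
  qed
  from choice[OF this] obtain d where d: "\<And>i B. d i B \<in> max_ideal_power i"
    "\<And>i. u (k + Suc i) - u (k + i) = (\<Sum>B\<in>?S. d i B * monomial_value x B)" by blast
  define v where "v B l = c B + (\<Sum>i<l. d i B)" for B l
  have v: "coherent (v B)" for B by (simp add: coherent_def v_def d)
  have uv: "u (k + l) = (\<Sum>B\<in>?S. v B l * monomial_value x B)" for l
  proof (induction l)
    case 0
    then show ?case by (simp add: c v_def)
  next
    case (Suc l)
    have "u (k + Suc l) = u (k + l) + (u (k + Suc l) - u (k + l))" by simp
    also have "\<dots> = (\<Sum>B\<in>?S. v B l * monomial_value x B) + (\<Sum>B\<in>?S. d l B * monomial_value x B)"
      by (rule arg_cong2[of _ _ _ _ "(+)", OF Suc.IH d(2)])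
    also have "\<dots> = (\<Sum>B\<in>?S. (v B l + d l B) * monomial_value x B)"
      by (simp only: sum.distrib distrib_right)
    finally show ?case by (simp add: v_def add.assoc)
  qed
  have "a = hat (\<lambda>l. \<Sum>B\<in>?S. v B l * monomial_value x B)"
    using coherent_shift(2)[OF u(1), of k] by (simp add: u(2) uv)
  also have "\<dots> = (\<Sum>B\<in>?S. hat (\<lambda>l. v B l * monomial_value x B))"
    using hat_sum[OF finite_mdeg_eq, of k "\<lambda>B l. v B l * monomial_value x B"] v
    by (simp add: coherent_mult)
  also have "\<dots> = (\<Sum>B\<in>?S. hat (v B) * monomial_value (to_completion \<circ> x) B)"
    by (intro sum.cong) (simp_all add: monomial_value_to_completion hat_mult v flip: hat_const)
  finally show "a \<in> mono_ideal (to_completion \<circ> x) {A. mdeg A = k}"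
    unfolding mono_ideal_explicit
    by (intro exI[of _ ?S] exI[of _ "\<lambda>B. hat (v B)"] conjI finite_mdeg_eq subset_refl)
qed

text \<open>Independence descends to the ring: a relation of degree \<open>d\<close> modulo
  \<open>level (Suc d)\<close> is visible in the entry with index \<open>Suc d\<close>, where
  \<open>analytically_independent\<close> applies.\<close>

theorem complete_parameters_completion:
  fixes x :: "'n::finite \<Rightarrow> 'a::regular_local_ring"
  assumes rsp: "regular_system_of_parameters x"
  shows "complete_parameters (to_completion \<circ> x)"
proof unfold_locales
  let ?y = "to_completion \<circ> x"
  note lv = in_level_iff_mono_ideal[OF rsp, symmetric]
  show "a dvd 1 \<longleftrightarrow> a \<notin> mono_ideal ?y {A. mdeg A = 1}" for a
    by (simp only: lv completion_unit_iff)
  show "\<exists>l. \<forall>k. l - a k \<in> mono_ideal ?y {A. mdeg A = k}"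
    if "\<And>k. a (Suc k) - a k \<in> mono_ideal ?y {A. mdeg A = k}" for a
    using that unfolding lv by (rule completion_complete)
  show "a = 0" if "\<And>k. a \<in> mono_ideal ?y {A. mdeg A = k}" for a
    using that unfolding lv by (rule completion_separated)
  fix S :: "('n \<Rightarrow>\<^sub>0 nat) set" and c d A
  assume S: "finite S" "\<And>A. A \<in> S \<Longrightarrow> mdeg A = d" "A \<in> S"
    and rel: "(\<Sum>A\<in>S. c A * monomial_value ?y A) \<in> mono_ideal ?y {A. mdeg A = Suc d}"
  have "\<forall>A. \<exists>u. coherent u \<and> c A = hat u" using completion_cases by metis
  from choice[OF this] obtain u where u: "\<And>A. coherent (u A)" "\<And>A. c A = hat (u A)" by blast
  have "(\<Sum>A\<in>S. c A * monomial_value ?y A) = (\<Sum>A\<in>S. hat (\<lambda>l. u A l * monomial_value x A))"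
    by (intro sum.cong) (simp_all add: u monomial_value_to_completion hat_mult flip: hat_const)
  also have "\<dots> = hat (\<lambda>l. \<Sum>A\<in>S. u A l * monomial_value x A)"
    using hat_sum[OF S(1), of "\<lambda>A l. u A l * monomial_value x A"] u by (simp add: coherent_mult)
  finally have "in_level (Suc d) (hat (\<lambda>l. \<Sum>A\<in>S. u A l * monomial_value x A))"
    using rel by (simp add: lv)
  moreover have "coherent (\<lambda>l. \<Sum>A\<in>S. u A l * monomial_value x A)"
    using hat_sum[OF S(1), of "\<lambda>A l. u A l * monomial_value x A"] u by (simp add: coherent_mult)
  ultimately have "(\<Sum>A\<in>S. u A (Suc d) * monomial_value x A) \<in> max_ideal_power (Suc d)"
    by (simp add: in_level_hat)
  from analytically_independent[OF rsp S(1,2) this S(3)]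
  have "u A (Suc d) \<in> max_ideal" by simp
  moreover have "u A (Suc d) - u A 1 \<in> max_ideal"
    using coherent_le[OF u(1), of 1 "Suc d"] ideal_power_1[OF ring_ideal_max_ideal[where 'a = 'a]] by simp
  ultimately have "u A (Suc d) - (u A (Suc d) - u A 1) \<in> max_ideal"
    by (rule ring_ideal_diff[OF ring_ideal_max_ideal])
  then have "in_level 1 (c A)"
    using ideal_power_1[OF ring_ideal_max_ideal[where 'a = 'a]] by (simp add: u in_level_hat)
  then show "c A \<in> mono_ideal ?y {A. mdeg A = 1}" by (simp only: lv)
qed

text \<open>Independence is \<open>analytically_independent\<close>, and closedness of monomial
  ideals is \<open>krull_intersection\<close> for the powers of the maximal ideal.\<close>

theorem closed_parameters_regular:
  fixes x :: "'n::finite \<Rightarrow> 'a::regular_local_ring"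
  assumes rsp: "regular_system_of_parameters x"
  shows "closed_parameters x"
proof unfold_locales
  note mp = max_ideal_power_eq_mono_ideal[OF rsp]
  have m1: "mono_ideal x {A. mdeg A = 1} = max_ideal"
    using ideal_power_1[OF ring_ideal_max_ideal[where 'a = 'a]] by (simp flip: mp)
  show "a dvd 1 \<longleftrightarrow> a \<notin> mono_ideal x {A. mdeg A = 1}" for a
    by (simp only: m1 unit_iff_notin_max_ideal)
  show "a \<in> mono_ideal x S" if h: "\<And>k. a \<in> mono_ideal x S + mono_ideal x {A. mdeg A = k}" for a S
  proof (rule krull_intersection[OF ring_ideal_mono_ideal])
    show "a \<in> mono_ideal x S + max_ideal_power k" for k unfolding mp by (rule h)
  qed
  show "c A \<in> mono_ideal x {A. mdeg A = 1}"
    if "finite S" "\<And>A. A \<in> S \<Longrightarrow> mdeg A = d"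
      "(\<Sum>A\<in>S. c A * monomial_value x A) \<in> mono_ideal x {A. mdeg A = Suc d}" "A \<in> S" for S c d A
  proof -
    have "(\<Sum>A\<in>S. c A * monomial_value x A) \<in> max_ideal_power (Suc d)"
      unfolding mp by (rule that(3))
    from analytically_independent[OF rsp that(1,2) this that(4)] show ?thesis by (simp only: m1)
  qed
qed

section \<open>Lifting a factorization along an edge\<close>

text \<open>By Dickson's lemma every monomial ideal has finitely many monomial generators.\<close>

lemma (in closed_parameters) mono_ideal_closed_general:
  assumes "\<And>k. a \<in> mono_ideal x V + level k"
  shows "a \<in> mono_ideal x V"
proof -
  have "mono_ideal x V = mono_ideal x (minimals V)"
  proof
    show "mono_ideal x V \<subseteq> mono_ideal x (minimals V)"
      by (rule mono_ideal_upward) (rule minimals_below)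
    show "mono_ideal x (minimals V) \<subseteq> mono_ideal x V"
      by (rule mono_ideal_mono) (auto simp: minimals_def)
  qed
  then show ?thesis using assms mono_ideal_closed[OF finite_minimals, of a V] by simp
qed

definition edge_weight :: "('n \<Rightarrow> real) \<Rightarrow> ('n \<Rightarrow>\<^sub>0 nat) \<Rightarrow> nat \<Rightarrow> 'n \<Rightarrow> real" where
  "edge_weight \<delta> A b i = real (Poly_Mapping.lookup A i) + real b * \<delta> i"

text \<open>The slope \<open>\<delta>\<close> of the edge gives the monomial \<open>x^A z^b\<close> the vector of weights
  \<open>A + b \<delta>\<close>. The edge consists of the exponents of a fixed weight.\<close>

locale weighted_parameters = complete_parameters x for x :: "'n::finite \<Rightarrow> 'r::comm_ring_1" +
  fixes res :: "'r \<Rightarrow> 'k::field" and \<delta> :: "'n \<Rightarrow> real"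
  assumes res_add: "res (a + b) = res a + res b"
    and res_mult: "res (a * b) = res a * res b"
    and res_one: "res 1 = 1"
    and res_surj: "\<exists>a. res a = c"
    and res_zero_iff: "res a = 0 \<longleftrightarrow> a \<in> level 1"
    and \<delta>_nonneg: "0 \<le> \<delta> i"
begin

abbreviation om :: "('n \<Rightarrow>\<^sub>0 nat) \<Rightarrow> nat \<Rightarrow> 'n \<Rightarrow> real" where
  "om \<equiv> edge_weight \<delta>"

definition tot :: "('n \<Rightarrow> real) \<Rightarrow> real" where
  "tot N = (\<Sum>i\<in>UNIV. N i)"

text \<open>The bound \<open>s\<close> on the total weight measures the precision of an approximate factorization.\<close>

definition wset :: "('n \<Rightarrow> real) \<Rightarrow> real \<Rightarrow> nat \<Rightarrow> ('n \<Rightarrow>\<^sub>0 nat) set" where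
  "wset N s b = {A. (\<forall>i. N i \<le> om A b i) \<and> s \<le> tot (om A b)}"

definition wmod :: "('n \<Rightarrow> real) \<Rightarrow> real \<Rightarrow> 'r poly set" where
  "wmod N s = {p. \<forall>b. coeff p b \<in> mono_ideal x (wset N s b)}"

section \<open>Residues, weights and the weight filtration\<close>

lemma res_zero [simp]: "res 0 = 0"
  unfolding res_zero_iff by (rule ideal_zero[OF level_ideal])

lemma res_diff: "res (a - b) = res a - res b"
  using res_add[of "a - b" b] by (simp add: algebra_simps)

lemma res_sum: "res (sum g S) = (\<Sum>s\<in>S. res (g s))"
  by (induction S rule: infinite_finite_induct) (simp_all add: res_add)

lemma om_add: "om (A + B) (b + c) i = om A b i + om B c i"
  by (simp add: edge_weight_def lookup_add algebra_simps)

lemma tot_add: "tot (\<lambda>i. N i + N' i) = tot N + tot N'"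
  by (simp add: tot_def sum.distrib)

lemma tot_om: "tot (om A b) = real (mdeg A) + real b * tot \<delta>"
  by (simp add: tot_def edge_weight_def mdeg_def sum.distrib sum_distrib_left)

lemma tot_om_add: "tot (om (A + B) (b + c)) = tot (om A b) + tot (om B c)"
  by (simp add: tot_om mdeg_add algebra_simps)

lemma tot_mono: "(\<And>i. N i \<le> N' i) \<Longrightarrow> tot N \<le> tot N'"
  unfolding tot_def by (rule sum_mono)

lemma om_ge: "real b * \<delta> i \<le> om A b i"
  by (simp add: edge_weight_def)

lemma wmod_zero: "0 \<in> wmod N s"
  by (simp add: wmod_def ideal_zero[OF level_ideal])

lemma wmod_add: "p \<in> wmod N s \<Longrightarrow> q \<in> wmod N s \<Longrightarrow> p + q \<in> wmod N s"
  by (simp add: wmod_def ideal_add[OF level_ideal])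

lemma wmod_diff: "p \<in> wmod N s \<Longrightarrow> q \<in> wmod N s \<Longrightarrow> p - q \<in> wmod N s"
  by (simp add: wmod_def ring_ideal_diff[OF level_ideal])

lemma wmod_smult: "p \<in> wmod N s \<Longrightarrow> smult c p \<in> wmod N s"
  by (simp add: wmod_def ideal_mult[OF level_ideal])

lemma wmod_mono:
  assumes "\<And>i. N' i \<le> N i" "s' \<le> s" "p \<in> wmod N s"
  shows "p \<in> wmod N' s'"
proof -
  have "wset N s b \<subseteq> wset N' s' b" for b
    using assms(1,2) by (auto simp: wset_def intro: order_trans)
  then have "mono_ideal x (wset N s b) \<subseteq> mono_ideal x (wset N' s' b)" for b by (rule mono_ideal_mono)
  then show ?thesis using assms(3) by (auto simp: wmod_def)
qed

lemma wmod_mult: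
  assumes "p \<in> wmod N s" "q \<in> wmod N' s'"
  shows "p * q \<in> wmod (\<lambda>i. N i + N' i) (s + s')"
  unfolding wmod_def
proof (intro CollectI allI)
  fix c
  have "coeff p i * coeff q (c - i) \<in> mono_ideal x (wset (\<lambda>i. N i + N' i) (s + s') c)" if i: "i \<le> c" for i
  proof (rule mono_ideal_mult)
    show "coeff p i \<in> mono_ideal x (wset N s i)" "coeff q (c - i) \<in> mono_ideal x (wset N' s' (c - i))"
      using assms by (auto simp: wmod_def)
    fix A B assume "A \<in> wset N s i" "B \<in> wset N' s' (c - i)"
    then show "A + B \<in> wset (\<lambda>i. N i + N' i) (s + s') c"
      using om_add[of A B i "c - i"] tot_om_add[of A B i "c - i"] i
      by (auto simp: wset_def intro!: add_mono)
  qed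
  then show "coeff (p * q) c \<in> mono_ideal x (wset (\<lambda>i. N i + N' i) (s + s') c)"
    unfolding coeff_mult by (intro ideal_sum[OF level_ideal]) simp
qed

text \<open>The total weight is the degree in x plus \<open>b * tot \<delta>\<close>. Thus smallness
  in the weight filtration means smallness in the adic topology, uniformly only for bounded
  \<open>b\<close>; hence the degree bounds in the limit arguments.\<close>

lemma wset_subset_level:
  assumes "real j + real b * tot \<delta> \<le> s"
  shows "mono_ideal x (wset N s b) \<subseteq> level j"
proof -
  have "wset N s b \<subseteq> {A. j \<le> mdeg A}" using assms by (auto simp: wset_def tot_om)
  from mono_ideal_mono[OF this, of x] show ?thesis by (simp only: mono_ideal_mdeg_ge)
qed

lemma upset_wset: "upset (wset N s b)"
proof -
  have "om A b i \<le> om B b i" if "exp_le A B" for A B i using that by (simp add: edge_weight_def exp_le_def)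
  then show ?thesis unfolding upset_def wset_def using tot_mono by (blast intro: order_trans)
qed

text \<open>Lifting \<open>0\<close> and \<open>1\<close> to themselves preserves vanishing coefficients and monic polynomials.\<close>

definition lft :: "'k \<Rightarrow> 'r" where
  "lft c = (if c = 0 then 0 else if c = 1 then 1 else (SOME a. res a = c))"

lemma res_lft [simp]: "res (lft c) = c"
  using someI_ex[OF res_surj[of c]] by (simp add: lft_def res_one)

lemma lft_zero [simp]: "lft 0 = 0" and lft_one [simp]: "lft 1 = 1"
  by (simp_all add: lft_def)

text \<open>For a fixed power of z the weight determines the exponent of x, so the description is
  unique. The value 0 for a weight without a monomial lets formulas be written for all
  \<open>b\<close> at once.\<close>

definition wmon :: "('n \<Rightarrow> real) \<Rightarrow> nat \<Rightarrow> 'r" where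
  "wmon N b = (if \<exists>A. om A b = N then monomial_value x (THE A. om A b = N) else 0)"

lemma om_inj: "om A b = om B b \<Longrightarrow> A = B"
  by (intro poly_mapping_eqI) (auto simp: edge_weight_def fun_eq_iff)

lemma wmon_om [simp]: "wmon (om A b) b = monomial_value x A"
proof -
  have "(THE A'. om A' b = om A b) = A" by (rule the_equality) (auto dest: om_inj)
  then show ?thesis by (auto simp: wmon_def)
qed

lemma wmon_none: "(\<And>A. om A b \<noteq> N) \<Longrightarrow> wmon N b = 0"
  by (simp add: wmon_def)

text \<open>Homogenization to the weight N and lifting of coefficients in one step. Terms of
  \<open>p\<close> for which no monomial has weight N are silently lost, so each use has to control
  which terms these are.\<close>

definition hlift :: "('n \<Rightarrow> real) \<Rightarrow> 'k poly \<Rightarrow> 'r poly" where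
  "hlift N p = (\<Sum>b\<le>degree p. monom (lft (coeff p b) * wmon N b) b)"

lemma coeff_hlift: "coeff (hlift N p) b = lft (coeff p b) * wmon N b"
proof -
  have "coeff (hlift N p) b = (\<Sum>b'\<le>degree p. if b' = b then lft (coeff p b) * wmon N b else 0)"
    unfolding hlift_def coeff_sum by (intro sum.cong) auto
  also have "\<dots> = lft (coeff p b) * wmon N b"
    by (cases "b \<le> degree p") (simp_all add: coeff_eq_0)
  finally show ?thesis .
qed

text \<open>A coefficient of level \<open>k\<close> contributes monomials of degree
  \<open>k\<close>, which increase the total weight by \<open>k\<close> and lower no
  component.\<close>

lemma level_mult_wmon:
  assumes "c \<in> level k"
  shows "c * wmon N b \<in> mono_ideal x (wset N (tot N + real k) b)"
proof (cases "\<exists>A. om A b = N")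
  case True
  then obtain A where A: "om A b = N" by blast
  have "monomial_value x A \<in> mono_ideal x {A}" by (rule mono_ideal_base) simp
  with assms have "c * monomial_value x A \<in> mono_ideal x (wset N (tot N + real k) b)"
  proof (rule mono_ideal_mult)
    fix B C :: "'n \<Rightarrow>\<^sub>0 nat" assume "B \<in> {A. mdeg A = k}" "C \<in> {A}"
    then show "B + C \<in> wset N (tot N + real k) b"
      using om_add[of B A 0 b] tot_om_add[of B A 0 b] A
      by (auto simp: wset_def tot_om[of B 0]) (simp add: edge_weight_def)
  qed
  then show ?thesis using A wmon_om[of A b] by simp
next
  case False
  then show ?thesis by (simp add: wmon_none ideal_zero[OF level_ideal])
qed

lemma hlift_in_wmod: "hlift N p \<in> wmod N (tot N)"
  using level_mult_wmon[of _ 0] by (simp add: wmod_def coeff_hlift mono_ideal_zero_mdeg)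

text \<open>The lift of coefficients is additive modulo the maximal ideal, and a factor from that
  ideal is worth one unit of total weight.\<close>

lemma hlift_add: "hlift N p + hlift N q - hlift N (p + q) \<in> wmod N (tot N + 1)"
proof -
  have "lft a + lft b - lft (a + b) \<in> level 1" for a b
    unfolding res_zero_iff[symmetric] by (simp add: res_diff res_add)
  from level_mult_wmon[OF this]
  have "(lft a + lft b - lft (a + b)) * wmon N n \<in> mono_ideal x (wset N (tot N + 1) n)" for a b n by simp
  then show ?thesis
    by (simp add: wmod_def coeff_hlift distrib_right left_diff_distrib)
qed

text \<open>The hypotheses are asymmetric on purpose. Once the monomials of \<open>p\<close> exist,
  a monomial of the product weight is divisible by them by the inequality for \<open>q\<close>, and
  the quotient is the monomial required of \<open>q\<close>. If the product weight has no monomial,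
  neither does that of \<open>q\<close>, and both sides vanish.\<close>

lemma hlift_mult:
  assumes p: "\<And>i. coeff p i \<noteq> 0 \<Longrightarrow> \<exists>A. om A i = N"
    and q: "\<And>j k. coeff q j \<noteq> 0 \<Longrightarrow> real j * \<delta> k \<le> N' k"
  shows "hlift N p * hlift N' q - hlift (\<lambda>i. N i + N' i) (p * q)
    \<in> wmod (\<lambda>i. N i + N' i) (tot (\<lambda>i. N i + N' i) + 1)"
  unfolding wmod_def
proof (intro CollectI allI)
  fix c
  let ?M = "\<lambda>i. N i + N' i"
  have summand: "lft (coeff p i) * wmon N i * (lft (coeff q (c - i)) * wmon N' (c - i)) =
      (lft (coeff p i) * lft (coeff q (c - i))) * wmon ?M c" if i: "i \<le> c" for i
  proof (cases "coeff p i = 0 \<or> coeff q (c - i) = 0")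
    case True
    then show ?thesis by auto
  next
    case False
    then obtain A where A: "om A i = N" using p by blast
    have ci: "real c = real i + real (c - i)" using i by simp
    have "wmon N i * wmon N' (c - i) = wmon ?M c"
    proof (cases "\<exists>C. om C c = ?M")
      case True
      then obtain C where C: "om C c = ?M" by blast
      have eq: "real (Poly_Mapping.lookup C k) - real (Poly_Mapping.lookup A k) = N' k - real (c - i) * \<delta> k" for k
        using fun_cong[OF C, of k] fun_cong[OF A, of k] by (simp add: edge_weight_def ci algebra_simps)
      have le: "exp_le A C"
        unfolding exp_le_def
      proof
        fix k
        have "real (Poly_Mapping.lookup A k) \<le> real (Poly_Mapping.lookup C k)"
          using eq[of k] q[of "c - i" k] False by simp
        then show "Poly_Mapping.lookup A k \<le> Poly_Mapping.lookup C k" by simp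
      qed
      then obtain B where B: "C = A + B" by (rule exp_leE)
      have "om B (c - i) = N'"
      proof
        fix k
        show "om B (c - i) k = N' k" using eq[of k] by (simp add: edge_weight_def B lookup_add)
      qed
      then show ?thesis
        using A C B wmon_om[of A i] wmon_om[of B "c - i"] wmon_om[of C c] by (simp add: monomial_value_add)
    next
      case none: False
      have "om B (c - i) \<noteq> N'" for B
      proof
        assume "om B (c - i) = N'"
        then have "om (A + B) c = ?M" using om_add[of A B i "c - i"] A i by (auto simp: fun_eq_iff)
        then show False using none by blast
      qed
      then show ?thesis using none by (simp add: wmon_none)
    qed
    then show ?thesis by (simp add: mult_ac)
  qed
  have "coeff (hlift N p * hlift N' q - hlift ?M (p * q)) c =
      (\<Sum>i\<le>c. lft (coeff p i) * lft (coeff q (c - i))) * wmon ?M c - lft (coeff (p * q) c) * wmon ?M c"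
    by (simp add: coeff_mult coeff_hlift summand sum_distrib_right)
  also have "\<dots> = ((\<Sum>i\<le>c. lft (coeff p i) * lft (coeff q (c - i))) - lft (coeff (p * q) c)) * wmon ?M c"
    by (simp add: left_diff_distrib)
  also have "\<dots> \<in> mono_ideal x (wset ?M (tot ?M + real 1) c)"
  proof (rule level_mult_wmon)
    show "(\<Sum>i\<le>c. lft (coeff p i) * lft (coeff q (c - i))) - lft (coeff (p * q) c) \<in> level 1"
      unfolding res_zero_iff[symmetric] by (simp add: res_diff res_sum res_mult coeff_mult)
  qed
  finally show "coeff (hlift N p * hlift N' q - hlift ?M (p * q)) c \<in> mono_ideal x (wset ?M (tot ?M + 1) c)"
    by simp
qed

lemma hlift_monom: "hlift (om A b) (monom 1 b) = monom (monomial_value x A) b"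
  by (intro poly_eqI) (simp add: coeff_hlift)

text \<open>The coefficients converge by completeness because the z-degree is bounded by D. That the
  limit keeps the componentwise and total bounds is the closedness of monomial ideals.\<close>

lemma wmod_limit:
  assumes \<epsilon>: "0 < \<epsilon>" and D: "\<And>k b. D < b \<Longrightarrow> coeff (p k) b = 0"
    and step: "\<And>k. p (Suc k) - p k \<in> wmod N (S + real k * \<epsilon>)"
  shows "\<exists>q. (\<forall>b>D. coeff q b = 0) \<and> (\<forall>k. q - p k \<in> wmod N (S + real k * \<epsilon>))"
proof -
  have t\<delta>: "0 \<le> tot \<delta>" unfolding tot_def by (intro sum_nonneg) (simp add: \<delta>_nonneg)
  have diff: "p (k + l) - p k \<in> wmod N (S + real k * \<epsilon>)" for k l
  proof (induction l)
    case 0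
    then show ?case by (simp add: wmod_zero)
  next
    case (Suc l)
    have "p (Suc (k + l)) - p (k + l) \<in> wmod N (S + real k * \<epsilon>)"
      by (rule wmod_mono[OF _ _ step]) (use \<epsilon> in \<open>auto intro!: mult_right_mono\<close>)
    from wmod_add[OF this Suc.IH] show ?case by simp
  qed
  \<comment> \<open>The step after which all changes of coefficients up to z-degree D lie in
    \<open>level j\<close>, obtained by solving
    \<open>j + D * tot \<delta> \<le> S + k * \<epsilon>\<close> for \<open>k\<close>.\<close>
  define K where "K j = nat \<lceil>(real j + real D * tot \<delta> - S) / \<epsilon>\<rceil>" for j
  have K: "real j + real D * tot \<delta> \<le> S + real (K j) * \<epsilon>" for j
  proof -
    have "(real j + real D * tot \<delta> - S) / \<epsilon> \<le> real (K j)" unfolding K_def by (rule real_nat_ceiling_ge)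
    then show ?thesis using \<epsilon> by (simp add: pos_divide_le_eq)
  qed
  have Kmono: "K j \<le> K (Suc j)" for j
    unfolding K_def using \<epsilon> by (intro nat_mono ceiling_mono divide_right_mono) auto
  have lev: "coeff r b \<in> level j" if "r \<in> wmod N (S + real (K j) * \<epsilon>)" "b \<le> D" for r b j
  proof -
    have "real j + real b * tot \<delta> \<le> S + real (K j) * \<epsilon>"
      using K[of j] mult_right_mono[OF _ t\<delta>, of "real b" "real D"] that(2) by simp
    from wset_subset_level[OF this] show ?thesis using that(1) by (auto simp: wmod_def)
  qed
  have "\<forall>b. \<exists>l. b \<le> D \<longrightarrow> (\<forall>j. l - coeff (p (K j)) b \<in> level j)"
  proof
    fix b
    show "\<exists>l. b \<le> D \<longrightarrow> (\<forall>j. l - coeff (p (K j)) b \<in> level j)"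
    proof (cases "b \<le> D")
      case True
      have "coeff (p (K (Suc j))) b - coeff (p (K j)) b \<in> level j" for j
        using lev[OF diff[of "K j" "K (Suc j) - K j"] True] Kmono[of j] by simp
      from complete[OF this] show ?thesis by blast
    qed simp
  qed
  from choice[OF this] obtain l where l: "\<And>b j. b \<le> D \<Longrightarrow> l b - coeff (p (K j)) b \<in> level j" by blast
  define q where "q = (\<Sum>b\<le>D. monom (l b) b)"
  have q: "coeff q b = (if b \<le> D then l b else 0)" for b
    unfolding q_def coeff_sum by (simp add: coeff_monom)
  have "q - p k \<in> wmod N (S + real k * \<epsilon>)" for k
    unfolding wmod_def
  proof (intro CollectI allI)
    fix b
    show "coeff (q - p k) b \<in> mono_ideal x (wset N (S + real k * \<epsilon>) b)"
    proof (cases "b \<le> D")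
      case True
      show ?thesis
      proof (rule mono_ideal_closed_general)
        fix j
        \<comment> \<open>Convergence is known only along the subsequence \<open>K\<close>; the
          index must reach both the accuracy \<open>j\<close> and the stage
          \<open>k\<close>.\<close>
        obtain i where i: "j \<le> i" "k \<le> K i"
        proof
          let ?i = "max j (nat \<lceil>S + real k * \<epsilon>\<rceil>)"
          show "j \<le> ?i" by simp
          have "S + real k * \<epsilon> \<le> real ?i"
            using real_nat_ceiling_ge[of "S + real k * \<epsilon>"] by simp
          also have "\<dots> \<le> S + real (K ?i) * \<epsilon>"
            using K[of ?i] mult_nonneg_nonneg[OF of_nat_0_le_iff t\<delta>, of D] by linarith
          finally show "k \<le> K ?i" using \<epsilon> by simp
        qed
        have "coeff (p (K i) - p k) b \<in> mono_ideal x (wset N (S + real k * \<epsilon>) b)"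
          using diff[of k "K i - k"] i by (simp add: wmod_def)
        moreover have "coeff q b - coeff (p (K i)) b \<in> level j"
          using l[OF True, of i] level_antimono[OF i(1)] True by (auto simp: q)
        ultimately have "coeff (p (K i) - p k) b + (coeff q b - coeff (p (K i)) b)
            \<in> mono_ideal x (wset N (S + real k * \<epsilon>) b) + level j"
          by (rule set_plus_intro)
        then show "coeff (q - p k) b \<in> mono_ideal x (wset N (S + real k * \<epsilon>) b) + level j" by simp
      qed
    next
      case False
      then show ?thesis using D by (simp add: q ideal_zero[OF level_ideal])
    qed
  qed
  then show ?thesis using q by (intro exI[of _ q]) auto
qed

lemma wmod_separated:
  assumes \<epsilon>: "0 < \<epsilon>" and p: "\<And>k. p \<in> wmod N (S + real k * \<epsilon>)"
  shows "p = 0"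
proof (rule poly_eqI)
  fix b
  have "coeff p b = 0"
  proof (rule separated)
    fix j
    obtain k where "real j + real b * tot \<delta> - S < real k * \<epsilon>"
      using \<epsilon> reals_Archimedean3 by blast
    then have "real j + real b * tot \<delta> \<le> S + real k * \<epsilon>" by simp
    from wset_subset_level[OF this] show "coeff p b \<in> level j" using p[of k] by (auto simp: wmod_def)
  qed
  then show "coeff p b = coeff 0 b" by simp
qed

end

text \<open>Here G and H are the polynomials with X set to 1, and \<open>u\<close>, \<open>v\<close>
  their Bezout cofactors. The weight belonging to G is that of the pure power of Z with which a
  monic polynomial begins; the weight of H is free.\<close>

locale edge_factorization = weighted_parameters x res \<delta>
  for x :: "'n::finite \<Rightarrow> 'r::comm_ring_1" and res :: "'r \<Rightarrow> 'k::field" and \<delta> :: "'n \<Rightarrow> real" +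
  fixes G H u v :: "'k poly" and N' :: "'n \<Rightarrow> real"
  assumes bezout: "u * G + v * H = 1"
    and monic: "lead_coeff G = 1"
    and H_nonzero: "H \<noteq> 0"
    and G_valid: "coeff G j \<noteq> 0 \<Longrightarrow> \<exists>A. om A j = (\<lambda>i. real (degree G) * \<delta> i)"
    and H_valid: "coeff H j \<noteq> 0 \<Longrightarrow> \<exists>A. om A j = N'"
begin

definition N :: "'n \<Rightarrow> real" where "N i = real (degree G) * \<delta> i"

abbreviation M :: "'n \<Rightarrow> real" where "M \<equiv> (\<lambda>i. N i + N' i)"

definition g0 :: "'r poly" where "g0 = hlift N G"
definition h0 :: "'r poly" where "h0 = hlift N' H"

lemma G_valid': "coeff G j \<noteq> 0 \<Longrightarrow> \<exists>A. om A j = N"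
  using G_valid by (simp add: N_def[abs_def])

lemma H_degree_le: "real (degree H) * \<delta> i \<le> N' i"
proof -
  obtain A where "om A (degree H) = N'" using H_valid[of "degree H"] H_nonzero by auto
  then show ?thesis using om_ge by metis
qed

lemma G_nonzero: "G \<noteq> 0"
  using monic by auto

text \<open>Solves the linearized factorization equation for one monomial: the Bezout identity times
  \<open>Z^b\<close> is reduced modulo G and lifted homogeneously. The reduction keeps the
  correction of the first factor below the degree of G, so that this factor remains monic.\<close>

lemma monomial_step:
  assumes D: "b \<le> D" "degree G + degree H \<le> D" and om: "\<And>i. M i \<le> om A b i"
  shows "\<exists>p q. p \<in> wmod N (tot (om A b) - tot N') \<and> (\<forall>j\<ge>degree G. coeff p j = 0) \<and>
      q \<in> wmod N' (tot (om A b) - tot N) \<and> (\<forall>j>D - degree G. coeff q j = 0) \<and>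
      monom (monomial_value x A) b - (g0 * q + h0 * p) \<in> wmod M (tot (om A b) + 1)"
proof -
  let ?d = "degree G"
  \<comment> \<open>The quotient by G is moved from the multiplier of H to that of G, which leaves
    the combined identity unchanged.\<close>
  define p1 where "p1 = (monom 1 b * v) mod G"
  define q1 where "q1 = (monom 1 b * u) + (monom 1 b * v) div G * H"
  have eq: "G * q1 + H * p1 = monom 1 b"
  proof -
    define X where "X = monom 1 b * v"
    define Y where "Y = X div G"
    have q1: "q1 = monom 1 b * u + Y * H" by (simp add: q1_def X_def Y_def)
    have p1: "Y * G + p1 = X" by (simp add: p1_def X_def Y_def)
    have "G * q1 + H * p1 = monom 1 b * (u * G) + H * (Y * G + p1)"
      unfolding q1 by (simp add: algebra_simps)
    also have "\<dots> = monom 1 b * (u * G) + H * X" by (simp only: p1)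
    also have "\<dots> = monom 1 b * (u * G + v * H)" by (simp add: X_def algebra_simps)
    finally show ?thesis by (simp add: bezout)
  qed
  have p1: "j < ?d" if "coeff p1 j \<noteq> 0" for j
  proof -
    have "p1 \<noteq> 0" using that by auto
    then have "degree p1 < ?d" unfolding p1_def using degree_mod_less[OF G_nonzero] by blast
    then show ?thesis using le_degree[OF that] by simp
  qed
  \<comment> \<open>\<open>G * q1\<close> equals \<open>Z^b - H * p1\<close>, and
    \<open>H * p1\<close> has degree less than \<open>?d + degree H\<close>. This bound gives the
    degree estimate for the correction and also the room for its exponents of x.\<close>
  have q1: "?d + j \<le> b \<or> j < degree H" if j: "coeff q1 j \<noteq> 0" for j
  proof (rule ccontr)
    assume n: "\<not> ?thesis"
    have jq: "j \<le> degree q1" "q1 \<noteq> 0" using j le_degree by auto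
    have deg: "degree (G * q1) = ?d + degree q1" using jq G_nonzero by (simp add: degree_mult_eq)
    have "coeff (monom 1 b - H * p1) (?d + degree q1) = 0"
    proof -
      have "coeff (H * p1) (?d + degree q1) = 0"
      proof (cases "p1 = 0")
        case False
        then have "degree p1 < ?d" using p1[of "degree p1"] by simp
        then have "degree (H * p1) < ?d + degree q1"
          using n jq degree_mult_le[of H p1] by simp
        then show ?thesis by (rule coeff_eq_0)
      qed simp
      then show ?thesis using n jq by simp
    qed
    moreover have "monom 1 b - H * p1 = G * q1" using eq by (simp add: algebra_simps)
    ultimately have "coeff (G * q1) (degree (G * q1)) = 0" using deg by simp
    then show False using jq G_nonzero by simp
  qed
  \<comment> \<open>The weights complementary to those of H and of G in the weight of the given
    monomial; both products then have exactly that weight.\<close>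
  let ?P = "\<lambda>i. om A b i - N' i" and ?Q = "\<lambda>i. om A b i - N i"
  define p where "p = hlift ?P p1"
  define q where "q = hlift ?Q q1"
  have tP: "tot ?P = tot (om A b) - tot N'" and tQ: "tot ?Q = tot (om A b) - tot N"
    by (simp_all add: tot_def sum_subtractf)
  have pw: "p \<in> wmod N (tot (om A b) - tot N')"
    by (rule wmod_mono[OF _ _ hlift_in_wmod[of ?P p1, folded p_def]]) (use om in \<open>auto simp: tP algebra_simps\<close>)
  have qw: "q \<in> wmod N' (tot (om A b) - tot N)"
    by (rule wmod_mono[OF _ _ hlift_in_wmod[of ?Q q1, folded q_def]]) (use om in \<open>auto simp: tQ algebra_simps\<close>)
  have "hlift N G * hlift ?Q q1 - hlift (\<lambda>i. N i + ?Q i) (G * q1) \<in> wmod (\<lambda>i. N i + ?Q i) (tot (\<lambda>i. N i + ?Q i) + 1)"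
  proof (rule hlift_mult[OF G_valid'])
    fix j k assume j: "coeff q1 j \<noteq> 0"
    show "real j * \<delta> k \<le> ?Q k"
    proof (cases "?d + j \<le> b")
      case True
      then have "real (?d + j) * \<delta> k \<le> real b * \<delta> k" by (intro mult_right_mono \<delta>_nonneg) simp
      also have "\<dots> \<le> om A b k" by (rule om_ge)
      finally show ?thesis by (simp add: N_def algebra_simps)
    next
      case False
      then have "j < degree H" using q1[OF j] by simp
      then have "real j * \<delta> k \<le> real (degree H) * \<delta> k" by (intro mult_right_mono \<delta>_nonneg) simp
      also have "\<dots> \<le> N' k" by (rule H_degree_le)
      also have "\<dots> \<le> ?Q k" using om[of k] by simp
      finally show ?thesis .
    qed
  qed
  then have 1: "g0 * q - hlift (om A b) (G * q1) \<in> wmod (om A b) (tot (om A b) + 1)"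
    by (simp add: g0_def q_def)
  have "hlift N' H * hlift ?P p1 - hlift (\<lambda>i. N' i + ?P i) (H * p1) \<in> wmod (\<lambda>i. N' i + ?P i) (tot (\<lambda>i. N' i + ?P i) + 1)"
  proof (rule hlift_mult[OF H_valid])
    fix j k assume j: "coeff p1 j \<noteq> 0"
    have "real j * \<delta> k \<le> real ?d * \<delta> k" using p1[OF j] by (intro mult_right_mono \<delta>_nonneg) simp
    also have "\<dots> \<le> ?P k" using om[of k] by (simp add: N_def)
    finally show "real j * \<delta> k \<le> ?P k" .
  qed
  then have 2: "h0 * p - hlift (om A b) (H * p1) \<in> wmod (om A b) (tot (om A b) + 1)"
    by (simp add: h0_def p_def)
  have 3: "hlift (om A b) (G * q1) + hlift (om A b) (H * p1) - monom (monomial_value x A) b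
      \<in> wmod (om A b) (tot (om A b) + 1)"
    using hlift_add[of "om A b" "G * q1" "H * p1"] by (simp only: eq hlift_monom)
  have "monom (monomial_value x A) b - (g0 * q + h0 * p) =
      0 - (((g0 * q - hlift (om A b) (G * q1)) + (h0 * p - hlift (om A b) (H * p1))) +
        (hlift (om A b) (G * q1) + hlift (om A b) (H * p1) - monom (monomial_value x A) b))"
    by simp
  also have "\<dots> \<in> wmod (om A b) (tot (om A b) + 1)"
    by (intro wmod_diff wmod_zero wmod_add 1 2 3)
  finally have "monom (monomial_value x A) b - (g0 * q + h0 * p) \<in> wmod M (tot (om A b) + 1)"
    by (rule wmod_mono[rotated 2]) (use om in auto)
  moreover have "\<forall>j\<ge>?d. coeff p j = 0"
  proof (intro allI impI)
    fix j assume "?d \<le> j"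
    then have "coeff p1 j = 0" using p1[of j] by fastforce
    then show "coeff p j = 0" by (simp add: p_def coeff_hlift)
  qed
  moreover have "\<forall>j>D - ?d. coeff q j = 0"
  proof (intro allI impI)
    fix j assume j: "j > D - ?d"
    have "coeff q1 j = 0"
    proof (rule ccontr)
      assume "coeff q1 j \<noteq> 0"
      from q1[OF this] show False using j D by auto
    qed
    then show "coeff q j = 0" by (simp add: q_def coeff_hlift)
  qed
  ultimately show ?thesis using pw qw by blast
qed

text \<open>An error of total weight \<open>s\<close> can be removed up to weight
  \<open>s + 1\<close> by correcting the two factors. The corrections have the weights that remain
  after subtracting that of the opposite factor, and the degrees that keep G monic and the product
  of degree at most D.\<close>

definition liftable :: "nat \<Rightarrow> real \<Rightarrow> 'r poly \<Rightarrow> bool" where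
  "liftable D s e \<longleftrightarrow> (\<exists>p q. p \<in> wmod N (s - tot N') \<and> (\<forall>j\<ge>degree G. coeff p j = 0) \<and>
      q \<in> wmod N' (s - tot N) \<and> (\<forall>j>D - degree G. coeff q j = 0) \<and>
      e - (g0 * q + h0 * p) \<in> wmod M (s + 1))"

lemma liftable_zero: "liftable D s 0"
  unfolding liftable_def by (intro exI[of _ 0]) (simp add: wmod_zero)

lemma liftable_add:
  assumes "liftable D s e" "liftable D s e'"
  shows "liftable D s (e + e')"
proof -
  from assms(1) obtain p q where pq: "p \<in> wmod N (s - tot N')" "\<forall>j\<ge>degree G. coeff p j = 0"
      "q \<in> wmod N' (s - tot N)" "\<forall>j>D - degree G. coeff q j = 0"
      "e - (g0 * q + h0 * p) \<in> wmod M (s + 1)"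
    unfolding liftable_def by blast
  from assms(2) obtain p' q' where pq': "p' \<in> wmod N (s - tot N')" "\<forall>j\<ge>degree G. coeff p' j = 0"
      "q' \<in> wmod N' (s - tot N)" "\<forall>j>D - degree G. coeff q' j = 0"
      "e' - (g0 * q' + h0 * p') \<in> wmod M (s + 1)"
    unfolding liftable_def by blast
  have eq: "e + e' - (g0 * (q + q') + h0 * (p + p')) = (e - (g0 * q + h0 * p)) + (e' - (g0 * q' + h0 * p'))"
    by (simp add: algebra_simps)
  have "e + e' - (g0 * (q + q') + h0 * (p + p')) \<in> wmod M (s + 1)"
    unfolding eq by (rule wmod_add[OF pq(5) pq'(5)])
  then show ?thesis unfolding liftable_def using pq pq'
    by (intro exI[of _ "p + p'"] exI[of _ "q + q'"]) (simp add: wmod_add)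
qed

lemma liftable_smult:
  assumes "liftable D s e"
  shows "liftable D s (smult c e)"
proof -
  from assms obtain p q where pq: "p \<in> wmod N (s - tot N')" "\<forall>j\<ge>degree G. coeff p j = 0"
      "q \<in> wmod N' (s - tot N)" "\<forall>j>D - degree G. coeff q j = 0"
      "e - (g0 * q + h0 * p) \<in> wmod M (s + 1)"
    unfolding liftable_def by blast
  have "smult c e - (g0 * smult c q + h0 * smult c p) = smult c (e - (g0 * q + h0 * p))"
    by (simp add: smult_diff_right smult_add_right)
  then have "smult c e - (g0 * smult c q + h0 * smult c p) \<in> wmod M (s + 1)"
    using wmod_smult[OF pq(5)] by simp
  then show ?thesis unfolding liftable_def using pq
    by (intro exI[of _ "smult c p"] exI[of _ "smult c q"]) (simp add: wmod_smult)
qed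

lemma liftable_sum: "(\<And>i. i \<in> S \<Longrightarrow> liftable D s (e i)) \<Longrightarrow> liftable D s (sum e S)"
  by (induction S rule: infinite_finite_induct) (simp_all add: liftable_zero liftable_add)

text \<open>For fixed \<open>b\<close> the coefficients that can be treated form an ideal, so it
  suffices to treat the monomials generating the weight filtration.\<close>

lemma liftable_wmod:
  assumes D: "degree G + degree H \<le> D" and e: "e \<in> wmod M s" "\<And>b. D < b \<Longrightarrow> coeff e b = 0"
  shows "liftable D s e"
proof -
  have "liftable D s (monom c b)" if b: "b \<le> D" and c: "c \<in> mono_ideal x (wset M s b)" for b c
  proof -
    have "mono_ideal x (wset M s b) \<subseteq> {c. liftable D s (monom c b)}"
    proof (rule mono_ideal_least)
      fix A assume "A \<in> wset M s b"
      then have A: "\<And>i. M i \<le> om A b i" "s \<le> tot (om A b)" by (auto simp: wset_def)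
      obtain p q where pq: "p \<in> wmod N (tot (om A b) - tot N')" "\<forall>j\<ge>degree G. coeff p j = 0"
          "q \<in> wmod N' (tot (om A b) - tot N)" "\<forall>j>D - degree G. coeff q j = 0"
          "monom (monomial_value x A) b - (g0 * q + h0 * p) \<in> wmod M (tot (om A b) + 1)"
        using monomial_step[OF b D A(1)] by blast
      have "p \<in> wmod N (s - tot N')" by (rule wmod_mono[OF _ _ pq(1)]) (use A(2) in auto)
      moreover have "q \<in> wmod N' (s - tot N)" by (rule wmod_mono[OF _ _ pq(3)]) (use A(2) in auto)
      moreover have "monom (monomial_value x A) b - (g0 * q + h0 * p) \<in> wmod M (s + 1)"
        by (rule wmod_mono[OF _ _ pq(5)]) (use A(2) in auto)
      ultimately have "liftable D s (monom (monomial_value x A) b)"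
        unfolding liftable_def using pq(2,4) by blast
      then show "monomial_value x A \<in> {c. liftable D s (monom c b)}" by simp
    next
      show "ring_ideal {c. liftable D s (monom c b)}"
      proof (rule ring_idealI)
        show "0 \<in> {c. liftable D s (monom c b)}" by (simp add: liftable_zero)
        show "c + c' \<in> {c. liftable D s (monom c b)}"
          if "c \<in> {c. liftable D s (monom c b)}" "c' \<in> {c. liftable D s (monom c b)}" for c c'
          using that by (simp add: liftable_add flip: add_monom)
        show "r * c \<in> {c. liftable D s (monom c b)}"
          if "c \<in> {c. liftable D s (monom c b)}" for r c
          using that liftable_smult[of D s "monom c b" r] by (simp add: smult_monom)
      qed
    qed
    then show ?thesis using c by blast
  qed
  then have "liftable D s (monom (coeff e b) b)" if "b \<le> D" for b
    using that e(1) by (simp add: wmod_def)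
  then have "liftable D s (\<Sum>b\<le>D. monom (coeff e b) b)" by (intro liftable_sum) simp
  moreover have "(\<Sum>b\<le>D. monom (coeff e b) b) = e"
    by (intro poly_eqI) (use e(2) in \<open>auto simp: coeff_sum coeff_monom\<close>)
  ultimately show ?thesis by simp
qed

lemma g0_coeff: "coeff g0 (degree G) = 1" "degree G < j \<Longrightarrow> coeff g0 j = 0"
proof -
  have "om 0 (degree G) = N" by (simp add: edge_weight_def N_def fun_eq_iff)
  then show "coeff g0 (degree G) = 1"
    using wmon_om[of 0 "degree G"] monic by (simp add: g0_def coeff_hlift)
  show "coeff g0 j = 0" if "degree G < j" using that by (simp add: g0_def coeff_hlift coeff_eq_0)
qed

text \<open>Linear Hensel iteration with the fixed corrections for \<open>g0\<close> and
  \<open>h0\<close>. The linear step gains one, while the quadratic terms and the deviation from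
  \<open>g0\<close> and \<open>h0\<close> gain \<epsilon>; as \<epsilon> is at most one, it is the
  gain of a whole step.\<close>

theorem hensel:
  assumes D: "degree G + degree H \<le> D" "\<And>b. D < b \<Longrightarrow> coeff f b = 0"
    and f: "f - g0 * h0 \<in> wmod M (tot M + \<epsilon>)" and \<epsilon>: "0 < \<epsilon>" "\<epsilon> \<le> 1"
  shows "\<exists>g h. f = g * h \<and> lead_coeff g = 1 \<and>
    g - g0 \<in> wmod N (tot N + \<epsilon>) \<and> h - h0 \<in> wmod N' (tot N' + \<epsilon>)"
proof -
  let ?d = "degree G"
  note tM = tot_add[of N N']
  \<comment> \<open>The deviation from \<open>g0\<close> stays below its degree, which preserves the
    leading coefficient 1. The weight of the error grows linearly in \<open>k\<close>, and
    \<open>Q\<close> bounds the increments by the same amount.\<close>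
  define P where "P k = (\<lambda>(g, h). g - g0 \<in> wmod N (tot N + \<epsilon>) \<and> (\<forall>j\<ge>?d. coeff (g - g0) j = 0) \<and>
    h - h0 \<in> wmod N' (tot N' + \<epsilon>) \<and> (\<forall>j>D - ?d. coeff h j = 0) \<and>
    f - g * h \<in> wmod M (tot M + \<epsilon> + real k * \<epsilon>))" for k :: nat
  define Q where "Q k = (\<lambda>(g, h) (g', h'). g' - g \<in> wmod N (tot N + \<epsilon> + real k * \<epsilon>) \<and>
    h' - h \<in> wmod N' (tot N' + \<epsilon> + real k * \<epsilon>))" for k :: nat and g h g' h' :: "'r poly"
  have g0w: "g0 \<in> wmod N (tot N)" and h0w: "h0 \<in> wmod N' (tot N')"
    unfolding g0_def h0_def by (rule hlift_in_wmod)+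
  have perturb: "r \<in> wmod L s" if "r - r0 \<in> wmod L (s + \<epsilon>)" "r0 \<in> wmod L s" for r r0 L s
  proof -
    have "r - r0 \<in> wmod L s" by (rule wmod_mono[OF _ _ that(1)]) (use \<epsilon> in auto)
    from wmod_add[OF this that(2)] show ?thesis by simp
  qed
  have degs: "coeff (g * h) b = 0"
    if "\<forall>j\<ge>?d. coeff (g - g0) j = 0" "\<forall>j>D - ?d. coeff h j = 0" "D < b" for g h b
  proof -
    have "coeff g j = 0" if "?d < j" for j
      using \<open>\<forall>j\<ge>?d. coeff (g - g0) j = 0\<close> that g0_coeff(2)[of j] by simp
    then have "degree g \<le> ?d" by (simp add: degree_le)
    moreover have "degree h \<le> D - ?d" using that(2) by (simp add: degree_le)
    ultimately have "degree (g * h) < b" using degree_mult_le[of g h] D(1) that(3) by simp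
    then show ?thesis by (rule coeff_eq_0)
  qed
  have "\<exists>s. \<forall>k. P k (s k) \<and> Q k (s k) (s (Suc k))"
  proof (rule dependent_nat_choice)
    have "\<forall>j>D - ?d. coeff h0 j = 0" using D(1) by (auto simp: h0_def coeff_hlift coeff_eq_0)
    then show "\<exists>s. P 0 s" unfolding P_def using f by (intro exI[of _ "(g0, h0)"]) (simp add: wmod_zero)
  next
    fix s k assume Ps: "P k s"
    obtain g h where s: "s = (g, h)" by (cases s)
    define S where "S = tot M + \<epsilon> + real k * \<epsilon>"
    have SM: "tot M + \<epsilon> \<le> S" using \<epsilon> by (simp add: S_def)
    from Ps have gh: "g - g0 \<in> wmod N (tot N + \<epsilon>)" "\<forall>j\<ge>?d. coeff (g - g0) j = 0"
      "h - h0 \<in> wmod N' (tot N' + \<epsilon>)" "\<forall>j>D - ?d. coeff h j = 0" "f - g * h \<in> wmod M S"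
      by (auto simp: P_def s S_def)
    have "coeff (f - g * h) b = 0" if "D < b" for b using degs[OF gh(2,4) that] D(2)[OF that] by simp
    from liftable_wmod[OF D(1) gh(5) this] obtain p q where
      p: "p \<in> wmod N (S - tot N')" "\<forall>j\<ge>?d. coeff p j = 0"
      and q: "q \<in> wmod N' (S - tot N)" "\<forall>j>D - ?d. coeff q j = 0"
      and e: "(f - g * h) - (g0 * q + h0 * p) \<in> wmod M (S + 1)"
      unfolding liftable_def by blast
    have Np: "tot N + \<epsilon> + real k * \<epsilon> = S - tot N'" and Nq: "tot N' + \<epsilon> + real k * \<epsilon> = S - tot N"
      by (simp_all add: S_def tM)
    have p': "p \<in> wmod N (tot N + \<epsilon>)" by (rule wmod_mono[OF _ _ p(1)]) (use SM tM in auto)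
    have q': "q \<in> wmod N' (tot N' + \<epsilon>)" by (rule wmod_mono[OF _ _ q(1)]) (use SM tM in auto)
    have 1: "(f - g * h) - (g0 * q + h0 * p) \<in> wmod M (S + \<epsilon>)"
      by (rule wmod_mono[OF _ _ e]) (use \<epsilon> in auto)
    have 2: "(g - g0) * q \<in> wmod M (S + \<epsilon>)"
      by (rule wmod_mono[OF _ _ wmod_mult[OF gh(1) q(1)]]) auto
    have 3: "p * (h - h0) \<in> wmod M (S + \<epsilon>)"
      by (rule wmod_mono[OF _ _ wmod_mult[OF p(1) gh(3)]]) auto
    have 4: "p * q \<in> wmod M (S + \<epsilon>)"
      by (rule wmod_mono[OF _ _ wmod_mult[OF p' q(1)]]) auto
    have "f - (g + p) * (h + q) = ((((f - g * h) - (g0 * q + h0 * p)) - (g - g0) * q) - p * (h - h0)) - p * q"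
      by (simp add: algebra_simps)
    also have "\<dots> \<in> wmod M (S + \<epsilon>)" by (intro wmod_diff 1 2 3 4)
    also have "S + \<epsilon> = tot M + \<epsilon> + real (Suc k) * \<epsilon>" by (simp add: S_def algebra_simps)
    finally have e': "f - (g + p) * (h + q) \<in> wmod M (tot M + \<epsilon> + real (Suc k) * \<epsilon>)" .
    have eqs: "g + p - g0 = (g - g0) + p" "h + q - h0 = (h - h0) + q" by simp_all
    have "P (Suc k) (g + p, h + q)"
      unfolding P_def prod.case eqs
      using e' wmod_add[OF gh(1) p'] wmod_add[OF gh(3) q'] gh(2,4) p(2) q(2) by simp
    moreover have "Q k s (g + p, h + q)"
      unfolding Q_def s using p(1) q(1) by (simp add: Np Nq)
    ultimately show "\<exists>s'. P (Suc k) s' \<and> Q k s s'" by blast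
  qed
  then obtain s where s: "\<And>k. P k (s k)" "\<And>k. Q k (s k) (s (Suc k))" by blast
  define gs where "gs k = fst (s k)" for k
  define hs where "hs k = snd (s k)" for k
  have gs: "gs k - g0 \<in> wmod N (tot N + \<epsilon>)" "\<forall>j\<ge>?d. coeff (gs k - g0) j = 0"
      "hs k - h0 \<in> wmod N' (tot N' + \<epsilon>)" "\<forall>j>D - ?d. coeff (hs k) j = 0"
      "f - gs k * hs k \<in> wmod M (tot M + \<epsilon> + real k * \<epsilon>)" for k
    using s(1)[of k] by (auto simp: P_def gs_def hs_def case_prod_unfold)
  have st: "gs (Suc k) - gs k \<in> wmod N (tot N + \<epsilon> + real k * \<epsilon>)"
      "hs (Suc k) - hs k \<in> wmod N' (tot N' + \<epsilon> + real k * \<epsilon>)" for k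
    using s(2)[of k] by (auto simp: Q_def gs_def hs_def case_prod_unfold)
  have gsj: "coeff (gs k) j = 0" if "?d < j" for k j
    using gs(2)[of k] that g0_coeff(2)[OF that] by simp
  from wmod_limit[OF \<epsilon>(1) gsj st(1)]
  obtain g where g: "\<forall>b>?d. coeff g b = 0" "\<And>k. g - gs k \<in> wmod N (tot N + \<epsilon> + real k * \<epsilon>)" by blast
  have hsj: "coeff (hs k) j = 0" if "D - ?d < j" for k j using gs(4)[of k] that by simp
  from wmod_limit[OF \<epsilon>(1) hsj st(2)]
  obtain h where h: "\<And>k. h - hs k \<in> wmod N' (tot N' + \<epsilon> + real k * \<epsilon>)" by blast
  have gg: "g - g0 \<in> wmod N (tot N + \<epsilon>)"
    using wmod_add[OF g(2)[of 0] wmod_mono[OF _ _ gs(1)[of 0]]] by simp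
  have hh: "h - h0 \<in> wmod N' (tot N' + \<epsilon>)"
    using wmod_add[OF h[of 0] wmod_mono[OF _ _ gs(3)[of 0]]] by simp
  have "f - g * h = 0"
  proof (rule wmod_separated[OF \<epsilon>(1)])
    fix k
    have hk: "hs k \<in> wmod N' (tot N')" using gs(3) h0w by (rule perturb)
    have gw: "g \<in> wmod N (tot N)" using gg g0w by (rule perturb)
    have 2: "(g - gs k) * hs k \<in> wmod M (tot M + \<epsilon> + real k * \<epsilon>)"
      by (rule wmod_mono[OF _ _ wmod_mult[OF g(2) hk]]) (auto simp: tM)
    have 3: "g * (h - hs k) \<in> wmod M (tot M + \<epsilon> + real k * \<epsilon>)"
      by (rule wmod_mono[OF _ _ wmod_mult[OF gw h]]) (auto simp: tM)
    have "f - g * h = ((f - gs k * hs k) - (g - gs k) * hs k) - g * (h - hs k)"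
      by (simp add: algebra_simps)
    also have "\<dots> \<in> wmod M (tot M + \<epsilon> + real k * \<epsilon>)" by (intro wmod_diff gs(5) 2 3)
    finally show "f - g * h \<in> wmod M (tot M + \<epsilon> + real k * \<epsilon>)" .
  qed
  moreover have "lead_coeff g = 1"
  proof -
    \<comment> \<open>All approximations have the leading coefficient of \<open>g0\<close>; that of
      the limit differs by an element of every stage of the filtration, hence by 0.\<close>
    let ?r = "monom (coeff (g - g0) ?d) ?d"
    have "?r = 0"
    proof (rule wmod_separated[OF \<epsilon>(1)])
      fix k
      have "coeff (g - g0) ?d = coeff (g - gs k) ?d" using gs(2)[of k] by simp
      then show "?r \<in> wmod N (tot N + \<epsilon> + real k * \<epsilon>)"
        using g(2)[of k] by (auto simp: wmod_def coeff_monom ideal_zero[OF level_ideal])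
    qed
    then have "coeff g ?d = 1" using g0_coeff(1) by simp
    moreover have "degree g = ?d"
    proof (rule antisym)
      show "degree g \<le> ?d" using g(1) by (simp add: degree_le)
      show "?d \<le> degree g" using \<open>coeff g ?d = 1\<close> by (intro le_degree) simp
    qed
    ultimately show ?thesis by simp
  qed
  ultimately show ?thesis using gg hh by (intro exI[of _ g] exI[of _ h]) simp
qed

end

section \<open>Weighted homogeneous polynomials\<close>

definition cf :: "('n, 'k::field) mpoly_Z \<Rightarrow> 'n exponent \<Rightarrow> 'k" where
  "cf P p = Poly_Mapping.lookup (coeff P (snd p)) (fst p)"

definition supp :: "('n, 'k::field) mpoly_Z \<Rightarrow> 'n exponent set" where
  "supp P = {p. cf P p \<noteq> 0}"

lemma cf_eqI: "(\<And>p. cf P p = cf Q p) \<Longrightarrow> P = Q"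
  by (intro poly_eqI poly_mapping_eqI) (metis cf_def fst_conv snd_conv)

lemma cf_zero [simp]: "cf 0 p = 0"
  by (simp add: cf_def)

lemma cf_sum: "cf (sum g S) p = (\<Sum>s\<in>S. cf (g s) p)"
  by (induction S rule: infinite_finite_induct) (simp_all add: cf_def lookup_add)

lemma cf_monom: "cf (monom (Poly_Mapping.single A c) b) p = (if p = (A, b) then c else 0)"
  by (cases p) (auto simp: cf_def coeff_monom lookup_single when_def)

lemma finite_supp: "finite (supp P)"
proof (rule finite_subset)
  show "supp P \<subseteq> (\<Union>b\<le>degree P. (\<lambda>A. (A, b)) ` Poly_Mapping.keys (coeff P b))"
  proof
    fix p assume p: "p \<in> supp P"
    then have "coeff P (snd p) \<noteq> 0" by (auto simp: supp_def cf_def)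
    then have "snd p \<le> degree P" by (rule le_degree)
    then show "p \<in> (\<Union>b\<le>degree P. (\<lambda>A. (A, b)) ` Poly_Mapping.keys (coeff P b))"
      using p by (intro UN_I[of "snd p"] image_eqI[of _ _ "fst p"]) (auto simp: supp_def cf_def in_keys_iff)
  qed
qed simp

lemma supp_empty_iff: "supp P = {} \<longleftrightarrow> P = 0"
  using cf_eqI[of P 0] by (auto simp: supp_def)

lemma sum_of_terms: "(\<Sum>p\<in>supp P. monom (Poly_Mapping.single (fst p) (cf P p)) (snd p)) = P"
proof (rule cf_eqI)
  fix q
  have "cf (\<Sum>p\<in>supp P. monom (Poly_Mapping.single (fst p) (cf P p)) (snd p)) q =
      (\<Sum>p\<in>supp P. if q = p then cf P q else 0)"
    unfolding cf_sum by (intro sum.cong) (auto simp: cf_monom)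
  also have "\<dots> = cf P q" using finite_supp[of P] by (simp add: supp_def)
  finally show "cf (\<Sum>p\<in>supp P. monom (Poly_Mapping.single (fst p) (cf P p)) (snd p)) q = cf P q" .
qed

lemma cf_mult:
  "cf (P * Q) r = (\<Sum>p\<in>supp P. \<Sum>q\<in>supp Q. if r = p + q then cf P p * cf Q q else 0)"
proof -
  have "P * Q = (\<Sum>p\<in>supp P. monom (Poly_Mapping.single (fst p) (cf P p)) (snd p)) *
      (\<Sum>q\<in>supp Q. monom (Poly_Mapping.single (fst q) (cf Q q)) (snd q))"
    by (simp only: sum_of_terms)
  also have "\<dots> = (\<Sum>p\<in>supp P. \<Sum>q\<in>supp Q.
      monom (Poly_Mapping.single (fst p + fst q) (cf P p * cf Q q)) (snd p + snd q))"
    by (simp add: sum_product mult_monom mult_single)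
  finally show ?thesis
    by (simp add: cf_sum cf_monom plus_prod_def)
qed

text \<open>No cancellation is possible at an exponent with only one decomposition.\<close>

lemma cf_mult_unique:
  assumes "p \<in> supp P" "q \<in> supp Q"
    and u: "\<And>p' q'. p' \<in> supp P \<Longrightarrow> q' \<in> supp Q \<Longrightarrow> p' + q' = p + q \<Longrightarrow> p' = p \<and> q' = q"
  shows "cf (P * Q) (p + q) = cf P p * cf Q q"
proof -
  have "cf (P * Q) (p + q) = (\<Sum>p'\<in>supp P. if p' = p then cf P p * cf Q q else 0)"
    unfolding cf_mult
  proof (rule sum.cong)
    fix p' assume p': "p' \<in> supp P"
    have "(\<Sum>q'\<in>supp Q. if p + q = p' + q' then cf P p' * cf Q q' else 0) =
        (\<Sum>q'\<in>supp Q. if q' = q then (if p' = p then cf P p * cf Q q else 0) else 0)"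
      using u[OF p'] by (intro sum.cong) (auto dest: sym)
    then show "(\<Sum>q'\<in>supp Q. if p + q = p' + q' then cf P p' * cf Q q' else 0) =
        (if p' = p then cf P p * cf Q q else 0)"
      using assms(2) by (simp only: sum.delta[OF finite_supp] if_True)
  qed simp
  then show ?thesis using assms(1) by (simp only: sum.delta[OF finite_supp] if_True)
qed

lemma separating_weights_exponent:
  fixes S :: "'n::finite exponent set"
  assumes "finite S"
  shows "\<exists>\<phi> :: 'n exponent \<Rightarrow> nat. (\<forall>p q. \<phi> (p + q) = \<phi> p + \<phi> q) \<and> inj_on \<phi> S"
proof -
  obtain w where w: "inj_on (wdeg w) (fst ` S)" using separating_weights[of "fst ` S"] assms by auto
  obtain K where K: "\<And>p. p \<in> S \<Longrightarrow> snd p < K"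
    using finite_nat_set_iff_bounded[of "snd ` S"] assms by auto
  define \<phi> where "\<phi> p = K * wdeg w (fst p) + snd p" for p :: "'n exponent"
  have "inj_on \<phi> S"
  proof (rule inj_onI)
    fix p q assume pq: "p \<in> S" "q \<in> S" "\<phi> p = \<phi> q"
    have "(K * wdeg w (fst p) + snd p) mod K = (K * wdeg w (fst q) + snd q) mod K"
      using pq(3) unfolding \<phi>_def by simp
    then have s: "snd p = snd q" using K[OF pq(1)] K[OF pq(2)] by simp
    then have "wdeg w (fst p) = wdeg w (fst q)" using pq(3) K[OF pq(1)] unfolding \<phi>_def by simp
    then have "fst p = fst q" using w pq by (auto dest: inj_onD)
    with s show "p = q" by (simp add: prod_eq_iff)
  qed
  moreover have "\<phi> (p + q) = \<phi> p + \<phi> q" for p q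
    by (simp add: \<phi>_def wdeg_add algebra_simps)
  ultimately show ?thesis by blast
qed

text \<open>Ties in the maximum of \<open>f\<close> are broken by an additive injective function on
  the exponents. The maximizers for the resulting lexicographic order are unique, so their sum has
  no second decomposition and survives in a product.\<close>

lemma extreme_pair:
  fixes S T :: "'n::finite exponent set" and f :: "'n exponent \<Rightarrow> real"
  assumes S: "finite S" "S \<noteq> {}" and T: "finite T" "T \<noteq> {}" and f: "\<And>p q. f (p + q) = f p + f q"
  shows "\<exists>p\<in>S. \<exists>q\<in>T. (\<forall>p'\<in>S. f p' \<le> f p) \<and> (\<forall>q'\<in>T. f q' \<le> f q) \<and>
    (\<forall>p'\<in>S. \<forall>q'\<in>T. p' + q' = p + q \<longrightarrow> p' = p \<and> q' = q)"
proof -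
  obtain \<phi> :: "'n exponent \<Rightarrow> nat" where \<phi>: "\<And>p q. \<phi> (p + q) = \<phi> p + \<phi> q" "inj_on \<phi> (S \<union> T)"
    using separating_weights_exponent[of "S \<union> T"] S T by blast
  have ex: "\<exists>p\<in>U. (\<forall>p'\<in>U. f p' \<le> f p) \<and> (\<forall>p'\<in>U. f p' = f p \<longrightarrow> \<phi> p' \<le> \<phi> p)"
    if U: "finite U" "U \<noteq> {}" for U
  proof -
    define V where "V = {p\<in>U. f p = Max (f ` U)}"
    have "Max (f ` U) \<in> f ` U" using U by (intro Max_in) auto
    then obtain p0 where "p0 \<in> U" "f p0 = Max (f ` U)" by (metis imageE)
    then have "p0 \<in> V" by (simp add: V_def)
    then have V: "finite V" "V \<noteq> {}" using U(1) by (simp add: V_def, blast)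
    then have "Max (\<phi> ` V) \<in> \<phi> ` V" by (intro Max_in) auto
    then obtain p where p: "p \<in> V" "\<phi> p = Max (\<phi> ` V)" by auto
    have "f p' \<le> f p" if "p' \<in> U" for p' using that p U by (simp add: V_def)
    moreover have "\<phi> p' \<le> \<phi> p" if "p' \<in> U" "f p' = f p" for p'
      using that p V by (simp add: V_def)
    moreover have "p \<in> U" using p by (simp add: V_def)
    ultimately show ?thesis by blast
  qed
  \<comment> \<open>First \<open>f\<close>, then \<open>\<phi>\<close> is maximized, separately on S
    and on T; additivity of both functions links the two choices.\<close>
  obtain p where p: "p \<in> S" "\<forall>p'\<in>S. f p' \<le> f p" "\<forall>p'\<in>S. f p' = f p \<longrightarrow> \<phi> p' \<le> \<phi> p" using ex[OF S] by blast
  obtain q where q: "q \<in> T" "\<forall>q'\<in>T. f q' \<le> f q" "\<forall>q'\<in>T. f q' = f q \<longrightarrow> \<phi> q' \<le> \<phi> q" using ex[OF T] by blast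
  have "p' = p \<and> q' = q" if pq: "p' \<in> S" "q' \<in> T" "p' + q' = p + q" for p' q'
  proof -
    have "f p' + f q' = f p + f q" using pq(3) f by metis
    moreover have "f p' \<le> f p" "f q' \<le> f q" using p(2) q(2) pq by blast+
    ultimately have "f p' = f p" "f q' = f q" by linarith+
    then have "\<phi> p' \<le> \<phi> p" "\<phi> q' \<le> \<phi> q" using p(3) q(3) pq by blast+
    moreover have "\<phi> p' + \<phi> q' = \<phi> p + \<phi> q" using pq(3) \<phi>(1) by metis
    ultimately have "\<phi> p' = \<phi> p" "\<phi> q' = \<phi> q" by linarith+
    then show ?thesis using \<phi>(2) pq p(1) q(1) by (auto dest: inj_onD)
  qed
  then show ?thesis using p q by blast
qed

lemma edge_weight_add: "edge_weight \<delta> (A + B) (b + c) i = edge_weight \<delta> A b i + edge_weight \<delta> B c i"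
  by (simp add: edge_weight_def lookup_add algebra_simps)

definition whomogeneous :: "('n \<Rightarrow> real) \<Rightarrow> ('n \<Rightarrow> real) \<Rightarrow> ('n, 'k::field) mpoly_Z \<Rightarrow> bool" where
  "whomogeneous \<delta> N P \<longleftrightarrow> (\<forall>p\<in>supp P. edge_weight \<delta> (fst p) (snd p) = N)"

text \<open>The extreme weights of the factors add up to the extreme weights of the product.\<close>

lemma whomogeneous_factors:
  fixes G H :: "('n::finite, 'k::field) mpoly_Z"
  assumes hom: "whomogeneous \<delta> M (G * H)" and nz: "G \<noteq> 0" "H \<noteq> 0"
  shows "\<exists>N N'. whomogeneous \<delta> N G \<and> whomogeneous \<delta> N' H \<and> M = (\<lambda>i. N i + N' i)"
proof -
  let ?w = "\<lambda>i p. edge_weight \<delta> (fst p) (snd p) i"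
  have S: "finite (supp G)" "supp G \<noteq> {}" and T: "finite (supp H)" "supp H \<noteq> {}"
    using nz by (simp_all add: finite_supp supp_empty_iff)
  have ext: "\<exists>p\<in>supp G. \<exists>q\<in>supp H. (\<forall>p'\<in>supp G. f p' \<le> f p) \<and> (\<forall>q'\<in>supp H. f q' \<le> f q) \<and>
      (\<forall>i. ?w i p + ?w i q = M i)"
    if f: "\<And>p q. f (p + q) = f p + f q" for f :: "'n exponent \<Rightarrow> real"
  proof -
    from extreme_pair[OF S T f] obtain p q where pq: "p \<in> supp G" "q \<in> supp H"
      "\<forall>p'\<in>supp G. f p' \<le> f p" "\<forall>q'\<in>supp H. f q' \<le> f q"
      "\<forall>p'\<in>supp G. \<forall>q'\<in>supp H. p' + q' = p + q \<longrightarrow> p' = p \<and> q' = q" by blast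
    have "cf (G * H) (p + q) = cf G p * cf H q" using pq by (intro cf_mult_unique) blast+
    then have "p + q \<in> supp (G * H)" using pq by (simp add: supp_def)
    from bspec[OF hom[unfolded whomogeneous_def] this]
    have "edge_weight \<delta> (fst (p + q)) (snd (p + q)) = M" .
    then have "?w i p + ?w i q = M i" for i using edge_weight_add[of \<delta> "fst p" "fst q" "snd p" "snd q" i] by simp
    then show ?thesis using pq by blast
  qed
  have eq: "?w i p = ?w i p' \<and> ?w i q = ?w i q' \<and> ?w i p + ?w i q = M i"
    if m: "p \<in> supp G" "p' \<in> supp G" "q \<in> supp H" "q' \<in> supp H" for i p p' q q'
  proof -
    obtain p1 q1 where 1: "\<forall>p'\<in>supp G. ?w i p' \<le> ?w i p1" "\<forall>q'\<in>supp H. ?w i q' \<le> ?w i q1"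
      "?w i p1 + ?w i q1 = M i"
      using ext[of "?w i"] by (auto simp: edge_weight_add)
    obtain p2 q2 where 2: "\<forall>p'\<in>supp G. - ?w i p' \<le> - ?w i p2" "\<forall>q'\<in>supp H. - ?w i q' \<le> - ?w i q2"
      "?w i p2 + ?w i q2 = M i" "p2 \<in> supp G" "q2 \<in> supp H"
      using ext[of "\<lambda>p. - ?w i p"] by (auto simp: edge_weight_add)
    have "?w i p \<le> ?w i p1" "?w i q \<le> ?w i q1" "?w i p2 \<le> ?w i p" "?w i q2 \<le> ?w i q"
      "?w i p' \<le> ?w i p1" "?w i q' \<le> ?w i q1" "?w i p2 \<le> ?w i p'" "?w i q2 \<le> ?w i q'"
      using 1(1,2) 2(1,2) m by auto
    then show ?thesis using 1(3) 2(3) by linarith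
  qed
  obtain p0 q0 where 0: "p0 \<in> supp G" "q0 \<in> supp H" using S T by blast
  have "whomogeneous \<delta> (\<lambda>i. ?w i p0) G" "whomogeneous \<delta> (\<lambda>i. ?w i q0) H"
    unfolding whomogeneous_def using eq[OF 0(1) _ 0(2) 0(2)] eq[OF 0(1) 0(1) 0(2)] by auto
  moreover have "M = (\<lambda>i. ?w i p0 + ?w i q0)" using eq[OF 0(1) 0(1) 0(2) 0(2)] by auto
  ultimately show ?thesis by blast
qed

section \<open>Setting X = 1 and homogenizing back\<close>

definition set_X_one :: "(('n \<Rightarrow>\<^sub>0 nat) \<Rightarrow>\<^sub>0 'k::field) \<Rightarrow> 'k" where
  "set_X_one a = (\<Sum>A\<in>Poly_Mapping.keys a. Poly_Mapping.lookup a A)"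

lemma set_X_one_superset:
  assumes "finite S" "Poly_Mapping.keys a \<subseteq> S"
  shows "set_X_one a = (\<Sum>A\<in>S. Poly_Mapping.lookup a A)"
  unfolding set_X_one_def using assms by (intro sum.mono_neutral_left) (auto simp: in_keys_iff)

lemma set_X_one_add: "set_X_one (a + b) = set_X_one a + set_X_one b"
proof -
  let ?S = "Poly_Mapping.keys a \<union> Poly_Mapping.keys b"
  have "set_X_one (a + b) = (\<Sum>A\<in>?S. Poly_Mapping.lookup (a + b) A)"
    by (intro set_X_one_superset) (auto simp: Poly_Mapping.keys_add)
  moreover have "set_X_one a = (\<Sum>A\<in>?S. Poly_Mapping.lookup a A)" "set_X_one b = (\<Sum>A\<in>?S. Poly_Mapping.lookup b A)"
    by (intro set_X_one_superset; simp)+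
  ultimately show ?thesis by (simp add: lookup_add sum.distrib)
qed

lemma set_X_one_zero [simp]: "set_X_one 0 = 0"
  by (simp add: set_X_one_def)

lemma set_X_one_single [simp]: "set_X_one (Poly_Mapping.single A c) = c"
  by (simp add: set_X_one_def)

lemma set_X_one_one [simp]: "set_X_one 1 = 1"
  using set_X_one_single[of 0 1] by (simp only: single_one)

lemma set_X_one_sum: "set_X_one (sum g S) = (\<Sum>s\<in>S. set_X_one (g s))"
  by (induction S rule: infinite_finite_induct) (simp_all add: set_X_one_add)

lemma set_X_one_mult:
  fixes a b :: "('n \<Rightarrow>\<^sub>0 nat) \<Rightarrow>\<^sub>0 'k::field"
  shows "set_X_one (a * b) = set_X_one a * set_X_one b"
proof -
  have s: "(\<Sum>A\<in>Poly_Mapping.keys c. Poly_Mapping.single A (Poly_Mapping.lookup c A)) = c"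
    for c :: "('n \<Rightarrow>\<^sub>0 nat) \<Rightarrow>\<^sub>0 'k"
    by (rule poly_mapping_eqI) (auto simp: lookup_sum lookup_single when_def in_keys_iff)
  have "a * b = (\<Sum>A\<in>Poly_Mapping.keys a. \<Sum>B\<in>Poly_Mapping.keys b.
      Poly_Mapping.single (A + B) (Poly_Mapping.lookup a A * Poly_Mapping.lookup b B))"
    by (subst (1 2) s[symmetric]) (simp add: sum_product mult_single)
  then show ?thesis by (simp add: set_X_one_sum set_X_one_def[of a] set_X_one_def[of b] sum_product)
qed

definition dehom :: "('n, 'k::field) mpoly_Z \<Rightarrow> 'k poly" where
  "dehom P = map_poly set_X_one P"

lemma coeff_dehom: "coeff (dehom P) b = set_X_one (coeff P b)"
  by (simp add: dehom_def coeff_map_poly)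

lemma dehom_mult: "dehom (P * Q) = dehom P * dehom Q"
  by (intro poly_eqI) (simp add: coeff_dehom coeff_mult set_X_one_sum set_X_one_mult)

lemma dehom_one: "dehom 1 = 1"
  by (intro poly_eqI) (simp add: coeff_dehom)

text \<open>This set has at most one element. Summing over it expresses the existing term or 0
  without a case distinction.\<close>

definition weight_expts :: "('n \<Rightarrow> real) \<Rightarrow> ('n \<Rightarrow> real) \<Rightarrow> nat \<Rightarrow> ('n \<Rightarrow>\<^sub>0 nat) set" where
  "weight_expts \<delta> N b = {A. edge_weight \<delta> A b = N}"

lemma weight_expts_unique: "A \<in> weight_expts \<delta> N b \<Longrightarrow> B \<in> weight_expts \<delta> N b \<Longrightarrow> A = B"
proof (rule poly_mapping_eqI)
  fix k
  assume "A \<in> weight_expts \<delta> N b" "B \<in> weight_expts \<delta> N b"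
  then have "edge_weight \<delta> A b k = edge_weight \<delta> B b k" by (simp add: weight_expts_def)
  then show "Poly_Mapping.lookup A k = Poly_Mapping.lookup B k" by (simp add: edge_weight_def)
qed

lemma weight_expts_cases:
  obtains "weight_expts \<delta> N b = {}" | A where "weight_expts \<delta> N b = {A}"
  using weight_expts_unique by blast

lemma ex_weight_expts_iff:
  fixes N :: "'n::finite \<Rightarrow> real"
  shows "weight_expts \<delta> N b \<noteq> {} \<longleftrightarrow> (\<forall>i. N i - real b * \<delta> i \<in> \<nat>)"
proof
  assume "weight_expts \<delta> N b \<noteq> {}"
  then obtain A where "edge_weight \<delta> A b = N" by (auto simp: weight_expts_def)
  then have "N i - real b * \<delta> i = real (Poly_Mapping.lookup A i)" for i by (auto simp: edge_weight_def)
  then show "\<forall>i. N i - real b * \<delta> i \<in> \<nat>" by simp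
next
  assume "\<forall>i. N i - real b * \<delta> i \<in> \<nat>"
  then have "\<forall>i. \<exists>a. N i - real b * \<delta> i = real a" by (auto elim: Nats_cases)
  from choice[OF this] obtain a where a: "\<And>i. N i - real b * \<delta> i = real (a i)" by blast
  have "Poly_Mapping.lookup (Abs_poly_mapping a) = a" by (rule lookup_Abs_poly_mapping) simp
  then have "edge_weight \<delta> (Abs_poly_mapping a) b i = N i" for i
    using a[of i] by (simp add: edge_weight_def)
  then have "Abs_poly_mapping a \<in> weight_expts \<delta> N b" by (auto simp: weight_expts_def)
  then show "weight_expts \<delta> N b \<noteq> {}" by blast
qed

lemma single_sum: "Poly_Mapping.single A (sum g S) = (\<Sum>s\<in>S. Poly_Mapping.single A (g s))"
  by (induction S rule: infinite_finite_induct) (simp_all add: single_add)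

text \<open>Coefficients whose weight has no monomial disappear; under
  \<open>liftable_weight\<close> there are none, and only then is setting X = 1 a left
  inverse.\<close>

definition homogenize :: "('n \<Rightarrow> real) \<Rightarrow> ('n \<Rightarrow> real) \<Rightarrow> 'k::field poly \<Rightarrow> ('n, 'k) mpoly_Z" where
  "homogenize \<delta> N p = (\<Sum>b\<le>degree p. \<Sum>A\<in>weight_expts \<delta> N b. monom (Poly_Mapping.single A (coeff p b)) b)"

lemma coeff_homogenize:
  "coeff (homogenize \<delta> N p) b = (\<Sum>A\<in>weight_expts \<delta> N b. Poly_Mapping.single A (coeff p b))"
proof -
  have "coeff (homogenize \<delta> N p) b =
      (\<Sum>b'\<le>degree p. if b' = b then (\<Sum>A\<in>weight_expts \<delta> N b. Poly_Mapping.single A (coeff p b)) else 0)"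
    unfolding homogenize_def coeff_sum by (intro sum.cong) (auto simp: coeff_monom)
  also have "\<dots> = (\<Sum>A\<in>weight_expts \<delta> N b. Poly_Mapping.single A (coeff p b))"
    by (cases "b \<le> degree p") (simp_all add: coeff_eq_0)
  finally show ?thesis .
qed

definition liftable_weight :: "('n \<Rightarrow> real) \<Rightarrow> ('n \<Rightarrow> real) \<Rightarrow> 'k::field poly \<Rightarrow> bool" where
  "liftable_weight \<delta> N p \<longleftrightarrow> (\<forall>b. coeff p b \<noteq> 0 \<longrightarrow> weight_expts \<delta> N b \<noteq> {})"

lemma weight_expts_add:
  assumes "weight_expts \<delta> N b = {A}" "weight_expts \<delta> N' c = {B}"
  shows "weight_expts \<delta> (\<lambda>i. N i + N' i) (b + c) = {A + B}"
proof -
  have "edge_weight \<delta> A b = N" "edge_weight \<delta> B c = N'" using assms by (auto simp: weight_expts_def)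
  then have "A + B \<in> weight_expts \<delta> (\<lambda>i. N i + N' i) (b + c)"
    by (auto simp: weight_expts_def edge_weight_add)
  then show ?thesis using weight_expts_unique by blast
qed

text \<open>Wherever both coefficients are nonzero, the monomials of the two weights exist and
  multiply to the monomial of the sum weight.\<close>

lemma homogenize_mult:
  assumes p: "liftable_weight \<delta> N p" and q: "liftable_weight \<delta> N' q"
  shows "homogenize \<delta> N p * homogenize \<delta> N' q = homogenize \<delta> (\<lambda>i. N i + N' i) (p * q)"
proof (rule poly_eqI)
  fix c
  let ?M = "\<lambda>i. N i + N' i"
  have "coeff (homogenize \<delta> N p) i * coeff (homogenize \<delta> N' q) (c - i) =
      (\<Sum>A\<in>weight_expts \<delta> ?M c. Poly_Mapping.single A (coeff p i * coeff q (c - i)))" if i: "i \<le> c" for i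
  proof (cases "coeff p i = 0 \<or> coeff q (c - i) = 0")
    case True
    then show ?thesis by (auto simp: coeff_homogenize)
  next
    case False
    obtain A where A: "weight_expts \<delta> N i = {A}"
      using False p by (metis liftable_weight_def weight_expts_cases)
    obtain B where B: "weight_expts \<delta> N' (c - i) = {B}"
      using False q by (metis liftable_weight_def weight_expts_cases)
    have "weight_expts \<delta> ?M c = {A + B}" using weight_expts_add[OF A B] i by simp
    then show ?thesis by (simp add: coeff_homogenize A B mult_single)
  qed
  then have "coeff (homogenize \<delta> N p * homogenize \<delta> N' q) c =
      (\<Sum>i\<le>c. \<Sum>A\<in>weight_expts \<delta> ?M c. Poly_Mapping.single A (coeff p i * coeff q (c - i)))"
    by (simp add: coeff_mult)
  also have "\<dots> = (\<Sum>A\<in>weight_expts \<delta> ?M c. \<Sum>i\<le>c. Poly_Mapping.single A (coeff p i * coeff q (c - i)))"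
    by (rule sum.swap)
  also have "\<dots> = (\<Sum>A\<in>weight_expts \<delta> ?M c. Poly_Mapping.single A (coeff (p * q) c))"
    by (simp add: coeff_mult single_sum)
  finally show "coeff (homogenize \<delta> N p * homogenize \<delta> N' q) c = coeff (homogenize \<delta> ?M (p * q)) c"
    by (simp add: coeff_homogenize)
qed

lemma dehom_homogenize:
  assumes "liftable_weight \<delta> N p"
  shows "dehom (homogenize \<delta> N p) = p"
proof (rule poly_eqI)
  fix b
  show "coeff (dehom (homogenize \<delta> N p)) b = coeff p b"
  proof (cases rule: weight_expts_cases[of \<delta> N b])
    case 1
    then show ?thesis using assms by (auto simp: coeff_dehom coeff_homogenize liftable_weight_def)
  next
    case (2 A)
    then show ?thesis by (simp add: coeff_dehom coeff_homogenize)
  qed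
qed

text \<open>For a fixed power of Z the weight leaves room for a single exponent of X, so the sum of
  the coefficients is the coefficient itself. Homogeneous polynomials can therefore be recovered
  from their value at X = 1.\<close>

lemma whomogeneous_coeff:
  assumes "whomogeneous \<delta> N P"
  shows "coeff P b = (\<Sum>A\<in>weight_expts \<delta> N b. Poly_Mapping.single A (coeff (dehom P) b))"
proof -
  have keys: "Poly_Mapping.keys (coeff P b) \<subseteq> weight_expts \<delta> N b"
    using assms by (auto simp: whomogeneous_def supp_def cf_def weight_expts_def in_keys_iff)
  show ?thesis
  proof (cases rule: weight_expts_cases[of \<delta> N b])
    case 1
    then show ?thesis using keys by simp
  next
    case (2 A)
    then have "set_X_one (coeff P b) = Poly_Mapping.lookup (coeff P b) A"
      using keys set_X_one_superset[of "{A}" "coeff P b"] by simp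
    then show ?thesis using keys 2
      by (intro poly_mapping_eqI) (auto simp: coeff_dehom lookup_single when_def in_keys_iff)
  qed
qed

lemma whomogeneous_homogenize: "whomogeneous \<delta> N P \<Longrightarrow> homogenize \<delta> N (dehom P) = P"
  by (intro poly_eqI) (simp add: coeff_homogenize flip: whomogeneous_coeff)

lemma whomogeneous_liftable: "whomogeneous \<delta> N P \<Longrightarrow> liftable_weight \<delta> N (dehom P)"
  unfolding liftable_weight_def using whomogeneous_coeff[of \<delta> N P]
  by (metis coeff_dehom set_X_one_zero sum.empty)

lemma whomogeneous_lookup:
  assumes "whomogeneous \<delta> N P" "edge_weight \<delta> A b = N"
  shows "Poly_Mapping.lookup (coeff P b) A = coeff (dehom P) b"
proof -
  have "A \<in> weight_expts \<delta> N b" using assms by (simp add: weight_expts_def)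
  then have "weight_expts \<delta> N b = {A}" using weight_expts_unique by blast
  then show ?thesis using whomogeneous_coeff[OF assms(1), of b] by (simp add: lookup_single)
qed

text \<open>The Euclidean algorithm stays within the polynomials whose exponents lie in one class
  modulo the lattice of all \<open>b\<close> with \<open>b \<delta>\<close> integral; such polynomials can be homogenized.\<close>

definition in_class :: "('n \<Rightarrow> real) \<Rightarrow> int \<Rightarrow> 'k::field poly \<Rightarrow> bool" where
  "in_class \<delta> a p \<longleftrightarrow> (\<forall>b. coeff p b \<noteq> 0 \<longrightarrow> (\<forall>i. (real b - of_int a) * \<delta> i \<in> \<int>))"

lemma in_class_zero [simp]: "in_class \<delta> a 0"
  by (simp add: in_class_def)

text \<open>The leading exponents of \<open>p\<close> and \<open>q\<close> belong to the classes
  \<open>a\<close> and \<open>b\<close>; the shift by their difference carries the class of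
  \<open>q'\<close> to that of \<open>p'\<close>. Taking both cofactors equal to the polynomials
  themselves covers the remainder as well.\<close>

lemma in_class_euclid_step:
  assumes p: "in_class \<delta> a p" and q: "in_class \<delta> b q" and nz: "p \<noteq> 0" "q \<noteq> 0"
    and p': "in_class \<delta> (a - e) p'" and q': "in_class \<delta> (b - e) q'"
    and le: "degree q \<le> degree p"
  shows "in_class \<delta> (a - e) (p' + monom k (degree p - degree q) * q')"
  unfolding in_class_def
proof (intro allI impI)
  fix c i assume c: "coeff (p' + monom k (degree p - degree q) * q') c \<noteq> 0"
  let ?m = "degree p - degree q"
  show "(real c - of_int (a - e)) * \<delta> i \<in> \<int>"
  proof (cases "coeff p' c = 0")
    case False
    then show ?thesis using p' by (simp add: in_class_def)
  next
    case True
    then have "?m \<le> c" "coeff q' (c - ?m) \<noteq> 0" using c by (auto simp: coeff_monom_mult split: if_splits)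
    then have "(real (c - ?m) - of_int (b - e)) * \<delta> i \<in> \<int>" using q' unfolding in_class_def by blast
    moreover have "(real (degree p) - of_int a) * \<delta> i \<in> \<int>" "(real (degree q) - of_int b) * \<delta> i \<in> \<int>"
      using p q nz by (simp_all add: in_class_def)
    ultimately have "(real (c - ?m) - of_int (b - e)) * \<delta> i + (real (degree p) - of_int a) * \<delta> i
      - (real (degree q) - of_int b) * \<delta> i \<in> \<int>" by (intro Ints_add Ints_diff)
    also have "(real (c - ?m) - of_int (b - e)) * \<delta> i + (real (degree p) - of_int a) * \<delta> i
      - (real (degree q) - of_int b) * \<delta> i = (real c - of_int (a - e)) * \<delta> i"
      using \<open>?m \<le> c\<close> le by (simp add: of_nat_diff algebra_simps)
    finally show ?thesis .
  qed
qed

text \<open>One leading term is removed at a time, which is a step between polynomials in fixed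
  classes. Besides the greatest common divisor and the Bezout cofactors, the two quotients are
  carried along with their classes, since they must be homogenized too.\<close>

lemma in_class_euclid:
  fixes p q :: "'k::field poly"
  assumes "in_class \<delta> a p" "in_class \<delta> b q" "p \<noteq> 0 \<or> q \<noteq> 0"
  shows "\<exists>c p' q' u v e. c \<noteq> 0 \<and> in_class \<delta> e c \<and> p = c * p' \<and> q = c * q' \<and>
    in_class \<delta> (a - e) p' \<and> in_class \<delta> (b - e) q' \<and> c = u * p + v * q"
  using assms
proof (induction "(if p = 0 then 0 else Suc (degree p)) + (if q = 0 then 0 else Suc (degree q))"
    arbitrary: p q a b rule: less_induct)
  case less
  have one: "in_class \<delta> (a - a) (1 :: 'k poly)" for a by (simp add: in_class_def coeff_1)
  \<comment> \<open>Stated for an arbitrary pair, so that the case in which the second degree is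
    larger follows by exchanging the polynomials.\<close>
  have reduce: "\<exists>c p' q' u v e. c \<noteq> 0 \<and> in_class \<delta> e c \<and> p = c * p' \<and> q = c * q' \<and>
      in_class \<delta> (a - e) p' \<and> in_class \<delta> (b - e) q' \<and> c = u * p + v * q"
    if pq: "in_class \<delta> a p" "in_class \<delta> b q" "p \<noteq> 0" "q \<noteq> 0" "degree q \<le> degree p"
      and IH: "\<And>p'. in_class \<delta> a p' \<Longrightarrow> p' = 0 \<or> degree p' < degree p \<Longrightarrow>
        \<exists>c p'' q' u v e. c \<noteq> 0 \<and> in_class \<delta> e c \<and> p' = c * p'' \<and> q = c * q' \<and>
        in_class \<delta> (a - e) p'' \<and> in_class \<delta> (b - e) q' \<and> c = u * p' + v * q"
    for p q :: "'k poly" and a b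
  proof -
    define m where "m = monom (lead_coeff p / lead_coeff q) (degree p - degree q)"
    define r where "r = p - m * q"
    have "in_class \<delta> (a - 0) (p + monom (- (lead_coeff p / lead_coeff q)) (degree p - degree q) * q)"
      by (rule in_class_euclid_step[OF pq(1-4) _ _ pq(5)]) (use pq in simp_all)
    then have r: "in_class \<delta> a r" by (simp add: r_def m_def flip: minus_monom)
    have "r = 0 \<or> degree r < degree p"
    proof (cases "degree p = 0")
      case True
      then have "degree q = 0" using pq by simp
      with True obtain c d where "p = [:c:]" "q = [:d:]" by (metis degree_eq_zeroE)
      then show ?thesis using pq by (simp add: r_def m_def monom_0)
    next
      case False
      have "degree m \<le> degree p - degree q" unfolding m_def by (rule degree_monom_le)
      then have "degree (m * q) \<le> degree p" using degree_mult_le[of m q] pq(5) by simp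
      then have "degree r \<le> degree p" unfolding r_def by (simp add: degree_diff_le)
      moreover have "coeff r (degree p) = 0"
        using pq by (simp add: r_def m_def coeff_monom_mult)
      ultimately show ?thesis using False
        by (metis le_neq_implies_less leading_coeff_0_iff)
    qed
    from IH[OF r this] obtain c p'' q' u v e where c: "c \<noteq> 0" "in_class \<delta> e c" "r = c * p''" "q = c * q'"
      "in_class \<delta> (a - e) p''" "in_class \<delta> (b - e) q'" "c = u * r + v * q" by blast
    have "in_class \<delta> (a - e) (p'' + m * q')"
      unfolding m_def by (rule in_class_euclid_step[OF pq(1-4) c(5,6) pq(5)])
    moreover have "p = c * (p'' + m * q')" using c(3,4) by (simp add: r_def algebra_simps)
    moreover have "c = u * p + (v - u * m) * q" using c(7) by (simp add: r_def algebra_simps)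
    ultimately show ?thesis using c by blast
  qed
  consider "q = 0" | "p = 0" "q \<noteq> 0" | "p \<noteq> 0" "q \<noteq> 0" "degree q \<le> degree p"
    | "p \<noteq> 0" "q \<noteq> 0" "degree p < degree q" by linarith
  then show ?case
  proof cases
    case 1
    then show ?thesis using less.prems one[of a]
      by (intro exI[of _ p] exI[of _ 1] exI[of _ 0] exI[of _ 1] exI[of _ 0] exI[of _ a]) simp
  next
    case 2
    then show ?thesis using less.prems one[of b]
      by (intro exI[of _ q] exI[of _ 0] exI[of _ 1] exI[of _ 0] exI[of _ 1] exI[of _ b]) simp
  next
    case 3
    show ?thesis
    proof (rule reduce[OF less.prems(1,2) 3])
      fix p' :: "'k poly" assume "in_class \<delta> a p'" "p' = 0 \<or> degree p' < degree p"
      then show "\<exists>c p'' q' u v e. c \<noteq> 0 \<and> in_class \<delta> e c \<and> p' = c * p'' \<and> q = c * q' \<and>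
        in_class \<delta> (a - e) p'' \<and> in_class \<delta> (b - e) q' \<and> c = u * p' + v * q"
        using 3 less.prems by (intro less.hyps) auto
    qed
  next
    case 4
    have "\<exists>c q' p' v u e. c \<noteq> 0 \<and> in_class \<delta> e c \<and> q = c * q' \<and> p = c * p' \<and>
      in_class \<delta> (b - e) q' \<and> in_class \<delta> (a - e) p' \<and> c = v * q + u * p"
    proof (rule reduce[OF less.prems(2,1) 4(2,1)])
      fix q' :: "'k poly" assume q': "in_class \<delta> b q'" "q' = 0 \<or> degree q' < degree q"
      have "\<exists>c p' q'' u v e. c \<noteq> 0 \<and> in_class \<delta> e c \<and> p = c * p' \<and> q' = c * q'' \<and>
        in_class \<delta> (a - e) p' \<and> in_class \<delta> (b - e) q'' \<and> c = u * p + v * q'"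
        using 4 less.prems q' by (intro less.hyps) auto
      then show "\<exists>c q'' p' v u e. c \<noteq> 0 \<and> in_class \<delta> e c \<and> q' = c * q'' \<and> p = c * p' \<and>
        in_class \<delta> (b - e) q'' \<and> in_class \<delta> (a - e) p' \<and> c = v * q' + u * p"
        by (metis add.commute)
    qed (use 4 in simp)
    then show ?thesis by (metis add.commute)
  qed
qed

text \<open>The leading term of the product provides a natural number in each component. Passing to
  a lower term of \<open>p\<close> adds \<open>(degree p - b) * \<delta>\<close>, an integer by the
  class condition and nonnegative because \<delta> is.\<close>

lemma liftable_quotient:
  fixes \<delta> :: "'n::finite \<Rightarrow> real"
  assumes N: "liftable_weight \<delta> N (c * p)" and nz: "c \<noteq> 0" "p \<noteq> 0"
    and p: "in_class \<delta> (int (degree (c * p)) - e) p" "in_class \<delta> e c" and \<delta>: "\<And>i. 0 \<le> \<delta> i"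
  shows "liftable_weight \<delta> (\<lambda>i. N i - real (degree c) * \<delta> i) p"
  unfolding liftable_weight_def ex_weight_expts_iff
proof (intro allI impI)
  fix b i assume b: "coeff p b \<noteq> 0"
  have deg: "degree (c * p) = degree c + degree p" using nz by (simp add: degree_mult_eq)
  have "coeff (c * p) (degree (c * p)) \<noteq> 0" using nz by simp
  then have 1: "N i - real (degree c + degree p) * \<delta> i \<in> \<nat>"
    using N unfolding liftable_weight_def ex_weight_expts_iff deg by blast
  have "b \<le> degree p" using b by (rule le_degree)
  have "(real (degree p) - of_int (int (degree (c * p)) - e)) * \<delta> i - (real b - of_int (int (degree (c * p)) - e)) * \<delta> i \<in> \<int>"
    using p(1) b nz by (intro Ints_diff) (simp_all add: in_class_def)
  then have "(real (degree p) - real b) * \<delta> i \<in> \<int>" by (simp add: left_diff_distrib)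
  moreover have "0 \<le> (real (degree p) - real b) * \<delta> i" using \<open>b \<le> degree p\<close> \<delta> by simp
  ultimately have "(real (degree p) - real b) * \<delta> i \<in> \<nat>" by (simp add: Nats_altdef2)
  from Nats_add[OF 1 this]
  show "N i - real (degree c) * \<delta> i - real b * \<delta> i \<in> \<nat>" by (simp add: algebra_simps)
qed

text \<open>The homogenized greatest common divisor divides G and H, so it is a unit. Setting X = 1
  in its inverse makes the common divisor invertible over the field, and the Bezout identity can be
  divided by it.\<close>

lemma coprime_homogeneous_bezout:
  fixes G H :: "('n::finite, 'k::field) mpoly_Z"
  assumes G: "whomogeneous \<delta> N G" "G \<noteq> 0" and H: "whomogeneous \<delta> N' H" "H \<noteq> 0"
    and co: "coprime_elements G H" and \<delta>: "\<And>i. 0 \<le> \<delta> i"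
  shows "\<exists>u v. u * dehom G + v * dehom H = 1"
proof -
  define p where "p = dehom G"
  define q where "q = dehom H"
  have hp: "homogenize \<delta> N p = G" "homogenize \<delta> N' q = H"
    unfolding p_def q_def using G H by (simp_all add: whomogeneous_homogenize)
  then have nz: "p \<noteq> 0" "q \<noteq> 0" using G H by (auto simp: homogenize_def)
  have lp: "liftable_weight \<delta> N p" and lq: "liftable_weight \<delta> N' q"
    unfolding p_def q_def using G H by (simp_all add: whomogeneous_liftable)
  have cls: "in_class \<delta> (int (degree r)) r" if "liftable_weight \<delta> L r" "r \<noteq> 0" for L and r :: "'k poly"
    unfolding in_class_def
  proof (intro allI impI)
    fix b i assume b: "coeff r b \<noteq> 0"
    have "coeff r (degree r) \<noteq> 0" using that by simp
    then have "L i - real (degree r) * \<delta> i \<in> \<int>" "L i - real b * \<delta> i \<in> \<int>"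
      using that(1) b unfolding liftable_weight_def ex_weight_expts_iff
      using Nats_subset_Ints by blast+
    then have "(L i - real (degree r) * \<delta> i) - (L i - real b * \<delta> i) \<in> \<int>" by (rule Ints_diff)
    then show "(real b - of_int (int (degree r))) * \<delta> i \<in> \<int>"
      using Ints_minus by (fastforce simp: algebra_simps)
  qed
  from in_class_euclid[OF cls[OF lp nz(1)] cls[OF lq nz(2)]] nz
  obtain c p' q' u v e where c: "c \<noteq> 0" "in_class \<delta> e c" "p = c * p'" "q = c * q'"
    "in_class \<delta> (int (degree p) - e) p'" "in_class \<delta> (int (degree q) - e) q'" "c = u * p + v * q"
    by blast
  \<comment> \<open>The weight of \<open>Z^degree c\<close>: the leading term of the homogenized
    divisor is free of X, and the lower terms acquire nonnegative integral exponents of X.\<close>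
  let ?E = "\<lambda>i. real (degree c) * \<delta> i"
  have lc: "liftable_weight \<delta> ?E c"
    unfolding liftable_weight_def ex_weight_expts_iff
  proof (intro allI impI)
    fix b i assume b: "coeff c b \<noteq> 0"
    then have "b \<le> degree c" by (rule le_degree)
    have "(real (degree c) - of_int e) * \<delta> i - (real b - of_int e) * \<delta> i \<in> \<int>"
      using c(1,2) b by (intro Ints_diff) (simp_all add: in_class_def)
    moreover have "(real (degree c) - of_int e) * \<delta> i - (real b - of_int e) * \<delta> i = real (degree c) * \<delta> i - real b * \<delta> i"
      by (simp add: algebra_simps)
    moreover have "real b * \<delta> i \<le> real (degree c) * \<delta> i" using \<open>b \<le> degree c\<close> \<delta> by (simp add: mult_right_mono)
    ultimately show "real (degree c) * \<delta> i - real b * \<delta> i \<in> \<nat>" by (simp add: Nats_altdef2)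
  qed
  have "p' \<noteq> 0" "q' \<noteq> 0" using nz c(3,4) by auto
  have "homogenize \<delta> ?E c dvd G"
  proof -
    have "liftable_weight \<delta> (\<lambda>i. N i - ?E i) p'"
      using liftable_quotient[of \<delta> N c p' e] lp c(1,2,5) \<open>p' \<noteq> 0\<close> \<delta> by (simp add: c(3))
    from homogenize_mult[OF lc this]
    have "homogenize \<delta> ?E c * homogenize \<delta> (\<lambda>i. N i - ?E i) p' = G" using hp(1) by (simp flip: c(3))
    then show ?thesis by (metis dvd_triv_left)
  qed
  moreover have "homogenize \<delta> ?E c dvd H"
  proof -
    have "liftable_weight \<delta> (\<lambda>i. N' i - ?E i) q'"
      using liftable_quotient[of \<delta> N' c q' e] lq c(1,2,6) \<open>q' \<noteq> 0\<close> \<delta> by (simp add: c(4))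
    from homogenize_mult[OF lc this]
    have "homogenize \<delta> ?E c * homogenize \<delta> (\<lambda>i. N' i - ?E i) q' = H" using hp(2) by (simp flip: c(4))
    then show ?thesis by (metis dvd_triv_left)
  qed
  ultimately have "homogenize \<delta> ?E c dvd 1" using co by (simp add: coprime_elements_def)
  then obtain W where "1 = homogenize \<delta> ?E c * W" by (elim dvdE)
  then have "1 = c * dehom W" using dehom_mult[of "homogenize \<delta> ?E c" W] dehom_homogenize[OF lc] by (simp add: dehom_one)
  also have "c * dehom W = (u * p + v * q) * dehom W" by (simp only: flip: c(7))
  also have "\<dots> = (dehom W * u) * p + (dehom W * v) * q" by (simp add: algebra_simps)
  finally show ?thesis unfolding p_def q_def by metis
qed

section \<open>Faces of Newton polyhedra\<close>

lemma inner_coords: "(l :: (real ^ 'n::finite) \<times> real) \<bullet> w = (\<Sum>i\<in>UNIV. fst l $ i * fst w $ i) + snd l * snd w"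
  by (simp add: inner_prod_def inner_vec_def)

lemma exponent_point_coords [simp]:
  "fst (exponent_point p) $ i = real (Poly_Mapping.lookup (fst p) i)"
  "snd (exponent_point p) = real (snd p)"
  by (simp_all add: exponent_point_def case_prod_unfold)

definition newton_hull :: "'n::finite exponent set \<Rightarrow> ((real ^ 'n) \<times> real) set" where
  "newton_hull S = (\<lambda>C. closed C \<and> convex C) hull (exponent_point ` S + nonneg_orthant)"

lemma convex_nonneg_orthant: "convex (nonneg_orthant :: ((real ^ 'n::finite) \<times> real) set)"
  by (auto simp: convex_def nonneg_orthant_def intro!: add_nonneg_nonneg)

lemma closed_nonneg_orthant: "closed (nonneg_orthant :: ((real ^ 'n::finite) \<times> real) set)"
proof -
  have eq: "nonneg_orthant = (\<Inter>i. {v :: (real ^ 'n) \<times> real. 0 \<le> fst v $ i}) \<inter> {v. 0 \<le> snd v}"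
    by (auto simp: nonneg_orthant_def)
  show ?thesis
    unfolding eq by (intro closed_Int closed_INT ballI closed_Collect_le continuous_intros)
qed

text \<open>The sum of a compact and a closed set is closed, so taking the closure adds
  nothing.\<close>

lemma newton_hull_eq:
  assumes "finite S"
  shows "newton_hull S = convex hull (exponent_point ` S) + nonneg_orthant"
proof
  let ?C = "convex hull (exponent_point ` S)"
  have "compact ?C" using assms by (intro finite_imp_compact_convex_hull) simp
  from compact_closed_sums[OF this closed_nonneg_orthant]
  have "closed (\<Union>x\<in>?C. \<Union>y\<in>nonneg_orthant. {x + y})" .
  moreover have "(\<Union>x\<in>?C. \<Union>y\<in>nonneg_orthant. {x + y}) = ?C + nonneg_orthant"
    by (auto simp: set_plus_def)
  ultimately have "closed (?C + nonneg_orthant)" by simp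
  moreover have "convex (?C + nonneg_orthant)"
    by (intro convex_set_plus convex_nonneg_orthant convex_convex_hull)
  ultimately show "newton_hull S \<subseteq> ?C + nonneg_orthant"
    unfolding newton_hull_def by (intro hull_minimal set_plus_mono2 hull_subset) auto
  have "?C + nonneg_orthant = convex hull (exponent_point ` S + nonneg_orthant)"
    by (simp add: convex_hull_set_plus hull_same[where S = convex, OF convex_nonneg_orthant])
  also have "\<dots> \<subseteq> newton_hull S"
  proof (rule hull_minimal)
    show "exponent_point ` S + nonneg_orthant \<subseteq> newton_hull S" unfolding newton_hull_def by (rule hull_subset)
    show "convex (newton_hull S)" unfolding newton_hull_def hull_def by (intro convex_Inter) auto
  qed
  finally show "?C + nonneg_orthant \<subseteq> newton_hull S" .
qed

lemma positive_form_orthant: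
  assumes "positive_form l" "o' \<in> nonneg_orthant"
  shows "0 \<le> l \<bullet> o'" "l \<bullet> o' = 0 \<Longrightarrow> o' = 0"
proof -
  have nn: "0 \<le> fst l $ i * fst o' $ i" "0 \<le> snd l * snd o'" for i
    using assms by (simp_all add: positive_form_def nonneg_orthant_def less_imp_le)
  then have s: "0 \<le> (\<Sum>i\<in>UNIV. fst l $ i * fst o' $ i)" by (intro sum_nonneg) simp
  show "0 \<le> l \<bullet> o'" using s nn by (simp add: inner_coords)
  assume "l \<bullet> o' = 0"
  then have "(\<Sum>i\<in>UNIV. fst l $ i * fst o' $ i) = 0" "snd l * snd o' = 0"
    using s nn(2) unfolding inner_coords by linarith+
  then have "fst l $ i * fst o' $ i = 0" for i using nn(1) by (simp add: sum_nonneg_eq_0_iff)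
  then have "fst o' $ i = 0" for i using assms(1) by (metis less_irrefl mult_eq_0_iff positive_form_def)
  moreover have "snd o' = 0" using \<open>snd l * snd o' = 0\<close> assms(1) by (auto simp: positive_form_def)
  ultimately show "o' = 0" by (simp add: prod_eq_iff vec_eq_iff)
qed

lemma exponent_point_in_newton_hull:
  assumes "finite S" "p \<in> S"
  shows "exponent_point p \<in> newton_hull S"
proof -
  have "exponent_point p \<in> convex hull (exponent_point ` S)" using assms by (intro hull_inc) simp
  moreover have "0 \<in> nonneg_orthant" by (simp add: nonneg_orthant_def)
  ultimately have "exponent_point p + 0 \<in> convex hull (exponent_point ` S) + nonneg_orthant"
    by (rule set_plus_intro)
  then show ?thesis using newton_hull_eq[OF assms(1)] by simp
qed

lemma newton_hull_lower_bound:
  assumes "finite S" "positive_form l" "\<And>p. p \<in> S \<Longrightarrow> c \<le> l \<bullet> exponent_point p" "w \<in> newton_hull S"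
  shows "c \<le> l \<bullet> w"
proof -
  obtain k o' where w: "w = k + o'" "k \<in> convex hull (exponent_point ` S)" "o' \<in> nonneg_orthant"
    using assms(4) unfolding newton_hull_eq[OF assms(1)] by (elim set_plus_elim)
  have "convex hull (exponent_point ` S) \<subseteq> {v. c \<le> l \<bullet> v}"
    using assms(3) by (intro hull_minimal convex_halfspace_ge) auto
  then have "c \<le> l \<bullet> k" using w by auto
  then show ?thesis using positive_form_orthant(1)[OF assms(2) w(3)] by (simp add: w inner_add_right)
qed

text \<open>A positive form vanishes on the orthant only at the origin, so its minimum is attained
  within the compact hull of the exponents; a face of a polytope is the hull of the generating
  points on it.\<close>

lemma newton_hull_face:
  assumes S: "finite S" and l: "positive_form l" and c: "\<And>p. p \<in> S \<Longrightarrow> c \<le> l \<bullet> exponent_point p"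
    and q: "q \<in> S" "l \<bullet> exponent_point q = c"
  shows "{v \<in> newton_hull S. \<forall>w\<in>newton_hull S. l \<bullet> v \<le> l \<bullet> w} =
    convex hull (exponent_point ` {p\<in>S. l \<bullet> exponent_point p = c})" (is "?F = ?R")
proof -
  let ?C = "convex hull (exponent_point ` S)"
  have F: "?F = {v \<in> newton_hull S. l \<bullet> v = c}"
    using newton_hull_lower_bound[OF S l c] exponent_point_in_newton_hull[OF S q(1)] q(2)
    by (auto intro!: antisym)
  have Cge: "c \<le> l \<bullet> k" if "k \<in> ?C" for k
  proof -
    have "?C \<subseteq> {v. c \<le> l \<bullet> v}" using c by (intro hull_minimal convex_halfspace_ge) blast
    then show ?thesis using that by blast
  qed
  have "{v \<in> newton_hull S. l \<bullet> v = c} = ?C \<inter> {v. l \<bullet> v = c}"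
  proof
    show "{v \<in> newton_hull S. l \<bullet> v = c} \<subseteq> ?C \<inter> {v. l \<bullet> v = c}"
    proof
      fix v assume v: "v \<in> {v \<in> newton_hull S. l \<bullet> v = c}"
      then obtain k o' where k: "v = k + o'" "k \<in> ?C" "o' \<in> nonneg_orthant"
        unfolding newton_hull_eq[OF S] by (auto elim: set_plus_elim)
      have "l \<bullet> k + l \<bullet> o' = c" using v k(1) by (simp add: inner_add_right)
      then have "l \<bullet> o' = 0" using Cge[OF k(2)] positive_form_orthant(1)[OF l k(3)] by linarith
      then have "o' = 0" by (rule positive_form_orthant(2)[OF l k(3)])
      then show "v \<in> ?C \<inter> {v. l \<bullet> v = c}" using k v by simp
    qed
    have "k + 0 \<in> ?C + nonneg_orthant" if "k \<in> ?C" for k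
      using that by (rule set_plus_intro) (simp add: nonneg_orthant_def)
    then show "?C \<inter> {v. l \<bullet> v = c} \<subseteq> {v \<in> newton_hull S. l \<bullet> v = c}"
      by (auto simp: newton_hull_eq[OF S])
  qed
  also have "\<dots> = ?R"
  proof
    have "(?C \<inter> {v. l \<bullet> v = c}) face_of ?C"
      by (rule face_of_Int_supporting_hyperplane_ge[OF convex_convex_hull Cge])
    moreover have "compact (exponent_point ` S)" using S by (intro finite_imp_compact) simp
    ultimately obtain S' where S': "S' \<subseteq> exponent_point ` S" "?C \<inter> {v. l \<bullet> v = c} = convex hull S'"
      using face_of_convex_hull_subset by metis
    have "S' \<subseteq> {v. l \<bullet> v = c}" using S'(2) hull_subset[of S' convex] by auto
    then have "S' \<subseteq> exponent_point ` {p\<in>S. l \<bullet> exponent_point p = c}" using S'(1) by blast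
    then show "?C \<inter> {v. l \<bullet> v = c} \<subseteq> ?R" unfolding S'(2) by (rule hull_mono)
    have "?R \<subseteq> ?C" by (rule hull_mono) auto
    moreover have "?R \<subseteq> {v. l \<bullet> v = c}"
      by (rule hull_minimal) (auto simp: convex_hyperplane)
    ultimately show "?R \<subseteq> ?C \<inter> {v. l \<bullet> v = c}" by blast
  qed
  finally show ?thesis using F by simp
qed

section \<open>Weights of real points and the linear forms built from them\<close>

definition point_weight :: "('n \<Rightarrow> real) \<Rightarrow> (real ^ 'n) \<times> real \<Rightarrow> 'n \<Rightarrow> real" where
  "point_weight \<delta> v i = fst v $ i + snd v * \<delta> i"

lemma point_weight_exponent_point:
  "point_weight \<delta> (exponent_point p) i = edge_weight \<delta> (fst p) (snd p) i"
  by (simp add: point_weight_def edge_weight_def)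

text \<open>The last coefficient is chosen so that the form vanishes on the direction
  \<open>(- \<delta>, 1)\<close> of the edge; every form constant along that direction arises in
  this way.\<close>

definition weight_form :: "('n::finite \<Rightarrow> real) \<Rightarrow> ('n \<Rightarrow> real) \<Rightarrow> (real ^ 'n) \<times> real" where
  "weight_form \<delta> e = ((\<chi> i. e i), (\<Sum>i\<in>UNIV. e i * \<delta> i))"

lemma weight_form_inner: "weight_form \<delta> e \<bullet> v = (\<Sum>i\<in>UNIV. e i * point_weight \<delta> v i)"
  by (simp add: weight_form_def inner_coords point_weight_def distrib_left sum.distrib
      sum_distrib_left sum_distrib_right mult_ac)

lemma positive_weight_form:
  assumes "\<And>i. 0 \<le> \<delta> i" "0 < \<delta> j" "\<And>i. 0 < e i"
  shows "positive_form (weight_form \<delta> e)"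
proof -
  have "0 < (\<Sum>i\<in>UNIV. e i * \<delta> i)"
    by (rule sum_pos2[of _ j]) (use assms in \<open>auto simp: less_imp_le\<close>)
  then show ?thesis using assms by (simp add: positive_form_def weight_form_def)
qed

lemma affine_point_weight: "affine {v. point_weight \<delta> v = N}"
proof -
  have "point_weight \<delta> (u *\<^sub>R v + w *\<^sub>R v') i = u * point_weight \<delta> v i + w * point_weight \<delta> v' i" for u w v v' i
    by (simp add: point_weight_def algebra_simps)
  moreover have "u * N i + w * N i = N i" if "u + w = 1" for u w i
    using that by (simp flip: distrib_right)
  ultimately show ?thesis unfolding affine_def mem_Collect_eq fun_eq_iff by simp
qed

lemma aff_dim_point_weight: "aff_dim {v :: (real ^ 'n::finite) \<times> real. point_weight \<delta> v = N} \<le> 1"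
proof -
  define a :: "(real ^ 'n) \<times> real" where "a = ((\<chi> i. N i), 0)"
  define d :: "(real ^ 'n) \<times> real" where "d = ((\<chi> i. - \<delta> i), 1)"
  have "{v. point_weight \<delta> v = N} \<subseteq> affine hull {a, a + d}"
  proof
    fix v assume v: "v \<in> {v. point_weight \<delta> v = N}"
    have "fst v $ i = N i - snd v * \<delta> i" for i
      using v by (auto simp: point_weight_def fun_eq_iff eq_diff_eq)
    then have "v = (1 - snd v) *\<^sub>R a + snd v *\<^sub>R (a + d)"
      by (simp add: prod_eq_iff vec_eq_iff a_def d_def algebra_simps)
    then show "v \<in> affine hull {a, a + d}" unfolding affine_hull_2
      by (intro CollectI exI[of _ "1 - snd v"] exI[of _ "snd v"]) simp
  qed
  then have "aff_dim {v. point_weight \<delta> v = N} \<le> aff_dim (affine hull {a, a + d})" by (rule aff_dim_subset)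
  also have "\<dots> \<le> 1" by (simp add: d_def prod_eq_iff)
  finally show ?thesis .
qed

lemma convex_hull_point_weight:
  assumes "\<And>p. p \<in> S \<Longrightarrow> edge_weight \<delta> (fst p) (snd p) = N" "v \<in> convex hull (exponent_point ` S)"
  shows "point_weight \<delta> v = N"
proof -
  have "exponent_point ` S \<subseteq> {v. point_weight \<delta> v = N}"
    using assms(1) by (auto simp: fun_eq_iff point_weight_exponent_point)
  then have "convex hull (exponent_point ` S) \<subseteq> {v. point_weight \<delta> v = N}"
    by (intro hull_minimal affine_imp_convex affine_point_weight)
  then show ?thesis using assms(2) by blast
qed

text \<open>The sum of all weights is a positive form. Under the componentwise lower bound N it is
  minimal exactly where every component equals its bound, and those points lie on one line.\<close>

lemma newton_hull_edge_face:
  fixes \<delta> :: "'n::finite \<Rightarrow> real"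
  assumes S: "finite S" and \<delta>: "\<And>i. 0 \<le> \<delta> i" "0 < \<delta> j"
    and N: "\<And>p i. p \<in> S \<Longrightarrow> N i \<le> edge_weight \<delta> (fst p) (snd p) i"
    and q: "q \<in> S" "edge_weight \<delta> (fst q) (snd q) = N"
  defines "F \<equiv> convex hull (exponent_point ` {p\<in>S. edge_weight \<delta> (fst p) (snd p) = N})"
  shows "compact_face (newton_hull S) F" "aff_dim F \<le> 1"
    "p \<in> S \<Longrightarrow> exponent_point p \<in> F \<longleftrightarrow> edge_weight \<delta> (fst p) (snd p) = N"
proof -
  let ?l = "weight_form \<delta> (\<lambda>_. 1)"
  let ?c = "\<Sum>i\<in>UNIV. N i"
  have l: "positive_form ?l" using \<delta> by (intro positive_weight_form) auto
  have lw: "?l \<bullet> exponent_point p = (\<Sum>i\<in>UNIV. edge_weight \<delta> (fst p) (snd p) i)" for p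
    by (simp add: weight_form_inner point_weight_exponent_point)
  have ge: "?c \<le> ?l \<bullet> exponent_point p" if "p \<in> S" for p
    unfolding lw using N[OF that] by (rule sum_mono)
  have eq: "?l \<bullet> exponent_point p = ?c \<longleftrightarrow> edge_weight \<delta> (fst p) (snd p) = N" if "p \<in> S" for p
  proof
    assume "?l \<bullet> exponent_point p = ?c"
    then have "(\<Sum>i\<in>UNIV. edge_weight \<delta> (fst p) (snd p) i - N i) = 0" by (simp add: lw sum_subtractf)
    then have "edge_weight \<delta> (fst p) (snd p) i - N i = 0" for i
      using N[OF that] by (subst (asm) sum_nonneg_eq_0_iff) auto
    then show "edge_weight \<delta> (fst p) (snd p) = N" by (simp add: fun_eq_iff)
  qed (simp add: lw)
  have "{p\<in>S. ?l \<bullet> exponent_point p = ?c} = {p\<in>S. edge_weight \<delta> (fst p) (snd p) = N}"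
    using eq by blast
  then have "{v \<in> newton_hull S. \<forall>w\<in>newton_hull S. ?l \<bullet> v \<le> ?l \<bullet> w} = F"
    using newton_hull_face[OF S l ge q(1)] eq[OF q(1)] q(2) by (simp add: F_def)
  then show "compact_face (newton_hull S) F" unfolding compact_face_def using l by blast
  have sub: "F \<subseteq> {v. point_weight \<delta> v = N}"
    unfolding F_def using convex_hull_point_weight[of "{p\<in>S. edge_weight \<delta> (fst p) (snd p) = N}" \<delta> N] by blast
  show "aff_dim F \<le> 1" using aff_dim_subset[OF sub] aff_dim_point_weight[of \<delta> N] by simp
  show "exponent_point p \<in> F \<longleftrightarrow> edge_weight \<delta> (fst p) (snd p) = N" if "p \<in> S"
  proof
    assume "exponent_point p \<in> F"
    then show "edge_weight \<delta> (fst p) (snd p) = N"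
      using sub by (auto simp: fun_eq_iff point_weight_exponent_point)
  next
    assume "edge_weight \<delta> (fst p) (snd p) = N"
    then show "exponent_point p \<in> F" unfolding F_def using that by (intro hull_inc) auto
  qed
qed

text \<open>For a loose edge every positive form that is constant on the edge attains its minimum
  exactly on the edge. Otherwise some form on the segment to it from a form defining the edge
  would define a larger face.\<close>

lemma loose_edge_weights:
  fixes E :: "((real ^ 'n::finite) \<times> real) set"
  assumes S: "finite S" and loose: "loose_edge (newton_hull S) E" and desc: "descendant E"
  shows "\<exists>\<delta> M. (\<forall>i. 0 \<le> \<delta> i) \<and> (\<exists>i. 0 < \<delta> i) \<and>
    (\<forall>p\<in>S. \<forall>i. M i \<le> edge_weight \<delta> (fst p) (snd p) i) \<and>
    (\<forall>p\<in>S. exponent_point p \<in> E \<longleftrightarrow> edge_weight \<delta> (fst p) (snd p) = M) \<and>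
    E = convex hull (exponent_point ` {p\<in>S. edge_weight \<delta> (fst p) (snd p) = M})"
proof -
  let ?P = "newton_hull S"
  obtain l0 where l0: "positive_form l0" and E: "E = {v \<in> ?P. \<forall>w\<in>?P. l0 \<bullet> v \<le> l0 \<bullet> w}"
    and dimE: "aff_dim E = 1"
    using loose by (auto simp: loose_edge_def compact_edge_def compact_face_def)
  have "S \<noteq> {}"
  proof
    assume "S = {}"
    then have "?P = {}" using newton_hull_eq[OF S] by (simp add: set_plus_def)
    then show False using dimE E by simp
  qed
  define c0 where "c0 = Min ((\<lambda>p. l0 \<bullet> exponent_point p) ` S)"
  have c0: "c0 \<le> l0 \<bullet> exponent_point p" if "p \<in> S" for p
    unfolding c0_def using S that by (intro Min_le) auto
  have "c0 \<in> (\<lambda>p. l0 \<bullet> exponent_point p) ` S" unfolding c0_def using S \<open>S \<noteq> {}\<close> by (intro Min_in) auto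
  then obtain q0 where q0: "q0 \<in> S" "l0 \<bullet> exponent_point q0 = c0" by auto
  have Eh: "E = convex hull (exponent_point ` {p\<in>S. l0 \<bullet> exponent_point p = c0})"
    unfolding E by (rule newton_hull_face[OF S l0 c0 q0])
  have El0: "l0 \<bullet> v = c0" if "v \<in> E" for v
  proof -
    have "E \<subseteq> {v. l0 \<bullet> v = c0}" unfolding Eh by (rule hull_minimal) (auto simp: convex_hyperplane)
    then show ?thesis using that by blast
  qed
  have inE: "exponent_point p \<in> E \<longleftrightarrow> l0 \<bullet> exponent_point p = c0" if "p \<in> S" for p
  proof
    assume "l0 \<bullet> exponent_point p = c0"
    then show "exponent_point p \<in> E" using that unfolding Eh by (intro hull_inc) blast
  qed (rule El0)
  obtain d where d: "\<And>i. 0 \<le> fst d $ i" "snd d < 0" "\<And>v w. v \<in> E \<Longrightarrow> w \<in> E \<Longrightarrow> \<exists>t. w - v = t *\<^sub>R d"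
    using desc unfolding descendant_def by blast
  define v0 where "v0 = exponent_point q0"
  have v0: "v0 \<in> E" unfolding v0_def using inE q0 by simp
  have "E \<noteq> {v0}" using dimE by auto
  then obtain w0 where w0: "w0 \<in> E" "w0 \<noteq> v0" using v0 by blast
  obtain t where t: "w0 - v0 = t *\<^sub>R d" using d(3)[OF v0 w0(1)] by blast
  have "t \<noteq> 0" using t w0 by auto
  have "t * (l0 \<bullet> d) = l0 \<bullet> w0 - l0 \<bullet> v0" by (simp flip: inner_diff_right add: t)
  then have l0d: "l0 \<bullet> d = 0" using El0[OF v0] El0[OF w0(1)] \<open>t \<noteq> 0\<close> by simp
  \<comment> \<open>The direction of the edge, rescaled to have last coordinate -1.\<close>
  define \<delta> where "\<delta> i = fst d $ i / (- snd d)" for i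
  \<comment> \<open>Nonnegativity is the descent of the edge. Some component is even positive, since
    a positive form vanishes on the direction and so the direction is not parallel to the last
    axis.\<close>
  have \<delta>: "0 \<le> \<delta> i" for i using d by (simp add: \<delta>_def divide_nonneg_neg)
  have "\<exists>i. 0 < \<delta> i"
  proof (rule ccontr)
    assume "\<nexists>i. 0 < \<delta> i"
    then have "\<delta> i = 0" for i using \<delta>[of i] by (metis less_eq_real_def)
    then have "fst d $ i = 0" for i using d(2) by (simp add: \<delta>_def)
    then have "snd l0 * snd d = 0" using l0d by (simp add: inner_coords)
    then show False using d(2) l0 by (simp add: positive_form_def)
  qed
  then obtain j where j: "0 < \<delta> j" ..
  have d\<delta>: "fst d $ i + snd d * \<delta> i = 0" for i using d(2) by (simp add: \<delta>_def)
  have Ew: "point_weight \<delta> v = point_weight \<delta> v0" if vE: "v \<in> E" for v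
  proof
    fix i
    obtain s where s: "v - v0 = s *\<^sub>R d" using d(3)[OF v0 vE] by blast
    then have v: "v = v0 + s *\<^sub>R d" by (metis add.commute diff_add_cancel)
    have "point_weight \<delta> v i = point_weight \<delta> v0 i + s * (fst d $ i + snd d * \<delta> i)"
      unfolding v by (simp add: point_weight_def algebra_simps)
    then show "point_weight \<delta> v i = point_weight \<delta> v0 i" by (simp add: d\<delta>)
  qed
  define M where "M = point_weight \<delta> v0"
  have claim: "exponent_point p \<in> E \<or> weight_form \<delta> e \<bullet> v0 < weight_form \<delta> e \<bullet> exponent_point p"
    if p: "p \<in> S" and e: "\<And>i. 0 < e i" for p e
  proof (rule ccontr)
    assume bad: "\<not> ?thesis"
    let ?l = "weight_form \<delta> e"
    have l: "positive_form ?l" using \<delta> j e by (rule positive_weight_form)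
    define f0 where "f0 p = l0 \<bullet> exponent_point p - c0" for p
    define f1 where "f1 p = ?l \<bullet> exponent_point p - ?l \<bullet> v0" for p
    define B where "B = {p\<in>S. exponent_point p \<notin> E \<and> f1 p \<le> 0}"
    have B: "finite B" "p \<in> B" using S p bad by (auto simp: B_def f1_def)
    have f0: "0 < f0 q" if "q \<in> S" "exponent_point q \<notin> E" for q
      using c0[OF that(1)] inE[OF that(1)] that(2) by (simp add: f0_def)
    \<comment> \<open>Along \<open>(1 - s) *\<^sub>R l0 + s *\<^sub>R ?l\<close> the excess of
      \<open>q\<close> over the edge is \<open>(1 - s) * f0 q + s * f1 q\<close>, which vanishes at
      \<open>s = r q\<close>. The least such value belongs to the first exponents that reach the
      level of the edge.\<close>
    define r where "r q = f0 q / (f0 q - f1 q)" for q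
    define s where "s = Min (r ` B)"
    have "s \<in> r ` B" unfolding s_def using B by (intro Min_in) auto
    then obtain q where q: "q \<in> B" "s = r q" by auto
    have sle: "s \<le> r q'" if "q' \<in> B" for q' unfolding s_def using B that by (intro Min_le) auto
    have rB: "f0 q' - f1 q' > 0" if "q' \<in> B" for q' using that f0[of q'] by (auto simp: B_def)
    have fq: "0 < f0 q" "f1 q \<le> 0" using q(1) f0[of q] by (auto simp: B_def)
    have s01: "0 < s" "s \<le> 1"
      unfolding q(2) r_def using rB[OF q(1)] fq by (simp_all add: pos_divide_le_eq)
    define l' where "l' = (1 - s) *\<^sub>R l0 + s *\<^sub>R ?l"
    have l': "positive_form l'"
      unfolding positive_form_def
    proof (intro conjI allI)
      have "0 \<le> (1 - s) * fst l0 $ i" "0 < s * fst ?l $ i" for i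
        using s01 l0 l by (auto simp: positive_form_def less_imp_le)
      then show "0 < fst l' $ i" for i unfolding l'_def by (simp add: add_nonneg_pos)
      have "0 \<le> (1 - s) * snd l0" "0 < s * snd ?l"
        using s01 l0 l by (auto simp: positive_form_def less_imp_le)
      then show "0 < snd l'" unfolding l'_def by (simp add: add_nonneg_pos)
    qed
    have l'E: "l' \<bullet> v = l' \<bullet> v0" if "v \<in> E" for v
      using El0[OF that] El0[OF v0] Ew[OF that] by (simp add: l'_def inner_add_left weight_form_inner)
    have l'f: "l' \<bullet> exponent_point q' - l' \<bullet> v0 = (1 - s) * f0 q' + s * f1 q'" for q'
      using El0[OF v0] by (simp add: l'_def f0_def f1_def inner_add_left algebra_simps)
    have l'ge: "l' \<bullet> v0 \<le> l' \<bullet> exponent_point q'" if q': "q' \<in> S" for q'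
    proof (cases "exponent_point q' \<in> E")
      case True
      then show ?thesis using l'E by simp
    next
      case nE: False
      have "0 \<le> (1 - s) * f0 q' + s * f1 q'"
      proof (cases "f1 q' \<le> 0")
        case True
        then have B': "q' \<in> B" using nE q' by (simp add: B_def)
        have "s * (f0 q' - f1 q') \<le> f0 q'"
          using sle[OF B'] rB[OF B'] by (simp add: r_def pos_le_divide_eq)
        then show ?thesis by (simp add: algebra_simps)
      next
        case False
        then show ?thesis using f0[OF q' nE] s01 by (intro add_nonneg_nonneg mult_nonneg_nonneg) auto
      qed
      then show ?thesis using l'f[of q'] by simp
    qed
    have "s * (f0 q - f1 q) = f0 q" using rB[OF q(1)] by (simp add: q(2) r_def)
    then have l'q: "l' \<bullet> exponent_point q = l' \<bullet> v0" using l'f[of q] by (simp add: algebra_simps)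
    define F where "F = {v \<in> ?P. \<forall>w\<in>?P. l' \<bullet> v \<le> l' \<bullet> w}"
    have lb: "l' \<bullet> v0 \<le> l' \<bullet> w" if "w \<in> ?P" for w using newton_hull_lower_bound[OF S l' l'ge that] .
    have EF: "E \<subseteq> F" unfolding F_def using lb l'E E by auto
    have qF: "exponent_point q \<in> F"
      unfolding F_def using lb l'q exponent_point_in_newton_hull[OF S] q(1) by (auto simp: B_def)
    \<comment> \<open>The form \<open>l0\<close> is constant on the affine hull of the edge and
      larger at the new exponent, so the face found has dimension at least two.\<close>
    have "affine hull E \<subseteq> {v. l0 \<bullet> v = c0}"
      using El0 by (intro hull_minimal affine_hyperplane) auto
    then have "exponent_point q \<notin> affine hull E" using q(1) inE[of q] by (auto simp: B_def)
    then have "aff_dim (insert (exponent_point q) E) = 2" using dimE by (simp add: aff_dim_insert)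
    then have "2 \<le> aff_dim F" using aff_dim_subset[of "insert (exponent_point q) E" F] EF qF by simp
    moreover have "compact_face ?P F" unfolding compact_face_def F_def using l' by blast
    ultimately show False using loose EF unfolding loose_edge_def by blast
  qed
  have Mle: "M i \<le> edge_weight \<delta> (fst p) (snd p) i" if p: "p \<in> S" for p i
  proof (rule ccontr)
    assume n: "\<not> ?thesis"
    define y where "y k = edge_weight \<delta> (fst p) (snd p) k - M k" for k
    have yi: "y i < 0" using n by (simp add: y_def)
    define B where "B = (\<Sum>k\<in>UNIV. \<bar>y k\<bar>)"
    have B: "0 \<le> B" unfolding B_def by (intro sum_nonneg) simp
    \<comment> \<open>The form weights component \<open>i\<close> by 1 and the others by \<eta>.
      Since \<open>\<eta> * (1 + B) = - y i / 2\<close>, the other components cannot make up for the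
      negative one.\<close>
    define \<eta> where "\<eta> = (- y i / 2) / (1 + B)"
    have \<eta>: "0 < \<eta>" unfolding \<eta>_def using yi B by (intro divide_pos_pos) auto
    define e where "e k = (if k = i then 1 else \<eta>)" for k
    have "exponent_point p \<notin> E"
    proof
      assume "exponent_point p \<in> E"
      from fun_cong[OF Ew[OF this], of i] show False
        using n by (simp add: M_def point_weight_exponent_point)
    qed
    then have "weight_form \<delta> e \<bullet> v0 < weight_form \<delta> e \<bullet> exponent_point p"
      using claim[OF p, of e] \<eta> by (auto simp: e_def)
    then have "0 < (\<Sum>k\<in>UNIV. e k * y k)"
      by (simp add: weight_form_inner point_weight_exponent_point y_def M_def right_diff_distrib sum_subtractf)
    also have "(\<Sum>k\<in>UNIV. e k * y k) = y i + (\<Sum>k\<in>UNIV - {i}. \<eta> * y k)"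
      by (subst sum.remove[of _ i]) (auto simp: e_def)
    also have "\<dots> \<le> y i + (\<Sum>k\<in>UNIV - {i}. \<eta> * \<bar>y k\<bar>)"
      using \<eta> by (intro add_left_mono sum_mono mult_left_mono) auto
    also have "\<dots> \<le> y i + (\<Sum>k\<in>UNIV. \<eta> * \<bar>y k\<bar>)"
      using \<eta> by (intro add_left_mono sum_mono2) auto
    also have "\<dots> = y i + \<eta> * B" by (simp add: B_def sum_distrib_left)
    also have "\<eta> * B \<le> \<eta> * (1 + B)" using \<eta> by simp
    also have "\<eta> * (1 + B) = - y i / 2"
    proof -
      have "1 + B \<noteq> 0" using B by linarith
      then show ?thesis unfolding \<eta>_def by (rule nonzero_eq_divide_eq[THEN iffD1, OF _ refl])
    qed
    finally show False using yi by simp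
  qed
  have mem: "exponent_point p \<in> E \<longleftrightarrow> edge_weight \<delta> (fst p) (snd p) = M" if p: "p \<in> S" for p
  proof
    assume "exponent_point p \<in> E"
    from Ew[OF this] show "edge_weight \<delta> (fst p) (snd p) = M"
      by (auto simp: M_def fun_eq_iff point_weight_exponent_point)
  next
    assume "edge_weight \<delta> (fst p) (snd p) = M"
    then have "weight_form \<delta> (\<lambda>_. 1) \<bullet> exponent_point p = weight_form \<delta> (\<lambda>_. 1) \<bullet> v0"
      by (simp add: weight_form_inner point_weight_exponent_point M_def)
    then show "exponent_point p \<in> E" using claim[OF p, of "\<lambda>_. 1"] by simp
  qed
  have "{p\<in>S. l0 \<bullet> exponent_point p = c0} = {p\<in>S. edge_weight \<delta> (fst p) (snd p) = M}"
    using mem inE by blast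
  then have "E = convex hull (exponent_point ` {p\<in>S. edge_weight \<delta> (fst p) (snd p) = M})"
    using Eh by simp
  then show ?thesis using \<delta> j Mle mem by blast
qed

section \<open>Minkowski sums of segments on parallel lines\<close>

definition line_point :: "('n::finite \<Rightarrow> real) \<Rightarrow> ('n \<Rightarrow> real) \<Rightarrow> real \<Rightarrow> (real ^ 'n) \<times> real" where
  "line_point \<delta> N b = ((\<chi> i. N i - b * \<delta> i), b)"

lemma exponent_point_line: "edge_weight \<delta> (fst p) (snd p) = N \<Longrightarrow> exponent_point p = line_point \<delta> N (real (snd p))"
  by (auto simp: line_point_def prod_eq_iff vec_eq_iff edge_weight_def)

lemma line_point_add: "line_point \<delta> N b + line_point \<delta> N' c = line_point \<delta> (\<lambda>i. N i + N' i) (b + c)"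
  by (simp add: line_point_def prod_eq_iff vec_eq_iff algebra_simps)

lemma exponent_point_supp:
  assumes "whomogeneous \<delta> N P"
  shows "exponent_point ` supp P = (\<lambda>b. line_point \<delta> N (real b)) ` {b. coeff (dehom P) b \<noteq> 0}"
proof
  show "exponent_point ` supp P \<subseteq> (\<lambda>b. line_point \<delta> N (real b)) ` {b. coeff (dehom P) b \<noteq> 0}"
  proof (rule image_subsetI)
    fix p assume p: "p \<in> supp P"
    then have w: "edge_weight \<delta> (fst p) (snd p) = N" using assms by (simp add: whomogeneous_def)
    have "coeff (dehom P) (snd p) \<noteq> 0"
      using p whomogeneous_lookup[OF assms w] by (simp add: supp_def cf_def)
    then show "exponent_point p \<in> (\<lambda>b. line_point \<delta> N (real b)) ` {b. coeff (dehom P) b \<noteq> 0}"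
      using exponent_point_line[OF w] by blast
  qed
  show "(\<lambda>b. line_point \<delta> N (real b)) ` {b. coeff (dehom P) b \<noteq> 0} \<subseteq> exponent_point ` supp P"
  proof (rule image_subsetI)
    fix b assume b: "b \<in> {b. coeff (dehom P) b \<noteq> 0}"
    then obtain A where A: "edge_weight \<delta> A b = N"
      using whomogeneous_liftable[OF assms] by (auto simp: liftable_weight_def weight_expts_def)
    have "(A, b) \<in> supp P" using whomogeneous_lookup[OF assms A] b by (simp add: supp_def cf_def)
    moreover have "exponent_point (A, b) = line_point \<delta> N (real b)" using exponent_point_line[of \<delta> "(A, b)" N] A by simp
    ultimately show "line_point \<delta> N (real b) \<in> exponent_point ` supp P" by (metis imageI)
  qed
qed

text \<open>All three hulls are segments on parallel lines, determined by the lowest and the highest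
  power of Z. At both ends the coefficient of the product is a product of nonzero coefficients; the
  terms in between may cancel.\<close>

lemma convex_hull_supp_mult:
  fixes G H :: "('n::finite, 'k::field) mpoly_Z"
  assumes G: "whomogeneous \<delta> N G" "G \<noteq> 0" and H: "whomogeneous \<delta> N' H" "H \<noteq> 0"
    and GH: "whomogeneous \<delta> (\<lambda>i. N i + N' i) (G * H)"
  shows "convex hull (exponent_point ` supp (G * H)) =
    convex hull (exponent_point ` supp G) + convex hull (exponent_point ` supp H)"
proof -
  let ?M = "\<lambda>i. N i + N' i"
  let ?p = "dehom G" and ?q = "dehom H"
  have nz: "?p \<noteq> 0" "?q \<noteq> 0"
    using whomogeneous_homogenize[OF G(1)] whomogeneous_homogenize[OF H(1)] G H by (auto simp: homogenize_def)
  define m where "m = (LEAST b. coeff ?p b \<noteq> 0)"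
  define n where "n = (LEAST b. coeff ?q b \<noteq> 0)"
  have m: "coeff ?p m \<noteq> 0" unfolding m_def by (rule LeastI[of _ "degree ?p"]) (use nz in simp)
  have n: "coeff ?q n \<noteq> 0" unfolding n_def by (rule LeastI[of _ "degree ?q"]) (use nz in simp)
  have m': "m \<le> b" if "coeff ?p b \<noteq> 0" for b unfolding m_def using that by (rule Least_le)
  have n': "n \<le> b" if "coeff ?q b \<noteq> 0" for b unfolding n_def using that by (rule Least_le)
  have lo: "coeff (?p * ?q) (m + n) \<noteq> 0"
  proof -
    have "coeff (?p * ?q) (m + n) = (\<Sum>i\<le>m + n. if i = m then coeff ?p m * coeff ?q n else 0)"
      unfolding coeff_mult
    proof (rule sum.cong)
      fix i assume i: "i \<in> {..m + n}"
      show "coeff ?p i * coeff ?q (m + n - i) = (if i = m then coeff ?p m * coeff ?q n else 0)"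
      proof (cases "i = m")
        case False
        have "coeff ?p i = 0 \<or> coeff ?q (m + n - i) = 0"
        proof (rule ccontr)
          assume "\<not> ?thesis"
          then have "m \<le> i" "n \<le> m + n - i" using m' n' by auto
          then show False using False i by auto
        qed
        then show ?thesis using False by auto
      qed simp
    qed simp
    then show ?thesis using m n by simp
  qed
  have hi: "coeff (?p * ?q) (degree ?p + degree ?q) \<noteq> 0"
    using nz by (simp add: coeff_mult_degree_sum)
  have inC: "line_point \<delta> ?M (real b) \<in> convex hull (exponent_point ` supp (G * H))"
    if "coeff (?p * ?q) b \<noteq> 0" for b
    using that unfolding exponent_point_supp[OF GH] dehom_mult by (intro hull_inc) auto
  have line: "line_point \<delta> ?M c \<in> convex hull (exponent_point ` supp (G * H))"
    if "real (m + n) \<le> c" "c \<le> real (degree ?p + degree ?q)" for c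
  proof -
    have "c \<in> closed_segment (real (m + n)) (real (degree ?p + degree ?q))"
      using that by (simp add: closed_segment_eq_real_ivl)
    then obtain u where u: "0 \<le> u" "u \<le> 1" "c = (1 - u) * real (m + n) + u * real (degree ?p + degree ?q)"
      by (auto simp: closed_segment_def)
    have "line_point \<delta> ?M c = (1 - u) *\<^sub>R line_point \<delta> ?M (real (m + n)) + u *\<^sub>R line_point \<delta> ?M (real (degree ?p + degree ?q))"
      unfolding u(3) by (simp add: line_point_def prod_eq_iff vec_eq_iff algebra_simps)
    also have "\<dots> \<in> convex hull (exponent_point ` supp (G * H))"
      using u by (intro convexD[OF convex_convex_hull] inC lo hi) auto
    finally show ?thesis .
  qed
  show ?thesis
  proof
    have "supp (G * H) \<subseteq> supp G + supp H"
    proof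
      fix r assume "r \<in> supp (G * H)"
      then have "(\<Sum>p\<in>supp G. \<Sum>q\<in>supp H. if r = p + q then cf G p * cf H q else 0) \<noteq> 0"
        by (simp add: supp_def cf_mult)
      then obtain p where p: "p \<in> supp G" "(\<Sum>q\<in>supp H. if r = p + q then cf G p * cf H q else 0) \<noteq> 0"
        by (rule sum.not_neutral_contains_not_neutral)
      then obtain q where "q \<in> supp H" "(if r = p + q then cf G p * cf H q else 0) \<noteq> 0"
        by (elim sum.not_neutral_contains_not_neutral)
      then show "r \<in> supp G + supp H" using p(1) by (auto split: if_splits intro: set_plus_intro)
    qed
    moreover have "exponent_point (p + q) = exponent_point p + exponent_point q" for p q :: "'n exponent"
      by (simp add: prod_eq_iff vec_eq_iff lookup_add)
    ultimately have "exponent_point ` supp (G * H) \<subseteq> exponent_point ` supp G + exponent_point ` supp H"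
      by (auto elim!: set_plus_elim intro!: set_plus_intro dest!: subsetD)
    then show "convex hull (exponent_point ` supp (G * H)) \<subseteq>
      convex hull (exponent_point ` supp G) + convex hull (exponent_point ` supp H)"
      unfolding convex_hull_set_plus[symmetric] by (rule hull_mono)
    have "exponent_point ` supp G + exponent_point ` supp H \<subseteq> convex hull (exponent_point ` supp (G * H))"
    proof
      fix v assume "v \<in> exponent_point ` supp G + exponent_point ` supp H"
      then obtain b c where bc: "coeff ?p b \<noteq> 0" "coeff ?q c \<noteq> 0"
        "v = line_point \<delta> N (real b) + line_point \<delta> N' (real c)"
        unfolding exponent_point_supp[OF G(1)] exponent_point_supp[OF H(1)] by (auto elim!: set_plus_elim)
      have "m \<le> b" "n \<le> c" "b \<le> degree ?p" "c \<le> degree ?q" using bc m' n' le_degree by auto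
      then show "v \<in> convex hull (exponent_point ` supp (G * H))"
        unfolding bc(3) line_point_add by (intro line) simp_all
    qed
    then show "convex hull (exponent_point ` supp G) + convex hull (exponent_point ` supp H) \<subseteq>
      convex hull (exponent_point ` supp (G * H))"
      unfolding convex_hull_set_plus[symmetric] by (intro hull_minimal convex_convex_hull)
  qed
qed

section \<open>The factorization theorem\<close>

lemma newton_polyhedron_eq: "newton_polyhedron x f = newton_hull (Poly_Mapping.keys (expansion x f))"
  by (simp add: newton_polyhedron_def newton_hull_def)

lemma is_expansion_dvd_one:
  assumes "is_expansion x f \<rho>" "e \<in> Poly_Mapping.keys \<rho>"
  shows "Poly_Mapping.lookup \<rho> e dvd 1"
  using assms unfolding is_expansion_def in_keys_iff by blast

context weighted_parameters
begin

lemma res_unit: "a dvd 1 \<Longrightarrow> res a \<noteq> 0"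
  by (simp add: res_zero_iff unit_iff)

text \<open>An exponent whose weight is exactly the bound N is minimal in the set, since nothing
  smaller can satisfy the bound without having the same weight.\<close>

lemma upset_wset_remove:
  assumes "om A0 b = N"
  shows "upset (wset N s b - {A0})"
  unfolding upset_def
proof (intro ballI allI impI)
  fix B C assume B: "B \<in> wset N s b - {A0}" and BC: "exp_le B C"
  have "C \<noteq> A0"
  proof
    assume "C = A0"
    then have "om B b i \<le> N i" for i using BC assms by (auto simp: edge_weight_def exp_le_def)
    moreover have "N i \<le> om B b i" for i using B by (simp add: wset_def)
    ultimately have "om B b = om A0 b" using assms by (auto simp: fun_eq_iff intro: antisym)
    then show False using B om_inj by blast
  qed
  then show "C \<in> wset N s b - {A0}" using upsetD[OF upset_wset _ BC] B by blast
qed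

text \<open>Being close to the homogeneous lift of P confines every expansion of \<open>g\<close> to
  weights at least N, and at weight N it fixes the residues of the coefficients. The exponents of
  weight N are therefore the support of P, and they span the face.\<close>

lemma initial_data:
  assumes P: "whomogeneous \<delta> N P" "P \<noteq> 0" and \<delta>: "0 < \<delta> j" and \<epsilon>: "0 < \<epsilon>"
    and g: "g - hlift N (dehom P) \<in> wmod N (tot N + \<epsilon>)"
  defines "F \<equiv> convex hull (exponent_point ` supp P)"
  shows "compact_face (newton_polyhedron x g) F" "aff_dim F \<le> 1" "initial_form res x g F = P"
proof -
  define \<rho> where "\<rho> = expansion x g"
  have e: "is_expansion x g \<rho>" unfolding \<rho>_def by (rule is_expansion_expansion)
  let ?K = "Poly_Mapping.keys \<rho>"
  have "g - hlift N (dehom P) \<in> wmod N (tot N)"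
    by (rule wmod_mono[OF _ _ g]) (use \<epsilon> in auto)
  from wmod_add[OF this hlift_in_wmod[of N "dehom P"]] have gw: "g \<in> wmod N (tot N)" by simp
  have ge: "N i \<le> om (fst p) (snd p) i" if "p \<in> ?K" for p i
  proof -
    have "fst p \<in> wset N (tot N) (snd p)"
      by (rule expansion_keys_in_upset[OF e upset_wset]) (use gw that in \<open>auto simp: wmod_def\<close>)
    then show ?thesis by (simp add: wset_def)
  qed
  have low: "res (Poly_Mapping.lookup \<rho> (A, b)) = coeff (dehom P) b" if A: "om A b = N" for A b
  proof -
    let ?V = "wset N (tot N) b" and ?c = "lft (coeff (dehom P) b)"
    have AV: "A \<in> ?V" using A by (simp add: wset_def)
    have "coeff g b - ?c * monomial_value x A = coeff (g - hlift N (dehom P)) b"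
      using A wmon_om[of A b] by (simp add: coeff_hlift)
    also have "\<dots> \<in> mono_ideal x (wset N (tot N + \<epsilon>) b)" using g by (simp add: wmod_def)
    also have "mono_ideal x (wset N (tot N + \<epsilon>) b) \<subseteq> mono_ideal x (?V - {A})"
      using A \<epsilon> by (intro mono_ideal_mono) (auto simp: wset_def)
    finally have "Poly_Mapping.lookup \<rho> (A, b) - ?c \<in> level 1"
      by (rule expansion_lowest_coefficient[OF e upset_wset upset_wset_remove[OF A] AV])
    then have "res (Poly_Mapping.lookup \<rho> (A, b) - ?c) = 0" by (simp only: res_zero_iff)
    then show ?thesis by (simp add: res_diff)
  qed
  have cfP: "cf P p = res (Poly_Mapping.lookup \<rho> p)" if "om (fst p) (snd p) = N" for p
    using low[OF that] whomogeneous_lookup[OF P(1) that] by (simp add: cf_def)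
  have supp: "{p\<in>?K. om (fst p) (snd p) = N} = supp P"
  proof
    show "{p\<in>?K. om (fst p) (snd p) = N} \<subseteq> supp P"
      using cfP res_unit[OF is_expansion_dvd_one[OF e]] by (auto simp: supp_def)
    show "supp P \<subseteq> {p\<in>?K. om (fst p) (snd p) = N}"
    proof
      fix p assume p: "p \<in> supp P"
      then have w: "om (fst p) (snd p) = N" using P(1) by (simp add: whomogeneous_def)
      then have "res (Poly_Mapping.lookup \<rho> p) \<noteq> 0" using p cfP by (simp add: supp_def)
      then have "Poly_Mapping.lookup \<rho> p \<noteq> 0" by auto
      then show "p \<in> {p\<in>?K. om (fst p) (snd p) = N}" using w by (simp add: in_keys_iff)
    qed
  qed
  obtain q where "q \<in> supp P" using P(2) supp_empty_iff by blast
  then have q: "q \<in> ?K" "om (fst q) (snd q) = N" using supp by auto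
  note face = newton_hull_edge_face[of ?K \<delta> j N q, OF finite_keys \<delta>_nonneg \<delta> ge q, unfolded supp]
  show "compact_face (newton_polyhedron x g) F"
    unfolding newton_polyhedron_eq \<rho>_def[symmetric] F_def by (rule face(1))
  show "aff_dim F \<le> 1" unfolding F_def by (rule face(2))
  have "{p\<in>?K. exponent_point p \<in> F} = {p\<in>?K. om (fst p) (snd p) = N}"
    unfolding F_def using face(3) by blast
  then have eq: "{p\<in>?K. exponent_point p \<in> F} = supp P" using supp by simp
  have "initial_form res x g F =
      (\<Sum>p\<in>supp P. monom (Poly_Mapping.single (fst p) (res (Poly_Mapping.lookup \<rho> p))) (snd p))"
    unfolding initial_form_def \<rho>_def[symmetric] eq by (simp add: case_prod_unfold)
  also have "\<dots> = (\<Sum>p\<in>supp P. monom (Poly_Mapping.single (fst p) (cf P p)) (snd p))"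
    using P(1) cfP by (intro sum.cong) (auto simp: whomogeneous_def)
  also have "\<dots> = P" by (rule sum_of_terms)
  finally show "initial_form res x g F = P" .
qed

end

lemma to_residue_zero_iff: "to_residue a = 0 \<longleftrightarrow> a \<in> max_ideal"
  by (simp add: zero_residue_field_def residue_field.abs_eq_iff)

lemma completion_to_residue_hat: "coherent u \<Longrightarrow> completion_to_residue (hat u) = to_residue (u 1)"
  by (simp add: completion_to_residue.abs_eq completion_rel_self)

lemma weighted_parameters_completion:
  fixes x :: "'n::finite \<Rightarrow> 'a::regular_local_ring" and \<delta> :: "'n \<Rightarrow> real"
  assumes rsp: "regular_system_of_parameters x" and \<delta>: "\<And>i. 0 \<le> \<delta> i"
  shows "weighted_parameters (to_completion \<circ> x) completion_to_residue \<delta>"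
proof -
  interpret complete_parameters "to_completion \<circ> x" by (rule complete_parameters_completion[OF rsp])
  show ?thesis
  proof unfold_locales
    fix a b :: "'a completion"
    obtain u where u: "coherent u" "a = hat u" by (rule completion_cases)
    obtain v where v: "coherent v" "b = hat v" by (rule completion_cases)
    show "completion_to_residue (a + b) = completion_to_residue a + completion_to_residue b"
      using u v by (simp add: hat_add coherent_add completion_to_residue_hat plus_residue_field.abs_eq)
    show "completion_to_residue (a * b) = completion_to_residue a * completion_to_residue b"
      using u v by (simp add: hat_mult coherent_mult completion_to_residue_hat times_residue_field.abs_eq)
    have "completion_to_residue a = 0 \<longleftrightarrow> in_level 1 a"
      using u ideal_power_1[OF ring_ideal_max_ideal[where 'a = 'a]]
      by (simp add: completion_to_residue_hat in_level_hat to_residue_zero_iff)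
    then show "completion_to_residue a = 0 \<longleftrightarrow> a \<in> level 1"
      using in_level_iff_mono_ideal[OF rsp, of 1 a] by simp
  next
    show "completion_to_residue (1 :: 'a completion) = 1"
      by (simp add: one_residue_field_def flip: to_completion_one)
    fix c :: "'a residue_field"
    have "completion_to_residue (to_completion (rep_residue c)) = c"
      using Quotient_abs_rep[OF Quotient_residue_field] by simp
    then show "\<exists>a. completion_to_residue a = c" by blast
  qed (rule \<delta>)
qed

theorem theorem1p4:
  fixes x :: "'n::finite \<Rightarrow> 'a::regular_local_ring"
    and f :: "'a poly"
    and E :: "((real ^ 'n) \<times> real) set"
    and G H :: "('n, 'a residue_field) mpoly_Z"
  assumes "regular_system_of_parameters x"
    and "loose_edge (newton_polyhedron x f) E"
    and "descendant E"
    and "initial_form to_residue x f E = G * H"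
    and "coprime_elements G H"
    and "lead_coeff G = 1"
  shows "\<exists>(g :: 'a completion poly) (h :: 'a completion poly).
    map_poly to_completion f = g * h \<and>
    lead_coeff g = 1 \<and>
    (\<exists>E1 E2.
      compact_face (newton_polyhedron (to_completion \<circ> x) g) E1 \<and> aff_dim E1 \<le> 1 \<and>
      compact_face (newton_polyhedron (to_completion \<circ> x) h) E2 \<and> aff_dim E2 \<le> 1 \<and>
      E = E1 + E2 \<and>
      initial_form completion_to_residue (to_completion \<circ> x) g E1 = G \<and>
      initial_form completion_to_residue (to_completion \<circ> x) h E2 = H)"
proof -
  note rsp = assms(1)
  let ?y = "to_completion \<circ> x"
  interpret R: closed_parameters x by (rule closed_parameters_regular[OF rsp])
  define \<rho> where "\<rho> = expansion x f"
  have e: "is_expansion x f \<rho>" unfolding \<rho>_def by (rule R.is_expansion_expansion)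
  let ?S = "Poly_Mapping.keys \<rho>"
  have "loose_edge (newton_hull ?S) E" using assms(2) by (simp only: newton_polyhedron_eq \<rho>_def)
  from loose_edge_weights[OF finite_keys this assms(3)] obtain \<delta> M j where
    \<delta>: "\<And>i. 0 \<le> \<delta> i" "0 < \<delta> j" and M: "\<And>p i. p \<in> ?S \<Longrightarrow> M i \<le> edge_weight \<delta> (fst p) (snd p) i"
    and inE: "\<And>p. p \<in> ?S \<Longrightarrow> exponent_point p \<in> E \<longleftrightarrow> edge_weight \<delta> (fst p) (snd p) = M"
    and E: "E = convex hull (exponent_point ` {p\<in>?S. edge_weight \<delta> (fst p) (snd p) = M})" by blast
  let ?S1 = "{p\<in>?S. edge_weight \<delta> (fst p) (snd p) = M}"
  have S1: "{p\<in>?S. exponent_point p \<in> E} = ?S1" using inE by blast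
  have "G * H = (\<Sum>p\<in>?S1. monom (Poly_Mapping.single (fst p) (to_residue (Poly_Mapping.lookup \<rho> p))) (snd p))"
    unfolding assms(4)[symmetric] initial_form_def \<rho>_def[symmetric] S1 by (simp add: case_prod_unfold)
  then have "cf (G * H) p = (\<Sum>q\<in>?S1. if q = p then to_residue (Poly_Mapping.lookup \<rho> p) else 0)" for p
    by (simp add: cf_sum cf_monom)
  then have cfGH: "cf (G * H) p = (if p \<in> ?S1 then to_residue (Poly_Mapping.lookup \<rho> p) else 0)" for p
    by simp
  have unit: "to_residue (Poly_Mapping.lookup \<rho> p) \<noteq> 0" if "p \<in> ?S" for p
    using is_expansion_dvd_one[OF e that] by (simp add: to_residue_zero_iff unit_iff_notin_max_ideal)
  have suppGH: "supp (G * H) = ?S1" using unit by (auto simp: supp_def cfGH)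
  then have homGH: "whomogeneous \<delta> M (G * H)" by (simp add: whomogeneous_def)
  have "E \<noteq> {}" using assms(2) by (auto simp: loose_edge_def compact_edge_def)
  then have "?S1 \<noteq> {}" using E by auto
  then have "G * H \<noteq> 0" using suppGH supp_empty_iff by metis
  then have nz: "G \<noteq> 0" "H \<noteq> 0" by auto
  from whomogeneous_factors[OF homGH nz] obtain N N' where
    homG: "whomogeneous \<delta> N G" and homH: "whomogeneous \<delta> N' H" and MN: "M = (\<lambda>i. N i + N' i)" by blast
  let ?d = "degree G"
  \<comment> \<open>As G is monic, a pure power of Z occurs in it, and this determines the weight of
    G.\<close>
  have "cf G (0, ?d) = 1" using assms(6) by (simp add: cf_def)
  then have "(0, ?d) \<in> supp G" by (simp add: supp_def)
  then have "edge_weight \<delta> 0 ?d = N" using homG by (force simp: whomogeneous_def)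
  then have Nd: "N = (\<lambda>i. real ?d * \<delta> i)" by (auto simp: edge_weight_def fun_eq_iff)
  have cd: "coeff (dehom G) ?d = 1" using assms(6) by (simp add: coeff_dehom)
  have degG: "degree (dehom G) = ?d"
  proof (rule antisym)
    show "degree (dehom G) \<le> ?d" by (intro degree_le) (simp add: coeff_dehom coeff_eq_0)
    show "?d \<le> degree (dehom G)" using cd by (intro le_degree) simp
  qed
  have nzH: "dehom H \<noteq> 0" using whomogeneous_homogenize[OF homH] nz by (auto simp: homogenize_def)
  obtain u v where uv: "u * dehom G + v * dehom H = 1"
    using coprime_homogeneous_bezout[OF homG nz(1) homH nz(2) assms(5) \<delta>(1)] by blast
  interpret W: weighted_parameters ?y completion_to_residue \<delta>
    by (rule weighted_parameters_completion[OF rsp \<delta>(1)])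
  have valid: "\<exists>A. edge_weight \<delta> A b = L" if "whomogeneous \<delta> L P" "coeff (dehom P) b \<noteq> 0"
    for L b and P :: "('n, 'a residue_field) mpoly_Z"
    using whomogeneous_liftable[OF that(1)] that(2) by (auto simp: liftable_weight_def weight_expts_def)
  interpret F: edge_factorization ?y completion_to_residue \<delta> "dehom G" "dehom H" u v N'
  proof unfold_locales
    show "u * dehom G + v * dehom H = 1" by (fact uv)
    show "lead_coeff (dehom G) = 1" using cd degG by simp
    show "dehom H \<noteq> 0" by (fact nzH)
    show "\<exists>A. edge_weight \<delta> A b = (\<lambda>i. real (degree (dehom G)) * \<delta> i)" if "coeff (dehom G) b \<noteq> 0" for b
      using valid[OF homG that] by (simp add: degG Nd)
    show "\<exists>A. edge_weight \<delta> A b = N'" if "coeff (dehom H) b \<noteq> 0" for b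
      using valid[OF homH that] .
  qed
  have FN: "F.N = N" by (simp add: F.N_def[abs_def] degG Nd)
  \<comment> \<open>The smallest gap in total weight between the edge and the exponents off it. The
    inserted 1 covers the case of no such exponents and also accounts for the defects of lifted
    coefficients, which gain just one.\<close>
  define \<epsilon> where "\<epsilon> = Min (insert 1 ((\<lambda>p. W.tot (edge_weight \<delta> (fst p) (snd p)) - W.tot M) ` (?S - ?S1)))"
  have fin: "finite (insert 1 ((\<lambda>p. W.tot (edge_weight \<delta> (fst p) (snd p)) - W.tot M) ` (?S - ?S1)))" by simp
  have \<epsilon>1: "\<epsilon> \<le> 1" unfolding \<epsilon>_def by (rule Min_le[OF fin]) simp
  have \<epsilon>S: "W.tot M + \<epsilon> \<le> W.tot (edge_weight \<delta> (fst p) (snd p))" if "p \<in> ?S - ?S1" for p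
  proof -
    have "\<epsilon> \<le> W.tot (edge_weight \<delta> (fst p) (snd p)) - W.tot M"
      unfolding \<epsilon>_def by (rule Min_le[OF fin]) (use that in blast)
    then show ?thesis by simp
  qed
  have \<epsilon>0: "0 < \<epsilon>"
  proof -
    have "W.tot M < W.tot (edge_weight \<delta> (fst p) (snd p))" if p: "p \<in> ?S - ?S1" for p
    proof -
      have "edge_weight \<delta> (fst p) (snd p) \<noteq> M" using p by blast
      then obtain i where "edge_weight \<delta> (fst p) (snd p) i \<noteq> M i" by blast
      then have "M i < edge_weight \<delta> (fst p) (snd p) i" using M[of p i] p by simp
      then show ?thesis unfolding W.tot_def using M p by (intro sum_strict_mono_ex1) auto
    qed
    then show ?thesis unfolding \<epsilon>_def using fin by (subst Min_gr_iff) auto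
  qed
  let ?f = "map_poly to_completion f"
  have cf: "coeff ?f b = (\<Sum>A | (A, b) \<in> ?S. to_completion (Poly_Mapping.lookup \<rho> (A, b)) * monomial_value ?y A)" for b
    by (simp add: coeff_map_poly is_expansion_coeff[OF e] to_completion_sum to_completion_mult monomial_value_to_completion)
  have flift: "?f - W.hlift M (dehom (G * H)) \<in> W.wmod M (W.tot M + \<epsilon>)"
    unfolding W.wmod_def
  proof (intro CollectI allI)
    fix b
    let ?T = "{A. (A, b) \<in> ?S}" and ?We = "weight_expts \<delta> M b"
    let ?t = "\<lambda>A. to_completion (Poly_Mapping.lookup \<rho> (A, b)) * monomial_value ?y A"
    let ?I = "mono_ideal ?y (W.wset M (W.tot M + \<epsilon>) b)"
    have T: "finite ?T" by (rule R.finite_expansion_slice)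
    have 1: "(\<Sum>A\<in>?T - ?We. ?t A) \<in> ?I"
    proof (rule ideal_sum[OF ring_ideal_mono_ideal])
      fix A assume A: "A \<in> ?T - ?We"
      then have "(A, b) \<in> ?S - ?S1" by (simp add: weight_expts_def)
      then have "A \<in> W.wset M (W.tot M + \<epsilon>) b"
        using M[of "(A, b)"] \<epsilon>S[of "(A, b)"] by (auto simp: W.wset_def)
      then show "?t A \<in> ?I" by (intro ideal_mult ring_ideal_mono_ideal mono_ideal_base)
    qed
    \<comment> \<open>On the edge, f and the lift of its initial form have at most one term for each
      power of z. The two coefficients have equal residues, so their difference raises the total
      weight by one.\<close>
    have 2: "(\<Sum>A\<in>?T \<inter> ?We. ?t A) - W.lft (coeff (dehom (G * H)) b) * W.wmon M b \<in> ?I"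
    proof (cases rule: weight_expts_cases[of \<delta> M b])
      case 1
      then have "W.wmon M b = 0" by (intro W.wmon_none) (auto simp: weight_expts_def)
      then show ?thesis using 1 by (simp add: ideal_zero[OF ring_ideal_mono_ideal])
    next
      case (2 A)
      then have A: "edge_weight \<delta> A b = M" by (auto simp: weight_expts_def)
      let ?r = "to_completion (Poly_Mapping.lookup \<rho> (A, b))"
      have wm: "W.wmon M b = monomial_value ?y A" using W.wmon_om[of A b] A by simp
      have "(\<Sum>A\<in>?T \<inter> ?We. ?t A) = ?r * W.wmon M b"
      proof (cases "(A, b) \<in> ?S")
        case True
        then have "?T \<inter> ?We = {A}" using 2 by auto
        then show ?thesis by (simp add: wm)
      next
        case False
        then have "?T \<inter> ?We = {}" "Poly_Mapping.lookup \<rho> (A, b) = 0" using 2 by (auto simp: in_keys_iff)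
        then show ?thesis by simp
      qed
      moreover have "completion_to_residue ?r = coeff (dehom (G * H)) b"
      proof -
        have "coeff (dehom (G * H)) b = cf (G * H) (A, b)"
          using whomogeneous_lookup[OF homGH A] by (simp add: cf_def)
        also have "\<dots> = to_residue (Poly_Mapping.lookup \<rho> (A, b))"
        proof (cases "(A, b) \<in> ?S")
          case True
          then show ?thesis using A by (simp add: cfGH)
        next
          case False
          moreover have "to_residue (0 :: 'a) = 0" by (simp add: zero_residue_field_def)
          ultimately show ?thesis by (simp add: cfGH in_keys_iff)
        qed
        finally show ?thesis by simp
      qed
      then have "?r - W.lft (coeff (dehom (G * H)) b) \<in> W.level 1"
        unfolding W.res_zero_iff[symmetric] by (simp add: W.res_diff)
      from W.level_mult_wmon[OF this, of M b]
      have "(?r - W.lft (coeff (dehom (G * H)) b)) * W.wmon M b \<in> mono_ideal ?y (W.wset M (W.tot M + 1) b)"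
        by simp
      moreover have "mono_ideal ?y (W.wset M (W.tot M + 1) b) \<subseteq> ?I"
        using \<epsilon>1 by (intro mono_ideal_mono) (auto simp: W.wset_def)
      ultimately show ?thesis by (auto simp: left_diff_distrib)
    qed
    have "(\<Sum>A\<in>?T. ?t A) = (\<Sum>A\<in>?T - ?We. ?t A) + (\<Sum>A\<in>?T \<inter> ?We. ?t A)"
      using T by (subst sum.Int_Diff[of ?T _ ?We]) (simp_all add: add.commute)
    then have "coeff (?f - W.hlift M (dehom (G * H))) b =
       (\<Sum>A\<in>?T - ?We. ?t A) + ((\<Sum>A\<in>?T \<inter> ?We. ?t A) - W.lft (coeff (dehom (G * H)) b) * W.wmon M b)"
      by (simp only: coeff_diff cf W.coeff_hlift add_diff_eq)
    also have "\<dots> \<in> ?I" using 1 2 by (rule ideal_add[OF ring_ideal_mono_ideal])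
    finally show "coeff (?f - W.hlift M (dehom (G * H))) b \<in> ?I" .
  qed
  have "W.hlift N (dehom G) * W.hlift N' (dehom H) - W.hlift M (dehom G * dehom H) \<in> W.wmod M (W.tot M + 1)"
    unfolding MN
  proof (rule W.hlift_mult)
    show "\<exists>A. edge_weight \<delta> A i = N" if "coeff (dehom G) i \<noteq> 0" for i using valid[OF homG that] .
    show "real i * \<delta> k \<le> N' k" if i: "coeff (dehom H) i \<noteq> 0" for i k
    proof -
      obtain A where "edge_weight \<delta> A i = N'" using valid[OF homH i] by blast
      then show ?thesis using W.om_ge[of i k A] by simp
    qed
  qed
  then have gh: "F.g0 * F.h0 - W.hlift M (dehom (G * H)) \<in> W.wmod M (W.tot M + 1)"
    by (simp add: F.g0_def F.h0_def FN dehom_mult)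
  have "F.g0 * F.h0 - W.hlift M (dehom (G * H)) \<in> W.wmod M (W.tot M + \<epsilon>)"
    by (rule W.wmod_mono[OF _ _ gh]) (use \<epsilon>1 in auto)
  from W.wmod_diff[OF flift this] have start: "?f - F.g0 * F.h0 \<in> W.wmod M (W.tot M + \<epsilon>)" by simp
  \<comment> \<open>f may have a larger z-degree than its initial form, so the bound must cover
    both.\<close>
  define D where "D = max (degree ?f) (degree (dehom G) + degree (dehom H))"
  have "\<exists>g h. ?f = g * h \<and> lead_coeff g = 1 \<and>
    g - F.g0 \<in> W.wmod F.N (W.tot F.N + \<epsilon>) \<and> h - F.h0 \<in> W.wmod N' (W.tot N' + \<epsilon>)"
    by (rule F.hensel[of D]) (use start \<epsilon>0 \<epsilon>1 in \<open>auto simp: D_def coeff_eq_0 FN MN\<close>)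
  then obtain g h where fgh: "?f = g * h" "lead_coeff g = 1"
    and g: "g - W.hlift N (dehom G) \<in> W.wmod N (W.tot N + \<epsilon>)"
    and h: "h - W.hlift N' (dehom H) \<in> W.wmod N' (W.tot N' + \<epsilon>)"
    by (auto simp: FN F.g0_def F.h0_def)
  have "E = convex hull (exponent_point ` supp G) + convex hull (exponent_point ` supp H)"
    using convex_hull_supp_mult[OF homG nz(1) homH nz(2)] homGH E by (simp add: suppGH MN)
  then show ?thesis
    using fgh W.initial_data[OF homG nz(1) \<delta>(2) \<epsilon>0 g] W.initial_data[OF homH nz(2) \<delta>(2) \<epsilon>0 h] by blast
qed

end
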